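(* Let $Q$ be a quiver with a stability function $Z$ and let $l\subset\mathbb H_+$ be a ray such that $\langle\alpha,\beta\rangle=0$ whenever $\alpha,\beta\in\Gamma_+(Q)\setminus\{0\}$ satisfy $Z(\alpha),Z(\beta)\in l$ and $f_Z(\alpha),f_Z(\beta)\ne0$. Then for every $\alpha\in\Gamma_+(Q)\setminus\{0\}$ with $Z(\alpha)\in l$, the abelian quiver invariant $g_Z(\alpha)$ lies in $\mathbb N[q^{\pm\frac12}]$.
   Context: $\mathbb N=\{0,1,2,\dots\}$. $K_0(\mathrm{Var}_{\mathbb C})$ is the Grothendieck ring of complex varieties, $\mathbb L=[\mathbb A^1]$ is also denoted $q$, and $\mathcal V=K_0(\mathrm{Var}_{\mathbb C})\otimes_{\mathbb Z[\mathbb L]}\mathbb Q(\mathbb L^{1/2})$. $Q$ has vertex set $Q_0$ (possibly infinite) and arrow set $Q_1$, with finitely many arrows between any two vertices. $\Gamma(Q)$ is the group of finitely supported maps $Q_0\to\mathbb Z$, $\Gamma_+(Q)$ the submonoid of maps to $\mathbb N$; $i\in Q_0$ also denotes the corresponding basis vector. $|\alpha|=\sum_i\alpha_i$, $\alpha!=\prod_i\alpha_i!$. Put $r(\alpha,\beta)=\sum_{(a:i\to j)\in Q_1}\alpha_i\beta_j$ and $\langle\alpha,\beta\rangle=r(\beta,\alpha)-r(\alpha,\beta)$. A stability function on $Q$ is a group homomorphism $Z:\Gamma(Q)\to\mathbb C$ with $Z(i)\in\mathbb H_+=\{re^{i\pi\varphi}:r>0,\,0<\varphi\le1\}$ for all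 $i\in Q_0$. Writing $Z=-d+\sqrt{-1}\,r_Z$ with real-valued $d,r_Z$, the slope is $\mu_Z(\alpha)=d(\alpha)/r_Z(\alpha)\in\mathbb R\cup\{\infty\}$ for nonzero $\alpha\in\Gamma_+(Q)$. A representation $M$ is $Z$-semistable if $\mu_Z(\underline{\dim}N)\le\mu_Z(\underline{\dim}M)$ for all proper nonzero subrepresentations $N$. Rays are sets $\mathbb R_{>0}v$, $v\in\mathbb H_+$. For $\alpha\in\Gamma_+(Q)$ the quiver $Q(\alpha)$ has vertices $i_k$ with $i\in Q_0$, $1\le k\le\alpha_i$, and the number of arrows from $i_k$ to $j_{k'}$ equals the number of arrows from $i$ to $j$ in $Q$. It carries the induced stability function $Z(i_k)=Z(i)$. Abelian representations of $Q(\alpha)$ are representations over $\mathbb C$ with dimension one at every vertex; they form the affine space $\mathbb C^{Q(\alpha)_1}$, with $Z$-semistable locus $R_Z(Q(\alpha))$. Define $$f_Z(\alpha)=q^{\frac12(|\alpha|-r(\alpha,\alpha))}\frac{[R_Z(Q(\alpha))]}{(q-1)^{|\alpha|}}\in\mathcal V .$$ (These are rational functions of $q^{1/2}$.) For a ray $l$ as in the claim, the abelian quiver invariants $g_Z(\alpha)$, $Z(\alpha)\in l$, are defined by $$1+\sum_{Z(\alpha)\in l}f_Z(\alpha)\frac{x^\alpha}{\alpha!}=\exp\Bigg(\frac{\sum_{Z(\alpha)\in l}g_Z(\alpha)\frac{x^\alpha}{\alpha!}}{q^{1/2}-q^{-1/2}}\Bigg)$$ in the ring of commutative formal power series in the $x_i$,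 $i\in Q_0$ (sums over nonzero $\alpha\in\Gamma_+(Q)$). *)

theory Defs
  imports
    "HOL-Analysis.Analysis"
    "HOL-Library.Poly_Mapping"
    "HOL-Library.Multiset"
    "HOL-Library.Extended_Real"
    "HOL-Computational_Algebra.Polynomial"
    "HOL-Computational_Algebra.Fraction_Field"
    "Graph_Theory.Digraph"
begin

section \<open>Complex varieties\<close>

text \<open>
  Complex varieties are rendered classically, as topological spaces of closed points carrying a sheaf
  of complex-valued functions (as in Serre's FAC or Mumford's Red Book, but without requiring
  irreducibility; these are the reduced separated schemes of finite type over the complex numbers).
  Only the values of \<open>regular X\<close> on open sets matter. A section over \<open>U\<close> is normalised to be
  \<^const>\<open>undefined\<close> outside \<open>U\<close>, so that equal sections are equal HOL functions.
\<close>

record 'a fun_space =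
  zariski :: "'a topology"
  regular :: "'a set \<Rightarrow> ('a \<Rightarrow> complex) set"

abbreviation points :: "'a fun_space \<Rightarrow> 'a set" where
  "points X \<equiv> topspace (zariski X)"

definition function_sheaf :: "'a fun_space \<Rightarrow> bool" where
  "function_sheaf X \<longleftrightarrow>
     (\<forall>U. openin (zariski X) U \<longrightarrow> regular X U \<subseteq> extensional U) \<and>
     (\<forall>U W f. openin (zariski X) U \<and> openin (zariski X) W \<and> W \<subseteq> U \<and> f \<in> regular X U
        \<longrightarrow> restrict f W \<in> regular X W) \<and>
     (\<forall>U f. openin (zariski X) U \<and> f \<in> extensional U \<and>
        (\<forall>x\<in>U. \<exists>W. openin (zariski X) W \<and> x \<in> W \<and> W \<subseteq> U \<and> restrict f W \<in> regular X W)
        \<longrightarrow> f \<in> regular X U)"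

definition morphism :: "'a fun_space \<Rightarrow> 'b fun_space \<Rightarrow> ('a \<Rightarrow> 'b) \<Rightarrow> bool" where
  "morphism X Y \<phi> \<longleftrightarrow> continuous_map (zariski X) (zariski Y) \<phi> \<and>
     (\<forall>V h. openin (zariski Y) V \<and> h \<in> regular Y V \<longrightarrow>
        restrict (h \<circ> \<phi>) {x \<in> points X. \<phi> x \<in> V} \<in> regular X {x \<in> points X. \<phi> x \<in> V})"

definition isomorphic :: "'a fun_space \<Rightarrow> 'b fun_space \<Rightarrow> bool" where
  "isomorphic X Y \<longleftrightarrow> (\<exists>\<phi> \<psi>. morphism X Y \<phi> \<and> morphism Y X \<psi> \<and>
     (\<forall>x\<in>points X. \<psi> (\<phi> x) = x) \<and> (\<forall>y\<in>points Y. \<phi> (\<psi> y) = y))"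

text \<open>
  The reduced structure induced on a locally closed subset: regular functions are those that are
  locally restrictions of regular functions of the ambient space.
\<close>

definition induced :: "'a fun_space \<Rightarrow> 'a set \<Rightarrow> 'a fun_space" where
  "induced X S = \<lparr>zariski = subtopology (zariski X) S,
     regular = (\<lambda>U. {f \<in> extensional U. \<forall>x\<in>U. \<exists>W h. openin (zariski X) W \<and> x \<in> W \<and>
        h \<in> regular X W \<and> (\<forall>y\<in>W \<inter> U. f y = h y)})\<rparr>"

inductive_set poly_funs :: "'i set \<Rightarrow> (('i \<Rightarrow> complex) \<Rightarrow> complex) set" for I where
  const: "(\<lambda>_. c) \<in> poly_funs I"
| coord: "i \<in> I \<Longrightarrow> (\<lambda>x. x i) \<in> poly_funs I"
| add: "p \<in> poly_funs I \<Longrightarrow> p' \<in> poly_funs I \<Longrightarrow> (\<lambda>x. p x + p' x) \<in> poly_funs I"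
| mult: "p \<in> poly_funs I \<Longrightarrow> p' \<in> poly_funs I \<Longrightarrow> (\<lambda>x. p x * p' x) \<in> poly_funs I"

text \<open>The affine space of complex vectors indexed by a finite set \<open>I\<close>.\<close>

definition affine_space :: "'i set \<Rightarrow> ('i \<Rightarrow> complex) fun_space" where
  "affine_space I =
     (let T = topology_generated_by {{x \<in> I \<rightarrow>\<^sub>E UNIV. p x \<noteq> 0} | p. p \<in> poly_funs I}
      in \<lparr>zariski = T,
          regular = (\<lambda>U. {f \<in> extensional U. \<forall>x\<in>U. \<exists>W p p'. openin T W \<and> x \<in> W \<and> W \<subseteq> U \<and>
             p \<in> poly_funs I \<and> p' \<in> poly_funs I \<and> (\<forall>y\<in>W. p' y \<noteq> 0 \<and> f y = p y / p' y)})\<rparr>)"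

definition affine_variety :: "'a fun_space \<Rightarrow> bool" where
  "affine_variety X \<longleftrightarrow> (\<exists>n F. F \<subseteq> poly_funs {..<n::nat} \<and>
     isomorphic X (induced (affine_space {..<n}) {x \<in> {..<n} \<rightarrow>\<^sub>E UNIV. \<forall>p\<in>F. p x = 0}))"

definition prevariety :: "'a fun_space \<Rightarrow> bool" where
  "prevariety X \<longleftrightarrow> function_sheaf X \<and>
     (\<exists>\<U>. finite \<U> \<and> \<Union>\<U> = points X \<and>
        (\<forall>U\<in>\<U>. openin (zariski X) U \<and> affine_variety (induced X U)))"

text \<open>
  Separatedness is Mumford's Hausdorff axiom. The test prevarieties \<open>T\<close> have their points in the type
  \<^typ>\<open>nat \<Rightarrow> complex\<close>; a prevariety has at most continuum many points, so each of them, over any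
  type of points, is isomorphic to one of this kind.
\<close>

definition is_variety :: "'a fun_space \<Rightarrow> bool" where
  "is_variety X \<longleftrightarrow> prevariety X \<and>
     (\<forall>(T :: (nat \<Rightarrow> complex) fun_space) f g. prevariety T \<and> morphism T X f \<and> morphism T X g
        \<longrightarrow> closedin (zariski T) {t \<in> points T. f t = g t})"

text \<open>For the same reason the following type contains a copy of every complex variety.\<close>

typedef variety = "{X :: (nat \<Rightarrow> complex) fun_space. is_variety X}"
  morphisms of_variety Variety
proof -
  define E :: "(nat \<Rightarrow> complex) fun_space"
    where "E = \<lparr>zariski = discrete_topology {}, regular = extensional\<rparr>"
  have "function_sheaf E"
    unfolding function_sheaf_def E_def by auto
  then have "prevariety E"
    unfolding prevariety_def by (auto simp: E_def intro!: exI[of _ "{}"])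
  moreover have "closedin (zariski T) {t \<in> points T. f t = g t}"
    if "morphism T E f" for T :: "(nat \<Rightarrow> complex) fun_space" and f g
  proof -
    have "f \<in> points T \<rightarrow> {}"
      using that unfolding morphism_def E_def continuous_map_def by simp
    then have "points T = {}" by blast
    then have "{t \<in> points T. f t = g t} = {}" by blast
    then show ?thesis by (simp only: closedin_empty)
  qed
  ultimately show ?thesis
    unfolding is_variety_def by blast
qed

text \<open>\<open>P\<close> with the projections \<open>p\<close>, \<open>p'\<close> is a product of \<open>X\<close> and \<open>Y\<close> in the category of varieties.\<close>

definition is_product :: "variety \<Rightarrow> ((nat \<Rightarrow> complex) \<Rightarrow> (nat \<Rightarrow> complex)) \<Rightarrow>
    ((nat \<Rightarrow> complex) \<Rightarrow> (nat \<Rightarrow> complex)) \<Rightarrow> variety \<Rightarrow> variety \<Rightarrow> bool" where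
  "is_product P p p' X Y \<longleftrightarrow>
     morphism (of_variety P) (of_variety X) p \<and> morphism (of_variety P) (of_variety Y) p' \<and>
     (\<forall>T f g. morphism (of_variety T) (of_variety X) f \<and> morphism (of_variety T) (of_variety Y) g \<longrightarrow>
        (\<exists>h. morphism (of_variety T) (of_variety P) h \<and>
             (\<forall>t\<in>points (of_variety T). p (h t) = f t \<and> p' (h t) = g t)) \<and>
        (\<forall>h h'. morphism (of_variety T) (of_variety P) h \<and> morphism (of_variety T) (of_variety P) h' \<and>
             (\<forall>t\<in>points (of_variety T). p (h t) = p (h' t) \<and> p' (h t) = p' (h' t))
           \<longrightarrow> (\<forall>t\<in>points (of_variety T). h t = h' t)))"


section \<open>The Grothendieck ring of complex varieties\<close>

definition ideal_generated :: "'a::comm_ring_1 set \<Rightarrow> 'a set" where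
  "ideal_generated S = module.span (*) S"

lemma module_mult: "module ((*) :: 'a::comm_ring_1 \<Rightarrow> 'a \<Rightarrow> 'a)"
  by unfold_locales (simp_all add: algebra_simps)

lemma ideal_generated_base: "x \<in> S \<Longrightarrow> x \<in> ideal_generated S"
  unfolding ideal_generated_def by (rule module.span_base[OF module_mult])

lemma ideal_generated_0: "0 \<in> ideal_generated S"
  unfolding ideal_generated_def by (rule module.span_zero[OF module_mult])

lemma ideal_generated_add:
  "x \<in> ideal_generated S \<Longrightarrow> y \<in> ideal_generated S \<Longrightarrow> x + y \<in> ideal_generated S"
  unfolding ideal_generated_def by (rule module.span_add[OF module_mult])

lemma ideal_generated_mult: "x \<in> ideal_generated S \<Longrightarrow> a * x \<in> ideal_generated S"
  unfolding ideal_generated_def by (rule module.span_scale[OF module_mult])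

lemma ideal_generated_uminus: "x \<in> ideal_generated S \<Longrightarrow> - x \<in> ideal_generated S"
  unfolding ideal_generated_def by (rule module.span_neg[OF module_mult])

definition cong_ideal :: "'a::comm_ring_1 set \<Rightarrow> 'a \<Rightarrow> 'a \<Rightarrow> bool" where
  "cong_ideal S x y \<longleftrightarrow> x - y \<in> ideal_generated S"

lemma equivp_cong_ideal: "equivp (cong_ideal S)"
proof (rule equivpI)
  show "reflp (cong_ideal S)"
    by (simp add: reflp_def cong_ideal_def ideal_generated_0)
  show "symp (cong_ideal S)"
    unfolding symp_def cong_ideal_def by (metis ideal_generated_uminus minus_diff_eq)
  show "transp (cong_ideal S)"
    unfolding transp_def cong_ideal_def by (metis ideal_generated_add diff_add_cancel add_diff_eq)
qed

lemma cong_ideal_refl: "cong_ideal S x x"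
  by (simp add: cong_ideal_def ideal_generated_0)

lemma cong_ideal_add: "cong_ideal S (x + x') (y + y')"
  if "cong_ideal S x y" "cong_ideal S x' y'"
  using ideal_generated_add[of "x - y" S "x' - y'"] that
  by (simp add: cong_ideal_def algebra_simps)

lemma cong_ideal_uminus: "cong_ideal S (- x) (- y)" if "cong_ideal S x y"
  using ideal_generated_uminus[of "x - y" S] that by (simp add: cong_ideal_def)

lemma cong_ideal_mult: "cong_ideal S (x * x') (y * y')"
  if "cong_ideal S x y" "cong_ideal S x' y'"
proof -
  have "x * x' - y * y' = x' * (x - y) + y * (x' - y')"
    by (simp add: algebra_simps)
  with that show ?thesis
    by (simp add: cong_ideal_def ideal_generated_add ideal_generated_mult)
qed

text \<open>
  The type \<^typ>\<open>variety multiset \<Rightarrow>\<^sub>0 int\<close> is the free commutative ring on the set of varieties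
  (finitely supported integer combinations of monomials, a monomial being a multiset of varieties).
\<close>

definition k0_gen :: "variety \<Rightarrow> variety multiset \<Rightarrow>\<^sub>0 int" where
  "k0_gen X = Poly_Mapping.single {#X#} 1"

definition k0_relations :: "(variety multiset \<Rightarrow>\<^sub>0 int) set" where
  "k0_relations =
     {k0_gen X - k0_gen Y | X Y. isomorphic (of_variety X) (of_variety Y)} \<union>
     {k0_gen X - k0_gen Y - k0_gen U | X Y U.
        \<exists>S. closedin (zariski (of_variety X)) S \<and>
            isomorphic (of_variety Y) (induced (of_variety X) S) \<and>
            isomorphic (of_variety U) (induced (of_variety X) (points (of_variety X) - S))} \<union>
     {k0_gen P - k0_gen X * k0_gen Y | P X Y. \<exists>p p'. is_product P p p' X Y} \<union>
     {k0_gen P - 1 | P. isomorphic (of_variety P) (affine_space ({} :: nat set))}"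

quotient_type k0_var = "variety multiset \<Rightarrow>\<^sub>0 int" / "cong_ideal k0_relations"
  by (rule equivp_cong_ideal)

text \<open>
  The class \<^class>\<open>comm_ring_1\<close> includes the axiom that zero and one are distinct. This is true of the
  rings below, but it is a theorem about motivic measures and is not needed to define them.
\<close>

instantiation k0_var :: "{comm_ring, comm_monoid_mult}"
begin

lift_definition zero_k0_var :: k0_var is 0 .
lift_definition one_k0_var :: k0_var is 1 .
lift_definition plus_k0_var :: "k0_var \<Rightarrow> k0_var \<Rightarrow> k0_var" is "(+)"
  by (rule cong_ideal_add)
lift_definition uminus_k0_var :: "k0_var \<Rightarrow> k0_var" is uminus
  by (rule cong_ideal_uminus)
lift_definition minus_k0_var :: "k0_var \<Rightarrow> k0_var \<Rightarrow> k0_var" is "(-)"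
  unfolding diff_conv_add_uminus by (intro cong_ideal_add cong_ideal_uminus)
lift_definition times_k0_var :: "k0_var \<Rightarrow> k0_var \<Rightarrow> k0_var" is "(*)"
  by (rule cong_ideal_mult)

instance
  by standard (transfer, simp add: algebra_simps cong_ideal_refl)+

end

lift_definition k0_of_variety :: "variety \<Rightarrow> k0_var" is k0_gen .

text \<open>The class of a variety whose points may lie in any type.\<close>

definition k0_class :: "'a fun_space \<Rightarrow> k0_var" where
  "k0_class X = k0_of_variety (SOME V. isomorphic (of_variety V) X)"

definition lefschetz :: k0_var where
  "lefschetz = k0_class (affine_space {0::nat})"


section \<open>Extension of scalars to the rational functions in the square root of the Lefschetz class\<close>

text \<open>\<open>\<rat>(\<bbbL>\<^sup>1\<^sup>/\<^sup>2)\<close>; the variable \<open>q_half\<close> stands for the square root of \<open>q = \<bbbL>\<close>.\<close>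

type_synonym rat_fun = "rat poly fract"

definition q_half :: rat_fun where
  "q_half = Fract [:0, 1:] 1"

text \<open>
  The tensor product over \<open>\<int>[\<bbbL>]\<close> is the free abelian group on pairs modulo the bilinearity and
  balancing relations. Pairs are multiplied componentwise, written additively as \<^typ>\<open>'a \<Rightarrow>\<^sub>0 'b\<close>
  requires, so that the free abelian group on pairs becomes a ring with
  \<open>(a \<otimes> b) \<cdot> (a' \<otimes> b') = aa' \<otimes> bb'\<close>. The set of relations is stable under multiplication by pairs, so
  the ideal it generates is the subgroup it generates. By additivity, balancing with
  respect to the single element \<open>\<bbbL>\<close> implies balancing with respect to \<open>\<int>[\<bbbL>]\<close>.
\<close>

datatype pure_tensor = Pure k0_var rat_fun

instantiation pure_tensor :: comm_monoid_add
begin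

definition zero_pure_tensor :: pure_tensor where
  "0 = Pure 1 1"

fun plus_pure_tensor :: "pure_tensor \<Rightarrow> pure_tensor \<Rightarrow> pure_tensor" where
  "Pure a b + Pure a' b' = Pure (a * a') (b * b')"

instance
proof
  fix x y z :: pure_tensor
  show "x + y + z = x + (y + z)"
    by (cases x; cases y; cases z) (simp add: mult.assoc)
  show "x + y = y + x"
    by (cases x; cases y) (simp add: mult.commute)
  show "0 + x = x"
    by (cases x) (simp add: zero_pure_tensor_def)
qed

end

definition tensor_gen :: "k0_var \<Rightarrow> rat_fun \<Rightarrow> pure_tensor \<Rightarrow>\<^sub>0 int" where
  "tensor_gen a b = Poly_Mapping.single (Pure a b) 1"

definition tensor_relations :: "(pure_tensor \<Rightarrow>\<^sub>0 int) set" where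
  "tensor_relations =
     {tensor_gen (a + a') b - tensor_gen a b - tensor_gen a' b | a a' b. True} \<union>
     {tensor_gen a (b + b') - tensor_gen a b - tensor_gen a b' | a b b'. True} \<union>
     {tensor_gen (lefschetz * a) b - tensor_gen a (q_half\<^sup>2 * b) | a b. True}"

quotient_type motivic = "pure_tensor \<Rightarrow>\<^sub>0 int" / "cong_ideal tensor_relations"
  by (rule equivp_cong_ideal)

instantiation motivic :: "{comm_ring, comm_monoid_mult}"
begin

lift_definition zero_motivic :: motivic is 0 .
lift_definition one_motivic :: motivic is 1 .
lift_definition plus_motivic :: "motivic \<Rightarrow> motivic \<Rightarrow> motivic" is "(+)"
  by (rule cong_ideal_add)
lift_definition uminus_motivic :: "motivic \<Rightarrow> motivic" is uminus
  by (rule cong_ideal_uminus)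
lift_definition minus_motivic :: "motivic \<Rightarrow> motivic \<Rightarrow> motivic" is "(-)"
  unfolding diff_conv_add_uminus by (intro cong_ideal_add cong_ideal_uminus)
lift_definition times_motivic :: "motivic \<Rightarrow> motivic \<Rightarrow> motivic" is "(*)"
  by (rule cong_ideal_mult)

instance
  by standard (transfer, simp add: algebra_simps cong_ideal_refl)+

end

lift_definition tensor :: "k0_var \<Rightarrow> rat_fun \<Rightarrow> motivic" is tensor_gen .

definition of_rat_fun :: "rat_fun \<Rightarrow> motivic" where
  "of_rat_fun b = tensor 1 b"

definition motivic_class :: "'a fun_space \<Rightarrow> motivic" where
  "motivic_class X = tensor (k0_class X) 1"

definition nat_laurent :: "motivic set" where
  "nat_laurent =
     {of_rat_fun (\<Sum>k\<in>K. of_nat (c k) * q_half powi k) | (K :: int set) (c :: int \<Rightarrow> nat). finite K}"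

lemma of_rat_fun_mult: "of_rat_fun a * of_rat_fun b = of_rat_fun (a * b)"
  unfolding of_rat_fun_def
  by transfer (simp add: tensor_gen_def mult_single cong_ideal_refl)

lemma of_rat_fun_1: "of_rat_fun 1 = 1"
  unfolding of_rat_fun_def
  by transfer (simp add: tensor_gen_def cong_ideal_refl flip: single_one zero_pure_tensor_def)


section \<open>Quivers, stability and the semistable locus\<close>

definition quiver :: "('v, 'e) pre_digraph \<Rightarrow> bool" where
  "quiver Q \<longleftrightarrow> wf_digraph Q \<and>
     (\<forall>i\<in>verts Q. \<forall>j\<in>verts Q. finite {a \<in> arcs Q. tail Q a = i \<and> head Q a = j})"

definition Gamma :: "('v, 'e) pre_digraph \<Rightarrow> ('v \<Rightarrow>\<^sub>0 int) set" where
  "Gamma Q = {\<alpha>. Poly_Mapping.keys \<alpha> \<subseteq> verts Q}"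

definition Gamma_plus :: "('v, 'e) pre_digraph \<Rightarrow> ('v \<Rightarrow>\<^sub>0 int) set" where
  "Gamma_plus Q = {\<alpha> \<in> Gamma Q. \<forall>i. Poly_Mapping.lookup \<alpha> i \<ge> 0}"

definition height :: "('v \<Rightarrow>\<^sub>0 int) \<Rightarrow> int" where
  "height \<alpha> = (\<Sum>i\<in>Poly_Mapping.keys \<alpha>. Poly_Mapping.lookup \<alpha> i)"

definition multi_fact :: "('v \<Rightarrow>\<^sub>0 int) \<Rightarrow> nat" where
  "multi_fact \<alpha> = (\<Prod>i\<in>Poly_Mapping.keys \<alpha>. fact (nat (Poly_Mapping.lookup \<alpha> i)))"

text \<open>The sum over all arrows, restricted to the finitely many that can contribute.\<close>

definition arrow_form :: "('v, 'e) pre_digraph \<Rightarrow> ('v \<Rightarrow>\<^sub>0 int) \<Rightarrow> ('v \<Rightarrow>\<^sub>0 int) \<Rightarrow> int" where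
  "arrow_form Q \<alpha> \<beta> = (\<Sum>a\<in>{a \<in> arcs Q. tail Q a \<in> Poly_Mapping.keys \<alpha> \<and> head Q a \<in> Poly_Mapping.keys \<beta>}.
     Poly_Mapping.lookup \<alpha> (tail Q a) * Poly_Mapping.lookup \<beta> (head Q a))"

definition antisym_form :: "('v, 'e) pre_digraph \<Rightarrow> ('v \<Rightarrow>\<^sub>0 int) \<Rightarrow> ('v \<Rightarrow>\<^sub>0 int) \<Rightarrow> int" where
  "antisym_form Q \<alpha> \<beta> = arrow_form Q \<beta> \<alpha> - arrow_form Q \<alpha> \<beta>"

definition upper_half :: "complex set" where
  "upper_half = {of_real r * exp (\<i> * of_real (pi * \<phi>)) | r \<phi>. r > 0 \<and> 0 < \<phi> \<and> \<phi> \<le> 1}"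

definition is_ray :: "complex set \<Rightarrow> bool" where
  "is_ray l \<longleftrightarrow> (\<exists>v\<in>upper_half. l = {of_real r * v | r. r > 0})"

definition stability_function ::
    "('v, 'e) pre_digraph \<Rightarrow> (('v \<Rightarrow>\<^sub>0 int) \<Rightarrow> complex) \<Rightarrow> bool" where
  "stability_function Q Z \<longleftrightarrow>
     (\<forall>\<alpha>\<in>Gamma Q. \<forall>\<beta>\<in>Gamma Q. Z (\<alpha> + \<beta>) = Z \<alpha> + Z \<beta>) \<and>
     (\<forall>i\<in>verts Q. Z (Poly_Mapping.single i 1) \<in> upper_half)"

text \<open>
  For \<open>Im (Z \<alpha>) = 0\<close> the numerator is positive, and division by zero in \<^typ>\<open>ereal\<close> gives \<open>\<infinity>\<close>.
\<close>

definition slope :: "(('v \<Rightarrow>\<^sub>0 int) \<Rightarrow> complex) \<Rightarrow> ('v \<Rightarrow>\<^sub>0 int) \<Rightarrow> ereal" where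
  "slope Z \<alpha> = ereal (- Re (Z \<alpha>)) / ereal (Im (Z \<alpha>))"

definition abelian_quiver ::
    "('v, 'e) pre_digraph \<Rightarrow> ('v \<Rightarrow>\<^sub>0 int) \<Rightarrow> ('v \<times> nat, 'e \<times> nat \<times> nat) pre_digraph" where
  "abelian_quiver Q \<alpha> =
     \<lparr>verts = {(i, k). i \<in> verts Q \<and> 1 \<le> k \<and> int k \<le> Poly_Mapping.lookup \<alpha> i},
      arcs = {(a, k, k'). a \<in> arcs Q \<and> 1 \<le> k \<and> int k \<le> Poly_Mapping.lookup \<alpha> (tail Q a) \<and>
                                       1 \<le> k' \<and> int k' \<le> Poly_Mapping.lookup \<alpha> (head Q a)},
      tail = (\<lambda>(a, k, k'). (tail Q a, k)),
      head = (\<lambda>(a, k, k'). (head Q a, k'))\<rparr>"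

definition induced_stability ::
    "(('v \<Rightarrow>\<^sub>0 int) \<Rightarrow> complex) \<Rightarrow> ('v \<times> nat \<Rightarrow>\<^sub>0 int) \<Rightarrow> complex" where
  "induced_stability Z \<beta> =
     (\<Sum>v\<in>Poly_Mapping.keys \<beta>. of_int (Poly_Mapping.lookup \<beta> v) * Z (Poly_Mapping.single (fst v) 1))"

text \<open>
  A representation of a quiver \<open>P\<close> with the space \<open>\<complex>\<close> at every vertex is a family \<open>x\<close> of scalars
  indexed by the arrows. A subrepresentation is a family \<open>N\<close> of linear subspaces of \<open>\<complex>\<close>.
\<close>

definition subrep :: "('v, 'e) pre_digraph \<Rightarrow> ('e \<Rightarrow> complex) \<Rightarrow> ('v \<Rightarrow> complex set) \<Rightarrow> bool" where
  "subrep P x N \<longleftrightarrow> (\<forall>v\<in>verts P. vector_space_over_itself.subspace (N v)) \<and>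
     (\<forall>a\<in>arcs P. \<forall>z\<in>N (tail P a). x a * z \<in> N (head P a))"

definition dim_vector :: "('v, 'e) pre_digraph \<Rightarrow> ('v \<Rightarrow> complex set) \<Rightarrow> 'v \<Rightarrow>\<^sub>0 int" where
  "dim_vector P N =
     (\<Sum>v\<in>verts P. Poly_Mapping.single v (int (vector_space_over_itself.dim (N v))))"

definition semistable ::
    "('v, 'e) pre_digraph \<Rightarrow> (('v \<Rightarrow>\<^sub>0 int) \<Rightarrow> complex) \<Rightarrow> ('e \<Rightarrow> complex) \<Rightarrow> bool" where
  "semistable P W x \<longleftrightarrow>
     (\<forall>N. subrep P x N \<and> (\<exists>v\<in>verts P. N v \<noteq> {0}) \<and> (\<exists>v\<in>verts P. N v \<noteq> UNIV)
        \<longrightarrow> slope W (dim_vector P N) \<le> slope W (dim_vector P (\<lambda>_. UNIV)))"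

definition semistable_locus ::
    "('v, 'e) pre_digraph \<Rightarrow> (('v \<Rightarrow>\<^sub>0 int) \<Rightarrow> complex) \<Rightarrow> ('e \<Rightarrow> complex) fun_space" where
  "semistable_locus P W =
     induced (affine_space (arcs P)) {x \<in> arcs P \<rightarrow>\<^sub>E UNIV. semistable P W x}"

definition f_inv ::
    "('v, 'e) pre_digraph \<Rightarrow> (('v \<Rightarrow>\<^sub>0 int) \<Rightarrow> complex) \<Rightarrow> ('v \<Rightarrow>\<^sub>0 int) \<Rightarrow> motivic" where
  "f_inv Q Z \<alpha> =
     of_rat_fun (q_half powi (height \<alpha> - arrow_form Q \<alpha> \<alpha>) / (q_half\<^sup>2 - 1) powi (height \<alpha>)) *
     motivic_class (semistable_locus (abelian_quiver Q \<alpha>) (induced_stability Z))"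


section \<open>Abelian quiver invariants\<close>

text \<open>
  Commutative power series in the variables \<open>x\<^sub>i\<close>, \<open>i \<in> Q\<^sub>0\<close>, are given by their coefficients, which are
  indexed by \<open>\<Gamma>\<^sub>+(Q)\<close>.
\<close>

type_synonym 'v mps = "('v \<Rightarrow>\<^sub>0 int) \<Rightarrow> motivic"

definition mps_one :: "'v mps" where
  "mps_one \<alpha> = (if \<alpha> = 0 then 1 else 0)"

definition mps_mult :: "('v, 'e) pre_digraph \<Rightarrow> 'v mps \<Rightarrow> 'v mps \<Rightarrow> 'v mps" where
  "mps_mult Q A B \<alpha> =
     (\<Sum>(\<beta>, \<gamma>)\<in>{(\<beta>, \<gamma>). \<beta> \<in> Gamma_plus Q \<and> \<gamma> \<in> Gamma_plus Q \<and> \<beta> + \<gamma> = \<alpha>}. A \<beta> * B \<gamma>)"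

primrec mps_power :: "('v, 'e) pre_digraph \<Rightarrow> 'v mps \<Rightarrow> nat \<Rightarrow> 'v mps" where
  "mps_power Q A 0 = mps_one"
| "mps_power Q A (Suc n) = mps_mult Q A (mps_power Q A n)"

text \<open>
  Exponential of a series without constant term; the \<open>n\<close>-th power of such a series has no coefficients
  at \<open>\<alpha>\<close> with \<open>\<bar>\<alpha>\<bar> < n\<close>.
\<close>

definition mps_exp :: "('v, 'e) pre_digraph \<Rightarrow> 'v mps \<Rightarrow> 'v mps" where
  "mps_exp Q A \<alpha> = (\<Sum>n\<le>nat (height \<alpha>). of_rat_fun (1 / fact n) * mps_power Q A n \<alpha>)"

definition ray_classes ::
    "('v, 'e) pre_digraph \<Rightarrow> (('v \<Rightarrow>\<^sub>0 int) \<Rightarrow> complex) \<Rightarrow> complex set \<Rightarrow> ('v \<Rightarrow>\<^sub>0 int) set" where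
  "ray_classes Q Z l = {\<alpha> \<in> Gamma_plus Q - {0}. Z \<alpha> \<in> l}"

text \<open>The series \<open>\<Sum> h(\<alpha>) x\<^sup>\<alpha> / \<alpha>!\<close> over \<open>Z(\<alpha>) \<in> l\<close>.\<close>

definition ray_series :: "('v, 'e) pre_digraph \<Rightarrow> (('v \<Rightarrow>\<^sub>0 int) \<Rightarrow> complex) \<Rightarrow> complex set \<Rightarrow>
    'v mps \<Rightarrow> 'v mps" where
  "ray_series Q Z l h \<alpha> =
     (if \<alpha> \<in> ray_classes Q Z l then h \<alpha> * of_rat_fun (1 / of_nat (multi_fact \<alpha>)) else 0)"

text \<open>The invariants are normalised to be zero off the ray.\<close>

definition is_abelian_invariant :: "('v, 'e) pre_digraph \<Rightarrow> (('v \<Rightarrow>\<^sub>0 int) \<Rightarrow> complex) \<Rightarrow> complex set \<Rightarrow>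
    (('v \<Rightarrow>\<^sub>0 int) \<Rightarrow> motivic) \<Rightarrow> bool" where
  "is_abelian_invariant Q Z l g \<longleftrightarrow>
     (\<forall>\<alpha>. \<alpha> \<notin> ray_classes Q Z l \<longrightarrow> g \<alpha> = 0) \<and>
     (\<forall>\<alpha>\<in>Gamma_plus Q.
        mps_one \<alpha> + ray_series Q Z l (f_inv Q Z) \<alpha> =
        mps_exp Q (\<lambda>\<beta>. ray_series Q Z l g \<beta> * of_rat_fun (1 / (q_half - 1 / q_half))) \<alpha>)"

definition abelian_invariant :: "('v, 'e) pre_digraph \<Rightarrow> (('v \<Rightarrow>\<^sub>0 int) \<Rightarrow> complex) \<Rightarrow> complex set \<Rightarrow>
    ('v \<Rightarrow>\<^sub>0 int) \<Rightarrow> motivic" where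
  "abelian_invariant Q Z l = (THE g. is_abelian_invariant Q Z l g)"


subsection \<open>Existence and uniqueness of the invariants\<close>

lemma Gamma_plus_0: "0 \<in> Gamma_plus Q"
  by (simp add: Gamma_plus_def Gamma_def)

lemma Gamma_plus_add: "\<alpha> + \<beta> \<in> Gamma_plus Q" if "\<alpha> \<in> Gamma_plus Q" "\<beta> \<in> Gamma_plus Q"
  using that Poly_Mapping.keys_add[of \<alpha> \<beta>]
  by (fastforce simp: Gamma_plus_def Gamma_def lookup_add)

lemma height_superset:
  assumes "finite A" "Poly_Mapping.keys \<alpha> \<subseteq> A"
  shows "height \<alpha> = (\<Sum>i\<in>A. Poly_Mapping.lookup \<alpha> i)"
  unfolding height_def using assms
  by (intro sum.mono_neutral_left) (auto simp: in_keys_iff)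

lemma height_add: "height (\<alpha> + \<beta>) = height \<alpha> + height \<beta>"
proof -
  let ?A = "Poly_Mapping.keys \<alpha> \<union> Poly_Mapping.keys \<beta>"
  have "Poly_Mapping.keys (\<alpha> + \<beta>) \<subseteq> ?A"
    by (rule Poly_Mapping.keys_add)
  then show ?thesis
    by (simp add: height_superset[of ?A] lookup_add sum.distrib)
qed

lemma height_pos: "height \<alpha> > 0" if "\<alpha> \<in> Gamma_plus Q" "\<alpha> \<noteq> 0"
  unfolding height_def
proof (rule sum_pos)
  show "Poly_Mapping.keys \<alpha> \<noteq> {}"
    using that by simp
  show "0 < Poly_Mapping.lookup \<alpha> i" if "i \<in> Poly_Mapping.keys \<alpha>" for i
  proof -
    have "Poly_Mapping.lookup \<alpha> i \<ge> 0"
      using \<open>\<alpha> \<in> Gamma_plus Q\<close> by (simp add: Gamma_plus_def)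
    with that show ?thesis by (simp add: in_keys_iff)
  qed
qed simp

lemma height_0 [simp]: "height 0 = 0"
  by (simp add: height_def)

lemma finite_splits:
  fixes \<alpha> :: "'a \<Rightarrow>\<^sub>0 int"
  shows "finite {(\<beta>, \<gamma>). \<beta> \<in> Gamma_plus Q \<and> \<gamma> \<in> Gamma_plus Q \<and> \<beta> + \<gamma> = \<alpha>}" (is "finite ?S")
proof -
  let ?K = "Poly_Mapping.keys \<alpha>"
  let ?B = "\<Union>i\<in>?K. {0..Poly_Mapping.lookup \<alpha> i}"
  let ?F = "{f. \<forall>i. (i \<in> ?K \<longrightarrow> f i \<in> ?B) \<and> (i \<notin> ?K \<longrightarrow> f i = 0)}"
  have "finite ?F"
    by (intro finite_set_of_finite_funs) auto
  moreover have "(\<lambda>(\<beta>, \<gamma>). Poly_Mapping.lookup \<beta>) ` ?S \<subseteq> ?F"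
  proof clarify
    fix \<beta> \<gamma> i
    assume *: "\<beta> \<in> Gamma_plus Q" "\<gamma> \<in> Gamma_plus Q" "\<alpha> = \<beta> + \<gamma>"
    then have nn: "Poly_Mapping.lookup \<beta> i \<ge> 0" "Poly_Mapping.lookup \<gamma> i \<ge> 0"
      by (auto simp: Gamma_plus_def)
    show "(i \<in> Poly_Mapping.keys (\<beta> + \<gamma>) \<longrightarrow> Poly_Mapping.lookup \<beta> i \<in>
            (\<Union>i\<in>Poly_Mapping.keys (\<beta> + \<gamma>). {0..Poly_Mapping.lookup (\<beta> + \<gamma>) i})) \<and>
          (i \<notin> Poly_Mapping.keys (\<beta> + \<gamma>) \<longrightarrow> Poly_Mapping.lookup \<beta> i = 0)"
      using nn by (force simp: in_keys_iff lookup_add)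
  qed
  moreover have "inj_on (\<lambda>(\<beta>, \<gamma>). Poly_Mapping.lookup \<beta>) ?S"
  proof (rule inj_onI, clarify)
    fix \<beta> \<gamma> \<beta>' \<gamma>' :: "'a \<Rightarrow>\<^sub>0 int"
    assume "\<beta>' + \<gamma>' = \<beta> + \<gamma>" "Poly_Mapping.lookup \<beta> = Poly_Mapping.lookup \<beta>'"
    then show "\<beta> = \<beta>' \<and> \<gamma> = \<gamma>'"
      by (metis Poly_Mapping.lookup_inject add_left_cancel)
  qed
  ultimately show ?thesis
    using finite_imageD[of "\<lambda>(\<beta>, \<gamma>). Poly_Mapping.lookup \<beta>" ?S] finite_subset[of _ ?F] by simp
qed

lemma mps_mult_one_right:
  fixes \<alpha> :: "'a \<Rightarrow>\<^sub>0 int"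
  assumes "\<alpha> \<in> Gamma_plus Q"
  shows "mps_mult Q A mps_one \<alpha> = A \<alpha>"
proof -
  let ?S = "{(\<beta>, \<gamma>). \<beta> \<in> Gamma_plus Q \<and> \<gamma> \<in> Gamma_plus Q \<and> \<beta> + \<gamma> = \<alpha>}"
  have "mps_mult Q A mps_one \<alpha> = (\<Sum>(\<beta>, \<gamma>)\<in>{(\<alpha>, 0 :: 'a \<Rightarrow>\<^sub>0 int)}. A \<beta> * mps_one \<gamma>)"
    unfolding mps_mult_def
  proof (rule sum.mono_neutral_right)
    show "finite ?S" by (rule finite_splits)
    show "{(\<alpha>, 0)} \<subseteq> ?S"
      using assms Gamma_plus_0[of Q] by auto
  qed (auto simp: mps_one_def split: if_splits)
  then show ?thesis by (simp add: mps_one_def)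
qed

lemma mps_power_eq_lower:
  assumes "\<And>\<beta>. \<beta> \<in> Gamma_plus Q \<Longrightarrow> height \<beta> < N \<Longrightarrow> A \<beta> = B \<beta>"
  shows "\<alpha> \<in> Gamma_plus Q \<Longrightarrow> height \<alpha> < N \<Longrightarrow> mps_power Q A n \<alpha> = mps_power Q B n \<alpha>"
proof (induction n arbitrary: \<alpha>)
  case (Suc n)
  have "A \<beta> * mps_power Q A n \<gamma> = B \<beta> * mps_power Q B n \<gamma>"
    if "\<beta> \<in> Gamma_plus Q" "\<gamma> \<in> Gamma_plus Q" "\<beta> + \<gamma> = \<alpha>" for \<beta> \<gamma>
  proof -
    have "height \<beta> \<ge> 0" "height \<gamma> \<ge> 0"
      using that height_pos by (metis height_0 less_imp_le order_refl)+
    then have "height \<beta> < N" "height \<gamma> < N"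
      using Suc.prems that(3) height_add[of \<beta> \<gamma>] by auto
    with that Suc.IH assms show ?thesis by simp
  qed
  then show ?case
    by (simp add: mps_mult_def cong: sum.cong) (intro sum.cong, auto)
qed simp

lemma mps_power_0:
  assumes "A 0 = 0"
  shows "mps_power Q A (Suc n) 0 = 0"
proof -
  have "A \<beta> * mps_power Q A n \<gamma> = 0"
    if "\<beta> \<in> Gamma_plus Q" "\<gamma> \<in> Gamma_plus Q" "\<beta> + \<gamma> = 0" for \<beta> \<gamma>
  proof -
    have "\<beta> = 0"
      using that height_pos[of \<beta> Q] height_pos[of \<gamma> Q] height_add[of \<beta> \<gamma>]
      by (cases "\<beta> = 0"; cases "\<gamma> = 0") auto
    with assms show ?thesis by simp
  qed
  then show ?thesis
    by (auto simp: mps_mult_def intro!: sum.neutral)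
qed

lemma mps_power_eq:
  assumes AB: "\<And>\<beta>. \<beta> \<in> Gamma_plus Q \<Longrightarrow> height \<beta> < height \<alpha> \<Longrightarrow> A \<beta> = B \<beta>"
    and 0: "A 0 = 0" "B 0 = 0" and "n \<ge> 2"
  shows "mps_power Q A n \<alpha> = mps_power Q B n \<alpha>"
proof -
  obtain m where n: "n = Suc (Suc m)"
    using \<open>n \<ge> 2\<close> by (auto simp: numeral_2_eq_2 Suc_le_eq dest!: less_imp_Suc_add)
  have "A \<beta> * mps_power Q A (Suc m) \<gamma> = B \<beta> * mps_power Q B (Suc m) \<gamma>"
    if s: "\<beta> \<in> Gamma_plus Q" "\<gamma> \<in> Gamma_plus Q" "\<beta> + \<gamma> = \<alpha>" for \<beta> \<gamma>
  proof (cases "\<beta> = 0 \<or> \<gamma> = 0")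
    case True
    with 0 mps_power_0[of A Q m] mps_power_0[of B Q m] show ?thesis
      by (auto simp del: mps_power.simps)
  next
    case False
    then have "height \<beta> < height \<alpha>" "height \<gamma> < height \<alpha>"
      using s height_pos[of \<beta> Q] height_pos[of \<gamma> Q] height_add[of \<beta> \<gamma>] by auto
    with s AB mps_power_eq_lower[of Q "height \<alpha>" A B \<gamma> "Suc m"] show ?thesis
      by (simp del: mps_power.simps)
  qed
  then show ?thesis
    unfolding n mps_power.simps(2)[of _ _ "Suc m"] mps_mult_def[of Q _ "mps_power Q _ (Suc m)"]
    by (intro sum.cong) auto
qed

lemma mps_power_support:
  assumes add: "\<And>\<beta> \<gamma>. \<beta> \<in> S \<Longrightarrow> \<gamma> \<in> S \<Longrightarrow> \<beta> + \<gamma> \<in> S"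
    and A: "\<And>\<beta>. \<beta> \<notin> S \<Longrightarrow> A \<beta> = 0" and "\<alpha> \<notin> S" "\<alpha> \<noteq> 0"
  shows "mps_power Q A n \<alpha> = 0"
  using assms(3,4)
proof (induction n arbitrary: \<alpha>)
  case (Suc n)
  have "A \<beta> * mps_power Q A n \<gamma> = 0" if "\<beta> + \<gamma> = \<alpha>" for \<beta> \<gamma>
  proof (cases "\<beta> \<in> S")
    case True
    then have "\<gamma> \<notin> S" "\<gamma> \<noteq> 0"
      using that add Suc.prems by auto
    with Suc.IH show ?thesis by simp
  qed (simp add: A)
  then show ?case
    by (auto simp: mps_mult_def intro!: sum.neutral)
qed (simp add: mps_one_def)

definition mps_exp_tail :: "('v, 'e) pre_digraph \<Rightarrow> 'v mps \<Rightarrow> 'v mps" where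
  "mps_exp_tail Q A \<alpha> = (\<Sum>n\<in>{2..nat (height \<alpha>)}. of_rat_fun (1 / fact n) * mps_power Q A n \<alpha>)"

lemma mps_exp_0: "mps_exp Q A 0 = 1"
  by (simp add: mps_exp_def mps_one_def of_rat_fun_1)

lemma mps_exp_split:
  assumes "\<alpha> \<in> Gamma_plus Q" "\<alpha> \<noteq> 0"
  shows "mps_exp Q A \<alpha> = A \<alpha> + mps_exp_tail Q A \<alpha>"
proof -
  have "nat (height \<alpha>) \<ge> 1"
    using height_pos[OF assms] by simp
  then have "{..nat (height \<alpha>)} = {0, 1} \<union> {2..nat (height \<alpha>)}"
    by auto
  then have "mps_exp Q A \<alpha> =
      (\<Sum>n\<in>{0, 1}. of_rat_fun (1 / fact n) * mps_power Q A n \<alpha>) + mps_exp_tail Q A \<alpha>"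
    unfolding mps_exp_def mps_exp_tail_def by (simp only:) (rule sum.union_disjoint, auto)
  with assms show ?thesis
    by (simp add: mps_one_def of_rat_fun_1 mps_mult_one_right)
qed

lemma mps_exp_tail_eq:
  assumes "\<And>\<beta>. \<beta> \<in> Gamma_plus Q \<Longrightarrow> height \<beta> < height \<alpha> \<Longrightarrow> A \<beta> = B \<beta>"
    and "A 0 = 0" "B 0 = 0"
  shows "mps_exp_tail Q A \<alpha> = mps_exp_tail Q B \<alpha>"
proof -
  have "mps_power Q A n \<alpha> = mps_power Q B n \<alpha>" if "n \<ge> 2" for n
    using assms that by (rule mps_power_eq)
  then show ?thesis
    by (simp add: mps_exp_tail_def)
qed

text \<open>Existence and uniqueness of logarithms supported on a subsemigroup \<open>S\<close>.\<close>

lemma ex1_mps_log: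
  assumes S: "S \<subseteq> Gamma_plus Q - {0}" and add: "\<And>\<beta> \<gamma>. \<beta> \<in> S \<Longrightarrow> \<gamma> \<in> S \<Longrightarrow> \<beta> + \<gamma> \<in> S"
    and F: "\<And>\<beta>. \<beta> \<notin> S \<Longrightarrow> F \<beta> = 0"
  shows "\<exists>!A. (\<forall>\<alpha>. \<alpha> \<notin> S \<longrightarrow> A \<alpha> = 0) \<and>
              (\<forall>\<alpha>\<in>Gamma_plus Q. mps_one \<alpha> + F \<alpha> = mps_exp Q A \<alpha>)" (is "\<exists>!A. ?P A")
proof (rule ex_ex1I)
  define H where "H = rec_nat (\<lambda>_. 0) (\<lambda>_ A \<alpha>. if \<alpha> \<in> S then F \<alpha> - mps_exp_tail Q A \<alpha> else 0)"
  have H_0: "H 0 = (\<lambda>_. 0)"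
    and H_Suc: "H (Suc N) = (\<lambda>\<alpha>. if \<alpha> \<in> S then F \<alpha> - mps_exp_tail Q (H N) \<alpha> else 0)" for N
    unfolding H_def by simp_all
  have H_out: "H N \<alpha> = 0" if "\<alpha> \<notin> S" for N \<alpha>
    using that by (cases N) (simp_all add: H_0 H_Suc)
  have H_at_0: "H N 0 = 0" for N
    using H_out S by blast
  have stable: "H (Suc N) \<alpha> = H N \<alpha>" if "\<alpha> \<in> Gamma_plus Q" "height \<alpha> \<le> int N" for N \<alpha>
    using that
  proof (induction N arbitrary: \<alpha>)
    case 0
    then have "\<alpha> = 0" using height_pos[of \<alpha> Q] by auto
    then show ?case by (simp add: H_at_0)
  next
    case (Suc N)
    have "mps_exp_tail Q (H (Suc N)) \<alpha> = mps_exp_tail Q (H N) \<alpha>"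
      using Suc by (intro mps_exp_tail_eq H_at_0) auto
    then show ?case
      by (subst (1 2) H_Suc) simp
  qed
  have stable': "H (N + k) \<alpha> = H N \<alpha>" if "\<alpha> \<in> Gamma_plus Q" "height \<alpha> \<le> int N" for N k \<alpha>
    using that by (induction k) (simp_all add: stable)
  define A where "A = (\<lambda>\<alpha>. H (nat (height \<alpha>)) \<alpha>)"
  have A_out: "A \<alpha> = 0" if "\<alpha> \<notin> S" for \<alpha>
    using that by (simp add: A_def H_out)
  have A_eq: "A \<alpha> = F \<alpha> - mps_exp_tail Q A \<alpha>" if "\<alpha> \<in> S" for \<alpha>
  proof -
    have \<alpha>: "\<alpha> \<in> Gamma_plus Q" "height \<alpha> > 0"
      using S that height_pos by auto
    obtain N where N: "nat (height \<alpha>) = Suc N"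
      using \<alpha> by (cases "nat (height \<alpha>)") auto
    have "mps_exp_tail Q A \<alpha> = mps_exp_tail Q (H N) \<alpha>"
    proof (intro mps_exp_tail_eq H_at_0)
      fix \<beta> assume \<beta>: "\<beta> \<in> Gamma_plus Q" "height \<beta> < height \<alpha>"
      have "height \<beta> \<ge> 0"
        using height_pos[OF \<beta>(1)] by (cases "\<beta> = 0") auto
      then show "A \<beta> = H N \<beta>"
        using stable'[of \<beta> "nat (height \<beta>)" "N - nat (height \<beta>)"] \<beta> N
        by (simp add: A_def)
    qed (simp add: A_def H_0)
    with that N show ?thesis
      by (simp add: A_def H_Suc)
  qed
  have "?P A"
  proof (intro conjI allI impI ballI A_out)
    fix \<alpha> assume \<alpha>: "\<alpha> \<in> Gamma_plus Q"
    show "mps_one \<alpha> + F \<alpha> = mps_exp Q A \<alpha>"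
    proof (cases "\<alpha> = 0")
      case True
      moreover have "F 0 = 0" using F S by blast
      ultimately show ?thesis by (simp add: mps_exp_0 mps_one_def)
    next
      case False
      show ?thesis
      proof (cases "\<alpha> \<in> S")
        case True
        then show ?thesis
          using A_eq[of \<alpha>] False \<alpha> by (simp add: mps_exp_split mps_one_def)
      next
        case nS: False
        have "mps_power Q A n \<alpha> = 0" for n
          using mps_power_support[of S A \<alpha> Q n] add A_out nS False by blast
        with nS False show ?thesis
          by (simp add: mps_exp_def mps_one_def F)
      qed
    qed
  qed
  then show "\<exists>A. ?P A" by blast
next
  fix A B assume A: "?P A" and B: "?P B"
  have AB0: "A 0 = 0" "B 0 = 0"
    using A B S by auto
  have "A \<alpha> = B \<alpha>" if "\<alpha> \<in> Gamma_plus Q" for \<alpha>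
    using that
  proof (induction "nat (height \<alpha>)" arbitrary: \<alpha> rule: less_induct)
    case less
    show ?case
    proof (cases "\<alpha> = 0")
      case False
      have "A \<beta> = B \<beta>" if "\<beta> \<in> Gamma_plus Q" "height \<beta> < height \<alpha>" for \<beta>
        using less.hyps[of \<beta>] that height_pos[OF less.prems False] by simp
      then have "mps_exp_tail Q A \<alpha> = mps_exp_tail Q B \<alpha>"
        by (intro mps_exp_tail_eq AB0)
      moreover have "mps_exp Q A \<alpha> = mps_exp Q B \<alpha>"
        using A B less.prems by metis
      ultimately show ?thesis
        using less.prems False by (simp add: mps_exp_split)
    qed (simp add: AB0)
  qed
  moreover have "A \<alpha> = B \<alpha>" if "\<alpha> \<notin> Gamma_plus Q" for \<alpha>
  proof -
    have "\<alpha> \<notin> S" using that S by blast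
    with A B show ?thesis by simp
  qed
  ultimately show "A = B" by blast
qed

lemma ray_classes_add:
  assumes "stability_function Q Z" "is_ray l" "\<beta> \<in> ray_classes Q Z l" "\<gamma> \<in> ray_classes Q Z l"
  shows "\<beta> + \<gamma> \<in> ray_classes Q Z l"
proof -
  have \<beta>\<gamma>: "\<beta> \<in> Gamma_plus Q" "\<gamma> \<in> Gamma_plus Q" "\<beta> \<noteq> 0" "\<gamma> \<noteq> 0" "Z \<beta> \<in> l" "Z \<gamma> \<in> l"
    using assms(3,4) by (auto simp: ray_classes_def)
  have "Z (\<beta> + \<gamma>) = Z \<beta> + Z \<gamma>"
    using assms(1) \<beta>\<gamma> by (auto simp: stability_function_def Gamma_plus_def)
  moreover obtain v r s where "Z \<beta> = of_real r * v" "Z \<gamma> = of_real s * v" "r > 0" "s > 0"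
      and l: "l = {of_real r * v | r. r > 0}"
    using assms(2) \<beta>\<gamma> unfolding is_ray_def by auto
  ultimately have "Z (\<beta> + \<gamma>) = of_real (r + s) * v" "r + s > 0"
    by (simp_all add: algebra_simps)
  then have "Z (\<beta> + \<gamma>) \<in> l" unfolding l by blast
  moreover have "\<beta> + \<gamma> \<noteq> 0"
    using height_pos[of \<beta> Q] height_pos[of \<gamma> Q] height_add[of \<beta> \<gamma>] \<beta>\<gamma> by auto
  ultimately show ?thesis
    using \<beta>\<gamma> by (simp add: ray_classes_def Gamma_plus_add)
qed

lemma ex1_abelian_invariant:
  assumes "stability_function Q Z" "is_ray l"
  shows "\<exists>!g. is_abelian_invariant Q Z l g"
proof -
  let ?S = "ray_classes Q Z l"
  define u where "u = (\<lambda>\<alpha>::'a \<Rightarrow>\<^sub>0 int. 1 / of_nat (multi_fact \<alpha>) * (1 / (q_half - 1 / q_half)))"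
  have "q_half \<noteq> 0" "q_half\<^sup>2 \<noteq> 1"
    by (simp_all add: q_half_def Zero_fract_def One_fract_def eq_fract power2_eq_square
          poly_eq_iff[of _ 1]) (auto simp: coeff_pCons split: nat.splits)
  then have "q_half - 1 / q_half \<noteq> 0"
    by (simp add: field_simps power2_eq_square)
  moreover have "(of_nat (multi_fact \<alpha>) :: rat_fun) \<noteq> 0" for \<alpha> :: "'a \<Rightarrow>\<^sub>0 int"
  proof -
    have "multi_fact \<alpha> \<noteq> 0"
      by (simp add: multi_fact_def)
    then have "(of_nat (multi_fact \<alpha>) :: rat poly) \<noteq> 0"
      by simp
    then show ?thesis
      unfolding of_nat_fract Zero_fract_def by (simp add: eq_fract)
  qed
  ultimately have u: "u \<alpha> \<noteq> 0" for \<alpha>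
    by (simp add: u_def)
  define T where "T = (\<lambda>g \<alpha>. ray_series Q Z l g \<alpha> * of_rat_fun (1 / (q_half - 1 / q_half)))"
  have T: "T g \<alpha> = (if \<alpha> \<in> ?S then g \<alpha> * of_rat_fun (u \<alpha>) else 0)" for g \<alpha>
    by (simp add: T_def ray_series_def u_def mult.assoc of_rat_fun_mult)
  define T' where "T' = (\<lambda>A \<alpha>. if \<alpha> \<in> ?S then A \<alpha> * of_rat_fun (1 / u \<alpha>) else 0)"
  have inv: "x * of_rat_fun (u \<alpha>) * of_rat_fun (1 / u \<alpha>) = x"
      "x * of_rat_fun (1 / u \<alpha>) * of_rat_fun (u \<alpha>) = x" for x \<alpha>
    by (simp_all add: mult.assoc of_rat_fun_mult of_rat_fun_1 u)
  define L where "L = (\<lambda>A. (\<forall>\<alpha>. \<alpha> \<notin> ?S \<longrightarrow> A \<alpha> = 0) \<and>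
    (\<forall>\<alpha>\<in>Gamma_plus Q. mps_one \<alpha> + ray_series Q Z l (f_inv Q Z) \<alpha> = mps_exp Q A \<alpha>))"
  have "\<exists>!A. L A"
    unfolding L_def using assms
    by (intro ex1_mps_log ray_classes_add) (auto simp: ray_classes_def ray_series_def)
  then obtain A where A: "L A" and uniq: "\<And>B. L B \<Longrightarrow> B = A" by blast
  have inv_iff: "is_abelian_invariant Q Z l g \<longleftrightarrow> (\<forall>\<alpha>. \<alpha> \<notin> ?S \<longrightarrow> g \<alpha> = 0) \<and> L (T g)" for g
  proof -
    have "is_abelian_invariant Q Z l g \<longleftrightarrow> (\<forall>\<alpha>. \<alpha> \<notin> ?S \<longrightarrow> g \<alpha> = 0) \<and>
      (\<forall>\<alpha>\<in>Gamma_plus Q. mps_one \<alpha> + ray_series Q Z l (f_inv Q Z) \<alpha> = mps_exp Q (T g) \<alpha>)"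
      unfolding is_abelian_invariant_def T_def ..
    then show ?thesis by (simp add: T L_def)
  qed
  have A_out: "A \<alpha> = 0" if "\<alpha> \<notin> ?S" for \<alpha>
    using A that by (simp add: L_def)
  have "T (T' A) = A"
    by (rule ext) (simp add: T T'_def inv A_out)
  with A have "is_abelian_invariant Q Z l (T' A)"
    by (simp add: inv_iff) (simp add: T'_def)
  moreover have "g = T' A" if "is_abelian_invariant Q Z l g" for g
  proof -
    have g: "L (T g)" "\<And>\<alpha>. \<alpha> \<notin> ?S \<Longrightarrow> g \<alpha> = 0"
      using that by (simp_all add: inv_iff)
    have "T' (T g) = g"
      by (rule ext) (simp add: T T'_def inv g(2))
    then show ?thesis
      using uniq[OF g(1)] by simp
  qed
  ultimately show ?thesis by (rule ex1I)
qed

lemma is_abelian_invariant_abelian_invariant: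
  assumes "stability_function Q Z" "is_ray l"
  shows "is_abelian_invariant Q Z l (abelian_invariant Q Z l)"
  unfolding abelian_invariant_def by (rule theI'[OF ex1_abelian_invariant[OF assms]])

end

theory Submission imports Defs begin

text \<open>
  Write \<open>q\<close> for the class of the affine line and \<open>y = q - 1\<close>. Whether an abelian representation of
  \<open>Q(\<alpha>)\<close> is semistable depends only on its support, the set of arrows on which it does not vanish. The
  semistable locus is therefore a union of tori, its class is the sum of \<open>y ^ \<bar>S\<bar>\<close> over the semistable
  supports \<open>S\<close>, and the theorem becomes a statement about finite directed graphs.
  On a ray semistability is linear: spread \<open>\<theta> = Im (Z \<cdot> cnj u)\<close>, with \<open>u\<close> on the ray, over the
  vertices; a set \<open>V\<close> of vertices lies on the ray iff \<open>\<theta>(V) = 0\<close>, and then \<open>S\<close> is semistable iff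
  \<open>\<theta>(C) \<le> 0\<close> for every \<open>C \<subseteq> V\<close> that is closed under the arrows of \<open>S\<close>.

  The proof is a wall-crossing for one particular perturbation of the stability. Fix a vertex \<open>v\<close>.
  In a semistable support the closed sets of weight \<open>0\<close> that contain \<open>v\<close> have a smallest member \<open>W\<close>.
  The support is then the union of a support on \<open>W\<close> without smaller sets of this kind, called
  pointed, of an arbitrary semistable support on \<open>V - W\<close>, and of an arbitrary set of arrows from
  \<open>V - W\<close> to \<open>W\<close> (\<open>semistable_sum_recursion\<close>). After the normalisation in the definition of \<open>f\<^sub>Z\<close>, the
  remaining power of \<open>q\<close> has exponent half the antisymmetric form of the two parts. The hypothesis
  removes it, so that \<open>f(V) = (\<Sum>W \<ni> v. p(W) f(V - W))\<close> with normalised pointed counts \<open>p\<close>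
  (\<open>ray_count_recursion\<close>).

  Applying \<open>x\<^sub>i \<partial>/\<partial>x\<^sub>i\<close> to the exponential formula that defines \<open>g\<^sub>Z\<close> gives the same recursion with
  \<open>g / (q\<^sup>1\<^sup>/\<^sup>2 - q\<^sup>-\<^sup>1\<^sup>/\<^sup>2)\<close> in place of \<open>p\<close> (\<open>log_recursion\<close>); the factorials turn the sum over
  dimension vectors into a sum over subsets of the vertices of \<open>Q(\<alpha>)\<close>. The recursion determines its
  coefficients, hence \<open>g(\<alpha>) = (q\<^sup>1\<^sup>/\<^sup>2 - q\<^sup>-\<^sup>1\<^sup>/\<^sup>2) p(\<alpha>)\<close>.

  It remains to see that the sum of \<open>y ^ \<bar>S\<bar>\<close> over pointed supports on \<open>n\<close> vertices is \<open>y ^ (n - 1)\<close>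
  times a polynomial in \<open>q\<close> with natural coefficients. Pointed supports are the stable ones for a
  slightly perturbed weight, for which no proper nonempty subset has weight \<open>0\<close>. For such weights
  compare the supports with and without a chosen arrow \<open>a\<close>. If \<open>S\<close> is stable without \<open>a\<close>, the two
  terms combine to a factor \<open>1 + y = q\<close>. If \<open>a\<close> is essential, the set of maximal weight that is closed
  without \<open>a\<close> cuts the graph into two smaller stable problems of the same kind
  (\<open>semistable_sum_remove_arrow\<close>), and induction on the number of arrows applies.

  The class of the locus is computed in the Grothendieck ring from its definition: quasi-affine sets
  are varieties, the scissor relation cuts them along coordinate hyperplanes, and the product
  relation gives \<open>[\<bbbA>\<^sup>n] = \<bbbL>\<^sup>n\<close> (\<open>k0_class_support_locus\<close>).
\<close>

section \<open>Supports, weights and closed sets\<close>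

lemma sum_power_card_Pow:
  fixes y :: "'r::comm_semiring_1"
  assumes "finite A"
  shows "(\<Sum>B\<in>Pow A. y ^ card B) = (1 + y) ^ card A"
  using assms
proof (induction A rule: finite_induct)
  case (insert a A)
  have inj: "inj_on (Set.insert a) (Pow A)"
    using insert.hyps by (auto simp: inj_on_def)
  have disj: "Pow A \<inter> Set.insert a ` Pow A = {}"
    using insert.hyps by auto
  have "(\<Sum>B\<in>Pow (Set.insert a A). y ^ card B)
      = (\<Sum>B\<in>Pow A. y ^ card B) + (\<Sum>B\<in>Pow A. y ^ card (Set.insert a B))"
    unfolding Pow_insert using insert.hyps disj
    by (simp add: sum.union_disjoint sum.reindex[OF inj])
  also have "(\<Sum>B\<in>Pow A. y ^ card (Set.insert a B)) = (\<Sum>B\<in>Pow A. y * y ^ card B)"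
  proof (rule sum.cong)
    fix B assume "B \<in> Pow A"
    then have "finite B" "a \<notin> B" using insert.hyps finite_subset by auto
    then show "y ^ card (Set.insert a B) = y * y ^ card B" by simp
  qed simp
  finally show ?case
    using insert by (simp add: sum_distrib_left[symmetric] algebra_simps)
qed simp

locale arrow_ends =
  fixes t h :: "'a \<Rightarrow> 'v"
begin

definition arrows_from :: "'a set \<Rightarrow> 'v set \<Rightarrow> 'v set \<Rightarrow> 'a set" where
  "arrows_from E V W = {a \<in> E. t a \<in> V \<and> h a \<in> W}"

abbreviation arrows_on :: "'a set \<Rightarrow> 'v set \<Rightarrow> 'a set" where
  "arrows_on E V \<equiv> arrows_from E V V"

text \<open>
  For the support \<open>S\<close> of an abelian representation these are the dimension vectors of the
  subrepresentations.
\<close>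

definition closed_under :: "'a set \<Rightarrow> 'v set \<Rightarrow> bool" where
  "closed_under S C \<longleftrightarrow> (\<forall>a\<in>S. t a \<in> C \<longrightarrow> h a \<in> C)"

text \<open>
  The weight takes the place of the difference of slopes; the condition on \<open>V\<close> itself says that
  \<open>V\<close> lies on the ray, so that vertex sets off the ray have no semistable supports.
\<close>

definition semistable_support :: "('v \<Rightarrow> real) \<Rightarrow> 'v set \<Rightarrow> 'a set \<Rightarrow> bool" where
  "semistable_support \<theta> V S \<longleftrightarrow>
     sum \<theta> V = 0 \<and> (\<forall>C\<subseteq>V. closed_under S C \<longrightarrow> sum \<theta> C \<le> 0)"

definition semistable_sum :: "'r::comm_ring_1 \<Rightarrow> 'a set \<Rightarrow> ('v \<Rightarrow> real) \<Rightarrow> 'v set \<Rightarrow> 'r" where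
  "semistable_sum y E \<theta> V = (\<Sum>S | S \<subseteq> arrows_on E V \<and> semistable_support \<theta> V S. y ^ card S)"

text \<open>
  Stability for the infinitesimal perturbation of \<open>\<theta>\<close> that favours \<open>v\<close>.
\<close>

definition pointed_support :: "('v \<Rightarrow> real) \<Rightarrow> 'v \<Rightarrow> 'v set \<Rightarrow> 'a set \<Rightarrow> bool" where
  "pointed_support \<theta> v V S \<longleftrightarrow> semistable_support \<theta> V S \<and>
     (\<forall>C. C \<subset> V \<and> v \<in> C \<and> closed_under S C \<longrightarrow> sum \<theta> C < 0)"

definition pointed_sum :: "'r::comm_ring_1 \<Rightarrow> 'a set \<Rightarrow> ('v \<Rightarrow> real) \<Rightarrow> 'v \<Rightarrow> 'v set \<Rightarrow> 'r" where
  "pointed_sum y E \<theta> v V = (\<Sum>S | S \<subseteq> arrows_on E V \<and> pointed_support \<theta> v V S. y ^ card S)"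

lemma finite_arrows_from [simp, intro]: "finite E \<Longrightarrow> finite (arrows_from E V W)"
  by (simp add: arrows_from_def)

text \<open>
  Once the arrows from \<open>W\<close> to \<open>U\<close> are prescribed, a support is given by its independent parts inside
  \<open>W\<close>, inside \<open>U\<close>, and from \<open>U\<close> to \<open>W\<close>. The last part is an arbitrary subset and contributes a power
  of \<open>1 + y\<close>.
\<close>

lemma sum_over_cut:
  fixes y :: "'r::comm_ring_1"
  assumes "finite E" "W \<inter> U = {}" "X \<subseteq> arrows_from E W U"
    and "\<A> \<subseteq> Pow (arrows_on E W)" "\<B> \<subseteq> Pow (arrows_on E U)"
  shows "(\<Sum>S | S \<subseteq> arrows_on E (W \<union> U) \<and> S \<inter> arrows_from E W U = X \<and>
              S \<inter> arrows_on E W \<in> \<A> \<and> S \<inter> arrows_on E U \<in> \<B>. y ^ card S)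
       = y ^ card X * (\<Sum>S\<in>\<A>. y ^ card S) * (\<Sum>S\<in>\<B>. y ^ card S) * (1 + y) ^ card (arrows_from E U W)"
    (is "sum _ ?L = _")
proof -
  let ?P = "Pow (arrows_from E U W)"
  have disj: "arrows_on E W \<inter> arrows_on E U = {}" "arrows_on E W \<inter> arrows_from E U W = {}"
    "arrows_on E U \<inter> arrows_from E U W = {}" "arrows_from E W U \<inter> arrows_on E W = {}"
    "arrows_from E W U \<inter> arrows_on E U = {}" "arrows_from E W U \<inter> arrows_from E U W = {}"
    using assms(2) by (auto simp: arrows_from_def)
  have un: "arrows_on E (W \<union> U) = arrows_from E W U \<union> arrows_on E W \<union> arrows_on E U \<union> arrows_from E U W"
    by (auto simp: arrows_from_def)
  have "sum (\<lambda>S. y ^ card S) ?L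
      = (\<Sum>(S1, S2, B)\<in>\<A> \<times> \<B> \<times> ?P. y ^ card X * y ^ card S1 * y ^ card S2 * y ^ card B)"
  proof (rule sum.reindex_bij_witness[where
        i = "\<lambda>(S1, S2, B). X \<union> S1 \<union> S2 \<union> B" and
        j = "\<lambda>S. (S \<inter> arrows_on E W, S \<inter> arrows_on E U, S \<inter> arrows_from E U W)"])
    fix S assume S: "S \<in> ?L"
    then have eq: "X \<union> (S \<inter> arrows_on E W) \<union> (S \<inter> arrows_on E U) \<union> (S \<inter> arrows_from E U W) = S"
      using un by blast
    then show "(case (S \<inter> arrows_on E W, S \<inter> arrows_on E U, S \<inter> arrows_from E U W) of
        (S1, S2, B) \<Rightarrow> X \<union> S1 \<union> S2 \<union> B) = S" by simp
    show "(S \<inter> arrows_on E W, S \<inter> arrows_on E U, S \<inter> arrows_from E U W) \<in> \<A> \<times> \<B> \<times> ?P"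
      using S by auto
    have fin: "finite X" "finite (S \<inter> arrows_on E W)" "finite (S \<inter> arrows_on E U)" "finite (S \<inter> arrows_from E U W)"
      using assms(1,3) by (auto intro: finite_subset)
    have "card S = card (X \<union> (S \<inter> arrows_on E W) \<union> (S \<inter> arrows_on E U) \<union> (S \<inter> arrows_from E U W))"
      using eq by simp
    also have "\<dots> = card (X \<union> (S \<inter> arrows_on E W) \<union> (S \<inter> arrows_on E U)) + card (S \<inter> arrows_from E U W)"
      by (rule card_Un_disjoint) (use fin disj assms(3) in auto)
    also have "card (X \<union> (S \<inter> arrows_on E W) \<union> (S \<inter> arrows_on E U)) =
        card (X \<union> (S \<inter> arrows_on E W)) + card (S \<inter> arrows_on E U)"
      by (rule card_Un_disjoint) (use fin disj assms(3) in auto)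
    also have "card (X \<union> (S \<inter> arrows_on E W)) = card X + card (S \<inter> arrows_on E W)"
      by (rule card_Un_disjoint) (use fin disj assms(3) in auto)
    finally show "(case (S \<inter> arrows_on E W, S \<inter> arrows_on E U, S \<inter> arrows_from E U W) of
        (S1, S2, B) \<Rightarrow> y ^ card X * y ^ card S1 * y ^ card S2 * y ^ card B) = y ^ card S"
      by (simp add: power_add)
  next
    fix b assume "b \<in> \<A> \<times> \<B> \<times> ?P"
    then obtain S1 S2 B where b: "b = (S1, S2, B)" "S1 \<in> \<A>" "S2 \<in> \<B>" "B \<subseteq> arrows_from E U W" by auto
    have sub: "S1 \<subseteq> arrows_on E W" "S2 \<subseteq> arrows_on E U" using b assms by auto
    have 1: "(X \<union> S1 \<union> S2 \<union> B) \<inter> arrows_on E W = S1" using sub b assms(3) disj by blast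
    have 2: "(X \<union> S1 \<union> S2 \<union> B) \<inter> arrows_on E U = S2" using sub b assms(3) disj by blast
    have 3: "(X \<union> S1 \<union> S2 \<union> B) \<inter> arrows_from E U W = B" using sub b assms(3) disj by blast
    have 4: "(X \<union> S1 \<union> S2 \<union> B) \<inter> arrows_from E W U = X" using sub b assms(3) disj by blast
    have 5: "X \<union> S1 \<union> S2 \<union> B \<subseteq> arrows_on E (W \<union> U)" using sub b assms(3) un by blast
    show "(case b of (S1, S2, B) \<Rightarrow> X \<union> S1 \<union> S2 \<union> B) \<in> ?L"
      using 1 2 4 5 b by simp
    show "(\<lambda>S. (S \<inter> arrows_on E W, S \<inter> arrows_on E U, S \<inter> arrows_from E U W))
        (case b of (S1, S2, B) \<Rightarrow> X \<union> S1 \<union> S2 \<union> B) = b"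
      using 1 2 3 b by simp
  qed
  also have "\<dots> = y ^ card X * ((\<Sum>S\<in>\<A>. y ^ card S) *
      ((\<Sum>S\<in>\<B>. y ^ card S) * (\<Sum>B\<in>?P. y ^ card B)))"
    by (simp add: sum.cartesian_product[symmetric] sum_distrib_left[symmetric] sum_distrib_right[symmetric] mult.assoc)
  also have "(\<Sum>B\<in>?P. y ^ card B) = (1 + y) ^ card (arrows_from E U W)"
    using assms(1) by (intro sum_power_card_Pow) simp
  finally show ?thesis by (simp add: mult.assoc)
qed

lemma sum_two_parts:
  fixes \<theta> :: "'v \<Rightarrow> real"
  assumes "finite V" "C \<subseteq> V" "W \<subseteq> V"
  shows "sum \<theta> C = sum \<theta> (C \<inter> W) + sum \<theta> (C \<inter> (V - W))"
proof -
  have "C = (C \<inter> W) \<union> (C \<inter> (V - W))" using assms by auto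
  moreover have "sum \<theta> ((C \<inter> W) \<union> (C \<inter> (V - W))) = sum \<theta> (C \<inter> W) + sum \<theta> (C \<inter> (V - W))"
    using assms by (intro sum.union_disjoint) (auto intro: finite_subset)
  ultimately show ?thesis by simp
qed

section \<open>Splitting off the smallest critical set\<close>

text \<open>
  If \<open>W\<close> is closed of weight \<open>0\<close>, the closed subsets of \<open>W\<close> are closed, and adding \<open>W\<close> to a closed
  subset of \<open>V - W\<close> gives a closed set of the same weight. Conversely a closed set of \<open>V\<close> meets \<open>W\<close> and
  \<open>V - W\<close> in closed sets, whose weights add up.
\<close>

lemma pointed_decomposition:
  assumes "finite V" "v \<in> W" "W \<subseteq> V" "S \<subseteq> arrows_on E V"
  shows "(semistable_support \<theta> V S \<and> closed_under S W \<and> sum \<theta> W = 0 \<and>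
           (\<forall>C\<subseteq>V. closed_under S C \<longrightarrow> sum \<theta> C = 0 \<longrightarrow> v \<in> C \<longrightarrow> W \<subseteq> C)) \<longleftrightarrow>
         (S \<inter> arrows_from E W (V - W) = {} \<and> pointed_support \<theta> v W (S \<inter> arrows_on E W) \<and>
           semistable_support \<theta> (V - W) (S \<inter> arrows_on E (V - W)))" (is "?L \<longleftrightarrow> ?R")
proof
  assume L: ?L
  then have W0: "sum \<theta> W = 0" and V0: "sum \<theta> V = 0" and clW: "closed_under S W" by (auto simp: semistable_support_def)
  have le: "sum \<theta> C \<le> 0" if "C \<subseteq> V" "closed_under S C" for C
    using L that by (auto simp: semistable_support_def)
  have cut: "S \<inter> arrows_from E W (V - W) = {}"
    using clW by (auto simp: closed_under_def arrows_from_def)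
  have cl1: "closed_under S C" if "C \<subseteq> W" "closed_under (S \<inter> arrows_on E W) C" for C
    using that clW assms(4) unfolding closed_under_def arrows_from_def by blast
  have sum1: "sum \<theta> C \<le> 0" if "C \<subseteq> W" "closed_under (S \<inter> arrows_on E W) C" for C
    using le[of C] cl1[OF that] that(1) assms(3) by auto
  have "sum \<theta> C < 0" if "C \<subset> W" "v \<in> C" "closed_under (S \<inter> arrows_on E W) C" for C
  proof -
    have "sum \<theta> C \<noteq> 0" using L cl1[of C] that assms(3) by blast
    with sum1[of C] that show ?thesis by auto
  qed
  with sum1 W0 have P: "pointed_support \<theta> v W (S \<inter> arrows_on E W)"
    by (auto simp: pointed_support_def semistable_support_def)
  have "sum \<theta> (V - W) = 0"
    using sum_two_parts[OF assms(1) order_refl assms(3), of \<theta>] W0 V0 assms(3) by (simp add: Int_absorb1 Int_absorb2 Int_Diff)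
  moreover have "sum \<theta> C \<le> 0" if "C \<subseteq> V - W" "closed_under (S \<inter> arrows_on E (V - W)) C" for C
  proof -
    have "closed_under S (W \<union> C)"
      using that clW assms(4) unfolding closed_under_def arrows_from_def by blast
    then have "sum \<theta> (W \<union> C) \<le> 0" using le[of "W \<union> C"] that assms(3) by blast
    moreover have "sum \<theta> (W \<union> C) = sum \<theta> W + sum \<theta> C"
      using that assms by (intro sum.union_disjoint) (auto intro: finite_subset)
    ultimately show ?thesis using W0 by simp
  qed
  ultimately show ?R using cut P by (simp add: semistable_support_def)
next
  assume R: ?R
  then have W0: "sum \<theta> W = 0" and U0: "sum \<theta> (V - W) = 0"
    by (auto simp: pointed_support_def semistable_support_def)
  have clW: "closed_under S W"
    using R assms(4) unfolding closed_under_def arrows_from_def by blast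
  have parts: "closed_under (S \<inter> arrows_on E W) (C \<inter> W)"
      "closed_under (S \<inter> arrows_on E (V - W)) (C \<inter> (V - W))" if "closed_under S C" for C
    using that by (auto simp: closed_under_def arrows_from_def)
  have le: "sum \<theta> (C \<inter> W) \<le> 0" "sum \<theta> (C \<inter> (V - W)) \<le> 0" if "closed_under S C" for C
    using R parts[OF that] unfolding pointed_support_def semistable_support_def by auto
  have V0: "sum \<theta> V = 0"
    using sum_two_parts[OF assms(1) order_refl assms(3), of \<theta>] W0 U0 assms(3) by (simp add: Int_absorb1 Int_absorb2 Int_Diff)
  have "sum \<theta> C \<le> 0" if "C \<subseteq> V" "closed_under S C" for C
    using le[OF that(2)] sum_two_parts[OF assms(1) that(1) assms(3), of \<theta>] by simp
  with V0 have ss: "semistable_support \<theta> V S" by (auto simp: semistable_support_def)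
  have "W \<subseteq> C" if C: "C \<subseteq> V" "closed_under S C" "sum \<theta> C = 0" "v \<in> C" for C
  proof (rule ccontr)
    assume "\<not> W \<subseteq> C"
    then have "sum \<theta> (C \<inter> W) < 0"
      using R parts[OF C(2)] C(4) assms(2) unfolding pointed_support_def by blast
    then show False
      using le[OF C(2)] sum_two_parts[OF assms(1) C(1) assms(3), of \<theta>] C(3) by simp
  qed
  with ss clW W0 show ?L by blast
qed

lemma closed_under_Int: "closed_under S C \<Longrightarrow> closed_under S D \<Longrightarrow> closed_under S (C \<inter> D)"
  and closed_under_Un: "closed_under S C \<Longrightarrow> closed_under S D \<Longrightarrow> closed_under S (C \<union> D)"
  by (auto simp: closed_under_def)

text \<open>
  Closed sets of weight \<open>0\<close> are stable under intersection: for two of them, the weights of the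
  intersection and of the union are nonpositive with sum \<open>0\<close>.
\<close>

lemma ex1_smallest_critical:
  assumes "finite V" "v \<in> V" and ss: "semistable_support \<theta> V S" and "S \<subseteq> arrows_on E V"
  shows "\<exists>!W. W \<subseteq> V \<and> v \<in> W \<and> closed_under S W \<and> sum \<theta> W = 0 \<and>
           (\<forall>C\<subseteq>V. closed_under S C \<longrightarrow> sum \<theta> C = 0 \<longrightarrow> v \<in> C \<longrightarrow> W \<subseteq> C)"
proof -
  define \<C> where "\<C> = {C. C \<subseteq> V \<and> v \<in> C \<and> closed_under S C \<and> sum \<theta> C = 0}"
  have VC: "V \<in> \<C>"
    using assms by (auto simp: \<C>_def semistable_support_def closed_under_def arrows_from_def)
  have fin: "finite \<C>" using assms(1) by (auto simp: \<C>_def)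
  have Int: "C \<inter> D \<in> \<C>" if "C \<in> \<C>" "D \<in> \<C>" for C D
  proof -
    have "sum \<theta> (C \<inter> D) \<le> 0" "sum \<theta> (C \<union> D) \<le> 0"
      using that ss unfolding \<C>_def semistable_support_def
      by (simp_all add: closed_under_Int closed_under_Un le_infI1)
    moreover have "sum \<theta> (C \<union> D) + sum \<theta> (C \<inter> D) = sum \<theta> C + sum \<theta> D"
      using that assms(1) by (intro sum.union_inter) (auto simp: \<C>_def intro: finite_subset)
    ultimately have "sum \<theta> (C \<inter> D) = 0" using that by (auto simp: \<C>_def)
    with that closed_under_Int show ?thesis by (auto simp: \<C>_def)
  qed
  have "\<Inter> \<D> \<in> \<C>" if "finite \<D>" "\<D> \<noteq> {}" "\<D> \<subseteq> \<C>" for \<D>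
    using that by (induction rule: finite_ne_induct) (auto intro: Int)
  with fin VC have I: "\<Inter>\<C> \<in> \<C>" by blast
  show ?thesis
  proof (rule ex1I[of _ "\<Inter>\<C>"])
    show "\<Inter>\<C> \<subseteq> V \<and> v \<in> \<Inter>\<C> \<and> closed_under S (\<Inter>\<C>) \<and> sum \<theta> (\<Inter>\<C>) = 0 \<and>
       (\<forall>C\<subseteq>V. closed_under S C \<longrightarrow> sum \<theta> C = 0 \<longrightarrow> v \<in> C \<longrightarrow> \<Inter>\<C> \<subseteq> C)"
      using I unfolding \<C>_def by blast
  next
    fix W assume W: "W \<subseteq> V \<and> v \<in> W \<and> closed_under S W \<and> sum \<theta> W = 0 \<and>
       (\<forall>C\<subseteq>V. closed_under S C \<longrightarrow> sum \<theta> C = 0 \<longrightarrow> v \<in> C \<longrightarrow> W \<subseteq> C)"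
    then have "W \<in> \<C>" by (auto simp: \<C>_def)
    moreover have "W \<subseteq> \<Inter>\<C>" using W by (auto simp: \<C>_def)
    ultimately show "W = \<Inter>\<C>" by blast
  qed
qed

text \<open>
  The Harder-Narasimhan recursion for the stability perturbed in favour of \<open>v\<close>; only two
  pieces occur, because the perturbation sees nothing on the part that does not contain \<open>v\<close>.
\<close>

lemma semistable_sum_recursion:
  fixes y :: "'r::comm_ring_1"
  assumes "finite V" "finite E" "v \<in> V"
  shows "semistable_sum y E \<theta> V = (\<Sum>W | W \<subseteq> V \<and> v \<in> W.
           pointed_sum y E \<theta> v W * semistable_sum y E \<theta> (V - W) * (1 + y) ^ card (arrows_from E (V - W) W))"
proof -
  let ?P = "\<lambda>S W. W \<subseteq> V \<and> v \<in> W \<and> closed_under S W \<and> sum \<theta> W = 0 \<and>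
           (\<forall>C\<subseteq>V. closed_under S C \<longrightarrow> sum \<theta> C = 0 \<longrightarrow> v \<in> C \<longrightarrow> W \<subseteq> C)"
  let ?SS = "{S. S \<subseteq> arrows_on E V \<and> semistable_support \<theta> V S}"
  define m where "m = (\<lambda>S. THE W. ?P S W)"
  have ex1: "\<exists>!W. ?P S W" if "S \<in> ?SS" for S
    using ex1_smallest_critical[of V v \<theta> S E] that assms by blast
  have m: "?P S (m S)" if "S \<in> ?SS" for S
    unfolding m_def by (rule theI'[OF ex1[OF that]])
  have m_iff: "m S = W \<longleftrightarrow> ?P S W" if "S \<in> ?SS" for S W
    using m[OF that] ex1[OF that] by blast
  have finSS: "finite ?SS"
    using assms by (auto intro: finite_subset[OF _ finite_Pow_iff[THEN iffD2]])
  have "semistable_sum y E \<theta> V =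
      (\<Sum>W | W \<subseteq> V \<and> v \<in> W. \<Sum>S | S \<in> ?SS \<and> m S = W. y ^ card S)"
    unfolding semistable_sum_def
    by (rule sum.group[symmetric, of ?SS "{W. W \<subseteq> V \<and> v \<in> W}"]) (use finSS assms m in auto)
  also have "\<dots> = (\<Sum>W | W \<subseteq> V \<and> v \<in> W.
           pointed_sum y E \<theta> v W * semistable_sum y E \<theta> (V - W) * (1 + y) ^ card (arrows_from E (V - W) W))"
  proof (rule sum.cong)
    fix W assume "W \<in> {W. W \<subseteq> V \<and> v \<in> W}"
    then have W: "W \<subseteq> V" "v \<in> W" by auto
    let ?A = "{S. S \<subseteq> arrows_on E W \<and> pointed_support \<theta> v W S}"
    let ?B = "{S. S \<subseteq> arrows_on E (V - W) \<and> semistable_support \<theta> (V - W) S}"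
    have "S \<in> ?SS \<and> m S = W \<longleftrightarrow> S \<subseteq> arrows_on E V \<and> S \<inter> arrows_from E W (V - W) = {} \<and>
        S \<inter> arrows_on E W \<in> ?A \<and> S \<inter> arrows_on E (V - W) \<in> ?B" for S
    proof -
      have "S \<in> ?SS \<and> m S = W \<longleftrightarrow> S \<in> ?SS \<and> ?P S W" using m_iff[of S W] by (rule conj_cong[OF refl])
      then show ?thesis
        using pointed_decomposition[OF assms(1) W(2,1), of S E \<theta>] W
        by (cases "S \<subseteq> arrows_on E V") simp_all
    qed
    moreover have "W \<union> (V - W) = V" using W by auto
    ultimately have "(\<Sum>S | S \<in> ?SS \<and> m S = W. y ^ card S) =
        (\<Sum>S | S \<subseteq> arrows_on E (W \<union> (V - W)) \<and> S \<inter> arrows_from E W (V - W) = {} \<and>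
              S \<inter> arrows_on E W \<in> ?A \<and> S \<inter> arrows_on E (V - W) \<in> ?B. y ^ card S)"
      by presburger
    also have "\<dots> = y ^ card ({}::'a set) * (\<Sum>S\<in>?A. y ^ card S) * (\<Sum>S\<in>?B. y ^ card S) *
        (1 + y) ^ card (arrows_from E (V - W) W)"
      by (rule sum_over_cut) (use assms in auto)
    finally show "(\<Sum>S | S \<in> ?SS \<and> m S = W. y ^ card S) =
        pointed_sum y E \<theta> v W * semistable_sum y E \<theta> (V - W) * (1 + y) ^ card (arrows_from E (V - W) W)"
      by (simp add: pointed_sum_def semistable_sum_def)
  qed simp
  finally show ?thesis .
qed

end

section \<open>Positivity for generic weights\<close>

text \<open>
  Values at \<open>q\<close> of polynomials with natural coefficients.
\<close>

inductive_set nat_polys :: "'r::comm_ring_1 \<Rightarrow> 'r set" for q where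
  zero: "0 \<in> nat_polys q"
| one: "1 \<in> nat_polys q"
| add: "x \<in> nat_polys q \<Longrightarrow> x' \<in> nat_polys q \<Longrightarrow> x + x' \<in> nat_polys q"
| times_q: "x \<in> nat_polys q \<Longrightarrow> q * x \<in> nat_polys q"

lemma nat_polys_mult:
  assumes "x \<in> nat_polys q" "x' \<in> nat_polys q"
  shows "x * x' \<in> nat_polys q"
  using assms(1)
proof induction
  case (add x1 x2)
  then show ?case by (simp add: distrib_right nat_polys.add)
next
  case (times_q x)
  then show ?case by (simp add: mult.assoc nat_polys.times_q)
qed (use assms(2) in \<open>simp_all add: nat_polys.zero\<close>)

lemma nat_polys_power: "q ^ n \<in> nat_polys q"
  by (induction n) (simp_all add: nat_polys.one nat_polys.times_q)

lemma nat_polys_sum: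
  assumes "\<And>i. i \<in> A \<Longrightarrow> f i \<in> nat_polys q"
  shows "sum f A \<in> nat_polys q"
  using assms by (induction A rule: infinite_finite_induct) (simp_all add: nat_polys.zero nat_polys.add)

context arrow_ends begin

definition generic_weight :: "('v \<Rightarrow> real) \<Rightarrow> 'v set \<Rightarrow> bool" where
  "generic_weight \<theta> V \<longleftrightarrow> sum \<theta> V = 0 \<and> (\<forall>C. C \<subset> V \<and> C \<noteq> {} \<longrightarrow> sum \<theta> C \<noteq> 0)"

lemma sum_shift_weight:
  fixes \<theta> :: "'v \<Rightarrow> real"
  assumes "finite K"
  shows "sum (\<theta>(i := \<theta> i + s)) K = sum \<theta> K + (if i \<in> K then s else 0)"
proof -
  have "sum (\<theta>(i := \<theta> i + s)) K = (\<Sum>k\<in>K. \<theta> k + (if k = i then s else 0))"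
    by (intro sum.cong) auto
  then show ?thesis using assms by (simp add: sum.distrib)
qed

text \<open>
  Moving the total weight of \<open>N\<close> to one vertex \<open>i\<close> changes the weight of a subset \<open>C\<close> to the weight
  of \<open>C\<close> or to minus that of \<open>N - C\<close>, so it cannot create a proper subset of weight \<open>0\<close>.
\<close>

lemma generic_weight_parts:
  assumes V: "finite V" and gen: "generic_weight \<theta> V" and N: "N \<subseteq> V" "i \<in> N"
  shows "generic_weight (\<theta>(i := \<theta> i + (- sum \<theta> N))) N"
  unfolding generic_weight_def
proof (intro conjI allI impI)
  have fin: "finite N" using V N finite_subset by auto
  then show "sum (\<theta>(i := \<theta> i + (- sum \<theta> N))) N = 0" using N by (simp add: sum_shift_weight del: fun_upd_apply add_uminus_conv_diff)
  fix C assume C: "C \<subset> N \<and> C \<noteq> {}"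
  then have "finite C" using fin finite_subset by auto
  have "sum \<theta> (N - C) = sum \<theta> N - sum \<theta> C" using C fin by (intro sum_diff) auto
  moreover have "sum \<theta> (N - C) \<noteq> 0" if "i \<in> C"
    using gen C N that unfolding generic_weight_def by (metis Diff_eq_empty_iff Diff_iff psubsetE psubsetI subset_iff)
  moreover have "sum \<theta> C \<noteq> 0" if "i \<notin> C"
    using gen C N unfolding generic_weight_def by blast
  ultimately show "sum (\<theta>(i := \<theta> i + (- sum \<theta> N))) C \<noteq> 0"
    using \<open>finite C\<close> by (auto simp: sum_shift_weight simp del: fun_upd_apply add_uminus_conv_diff)
qed

text \<open>
  The weight of \<open>N\<close> is what has to flow through \<open>a\<close>. Concentrating this amount at the two ends of
  \<open>a\<close> makes both sides of the cut balanced, and turns the condition that \<open>N\<close> has the greatest weight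
  among the closed sets into semistability of the two sides.
\<close>

lemma essential_decomposition:
  assumes V: "finite V" and gen: "generic_weight \<theta> V" and N: "N \<subseteq> V" "t a \<in> N" "h a \<in> V - N"
    and pos: "sum \<theta> N > 0" and S: "S \<subseteq> arrows_on E V"
  defines "\<theta>1 \<equiv> \<theta>(t a := \<theta> (t a) + (- sum \<theta> N))" and "\<theta>2 \<equiv> \<theta>(h a := \<theta> (h a) + sum \<theta> N)"
  shows "(semistable_support \<theta> V (insert a S) \<and> closed_under S N \<and>
           (\<forall>C\<subseteq>V. closed_under S C \<longrightarrow> C \<noteq> N \<longrightarrow> sum \<theta> C < sum \<theta> N)) \<longleftrightarrow>
         (S \<inter> arrows_from E N (V - N) = {} \<and> semistable_support \<theta>1 N (S \<inter> arrows_on E N) \<and>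
           semistable_support \<theta>2 (V - N) (S \<inter> arrows_on E (V - N)))" (is "?L \<longleftrightarrow> ?R")
proof -
  have finN: "finite N" "finite (V - N)" using V N finite_subset by auto
  have sum1: "sum \<theta>1 K = sum \<theta> K - (if t a \<in> K then sum \<theta> N else 0)" if "K \<subseteq> V" for K
    unfolding \<theta>1_def using finite_subset[OF that V] by (simp add: sum_shift_weight del: fun_upd_apply add_uminus_conv_diff)
  have sum2: "sum \<theta>2 K = sum \<theta> K + (if h a \<in> K then sum \<theta> N else 0)" if "K \<subseteq> V" for K
    unfolding \<theta>2_def using finite_subset[OF that V] by (simp add: sum_shift_weight del: fun_upd_apply add_uminus_conv_diff)
  have V0: "sum \<theta> V = 0" using gen by (simp add: generic_weight_def)
  have N1: "sum \<theta>1 N = 0" using sum1[OF N(1)] N by simp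
  have N2: "sum \<theta>2 (V - N) = 0"
    using sum2[of "V - N"] N V0 sum_diff[OF V N(1), of \<theta>] by simp
  have ne0: "sum \<theta> C \<noteq> 0" if "C \<subseteq> V" "C \<noteq> {}" "C \<noteq> V" for C
    using gen that by (auto simp: generic_weight_def)
  show ?thesis
  proof
    assume L: ?L
    then have clN: "closed_under S N" and le: "\<And>C. C \<subseteq> V \<Longrightarrow> closed_under (insert a S) C \<Longrightarrow> sum \<theta> C \<le> 0"
      and less: "\<And>C. C \<subseteq> V \<Longrightarrow> closed_under S C \<Longrightarrow> C \<noteq> N \<Longrightarrow> sum \<theta> C < sum \<theta> N"
      by (auto simp: semistable_support_def)
    have "S \<inter> arrows_from E N (V - N) = {}"
      using clN by (auto simp: closed_under_def arrows_from_def)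
    moreover have "sum \<theta>1 C \<le> 0" if C: "C \<subseteq> N" "closed_under (S \<inter> arrows_on E N) C" for C
    proof -
      have cl: "closed_under S C"
        using C clN S unfolding closed_under_def arrows_from_def by blast
      show ?thesis
      proof (cases "t a \<in> C")
        case True
        have "sum \<theta> C \<le> sum \<theta> N" using less[of C] cl C N by (cases "C = N") (auto intro: less_imp_le)
        then show ?thesis using sum1[of C] C N True by auto
      next
        case False
        then have "closed_under (insert a S) C" using cl by (auto simp: closed_under_def)
        then show ?thesis using sum1[of C] le[of C] C N False by auto
      qed
    qed
    moreover have "sum \<theta>2 C \<le> 0" if C: "C \<subseteq> V - N" "closed_under (S \<inter> arrows_on E (V - N)) C" for C
    proof -
      have cl: "closed_under S (N \<union> C)"
        using C clN S unfolding closed_under_def arrows_from_def by blast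
      have CV: "C \<subseteq> V" using C by blast
      have un: "sum \<theta> (N \<union> C) = sum \<theta> N + sum \<theta> C"
        using C finN by (intro sum.union_disjoint) (auto intro: finite_subset)
      show ?thesis
      proof (cases "h a \<in> C")
        case True
        then have "closed_under (insert a S) (N \<union> C)" using cl by (auto simp: closed_under_def)
        then have "sum \<theta> (N \<union> C) \<le> 0" using le[of "N \<union> C"] N C by blast
        then show ?thesis using sum2[OF CV] un C True by auto
      next
        case False
        have "sum \<theta> (N \<union> C) \<le> sum \<theta> N"
          using less[of "N \<union> C"] cl CV N(1) by (cases "N \<union> C = N") auto
        then show ?thesis using sum2[OF CV] un C False by auto
      qed
    qed
    ultimately show ?R using N1 N2 by (auto simp: semistable_support_def)
  next
    assume R: ?R
    have clN: "closed_under S N"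
      using R S unfolding closed_under_def arrows_from_def by blast
    have le: "sum \<theta> C \<le> (if t a \<in> C then sum \<theta> N else 0) - (if h a \<in> C then sum \<theta> N else 0)"
      if C: "C \<subseteq> V" "closed_under S C" for C
    proof -
      have "closed_under (S \<inter> arrows_on E N) (C \<inter> N)"
        "closed_under (S \<inter> arrows_on E (V - N)) (C \<inter> (V - N))"
        using C by (auto simp: closed_under_def arrows_from_def)
      then have "sum \<theta>1 (C \<inter> N) \<le> 0" "sum \<theta>2 (C \<inter> (V - N)) \<le> 0"
        using R by (auto simp: semistable_support_def)
      moreover have "C \<inter> N \<subseteq> V" "C \<inter> (V - N) \<subseteq> V" using C by auto
      ultimately show ?thesis
        using sum1[of "C \<inter> N"] sum2[of "C \<inter> (V - N)"] N C sum_two_parts[OF V C(1) N(1), of \<theta>]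
        by (auto split: if_splits)
    qed
    have "sum \<theta> C \<le> 0" if C: "C \<subseteq> V" "closed_under (insert a S) C" for C
    proof -
      have "closed_under S C" "t a \<in> C \<Longrightarrow> h a \<in> C" using C by (auto simp: closed_under_def)
      then show ?thesis using le[OF C(1)] pos by (auto split: if_splits)
    qed
    then have "semistable_support \<theta> V (insert a S)"
      using V0 by (auto simp: semistable_support_def)
    moreover have "sum \<theta> C < sum \<theta> N" if C: "C \<subseteq> V" "closed_under S C" "C \<noteq> N" for C
    proof (rule ccontr)
      assume "\<not> sum \<theta> C < sum \<theta> N"
      then have ge: "sum \<theta> C \<ge> sum \<theta> N" by simp
      have "N \<inter> C \<subseteq> V" "N \<union> C \<subseteq> V" using C N by auto
      then have "sum \<theta> (N \<inter> C) \<le> sum \<theta> N" "sum \<theta> (N \<union> C) \<le> sum \<theta> N"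
        using le[of "N \<inter> C"] le[of "N \<union> C"] closed_under_Int[OF clN C(2)] closed_under_Un[OF clN C(2)] pos
        by (auto split: if_splits)
      moreover have "sum \<theta> (N \<union> C) + sum \<theta> (N \<inter> C) = sum \<theta> N + sum \<theta> C"
        using finN C V by (intro sum.union_inter) (auto intro: finite_subset)
      ultimately have "sum \<theta> (N \<inter> C) = sum \<theta> N" "sum \<theta> (N \<union> C) = sum \<theta> N" using ge by auto
      then have "sum \<theta> (N - N \<inter> C) = 0" "sum \<theta> ((N \<union> C) - N) = 0"
        using finN C V by (simp_all add: sum_diff finite_subset)
      moreover have "N - N \<inter> C \<noteq> V" "(N \<union> C) - N \<noteq> V" using N by auto
      ultimately have "N - N \<inter> C = {}" "(N \<union> C) - N = {}"
        using ne0[of "N - N \<inter> C"] ne0[of "(N \<union> C) - N"] N C by blast+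
      then show False using C by auto
    qed
    ultimately show ?L using clN by blast
  qed
qed

text \<open>
  A set of greatest weight is unique for a generic weight: the weights of the intersection and of
  the union of two of them are also greatest, so that their differences have weight \<open>0\<close>. It must be
  separated by \<open>a\<close>, as otherwise it would be closed with \<open>a\<close> present.
\<close>

lemma ex1_maximal_violation:
  assumes V: "finite V" and gen: "generic_weight \<theta> V"
    and ss: "semistable_support \<theta> V (insert a S)" and nss: "\<not> semistable_support \<theta> V S"
  shows "\<exists>!N. N \<subseteq> V \<and> t a \<in> N \<and> h a \<notin> N \<and> sum \<theta> N > 0 \<and> closed_under S N \<and>
           (\<forall>C\<subseteq>V. closed_under S C \<longrightarrow> C \<noteq> N \<longrightarrow> sum \<theta> C < sum \<theta> N)"
proof -
  have V0: "sum \<theta> V = 0" using gen by (simp add: generic_weight_def)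
  have ne0: "sum \<theta> C \<noteq> 0" if "C \<subseteq> V" "C \<noteq> {}" "C \<noteq> V" for C
    using gen that by (auto simp: generic_weight_def)
  define \<C> where "\<C> = {C. C \<subseteq> V \<and> closed_under S C}"
  have fin: "finite \<C>" using V by (auto simp: \<C>_def)
  obtain C0 where C0: "C0 \<in> \<C>" "sum \<theta> C0 > 0"
    using nss V0 by (auto simp: \<C>_def semistable_support_def not_le)
  define M where "M = Max (sum \<theta> ` \<C>)"
  have "M \<in> sum \<theta> ` \<C>" unfolding M_def using fin C0 by (intro Max_in) auto
  then obtain N where N: "N \<in> \<C>" "sum \<theta> N = M" by auto
  have le: "sum \<theta> C \<le> M" if "C \<in> \<C>" for C
    unfolding M_def using fin that by (intro Max_ge) auto
  have M: "M > 0" using le[OF C0(1)] C0(2) by simp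
  have "\<not> closed_under (insert a S) N"
    using ss N M by (auto simp: semistable_support_def \<C>_def)
  then have ah: "t a \<in> N" "h a \<notin> N" using N by (auto simp: closed_under_def \<C>_def)
  have less: "sum \<theta> C < M" if C: "C \<in> \<C>" "C \<noteq> N" for C
  proof (rule ccontr)
    assume "\<not> sum \<theta> C < M"
    then have ge: "sum \<theta> C = M" using le[OF C(1)] by simp
    have fin': "finite C" "finite N" using C N V by (auto simp: \<C>_def intro: finite_subset)
    have "N \<inter> C \<in> \<C>" "N \<union> C \<in> \<C>"
      using N C closed_under_Int[of S N C] closed_under_Un[of S N C] by (auto simp: \<C>_def)
    then have "sum \<theta> (N \<inter> C) \<le> M" "sum \<theta> (N \<union> C) \<le> M"
      using le by simp_all
    moreover have "sum \<theta> (N \<union> C) + sum \<theta> (N \<inter> C) = sum \<theta> N + sum \<theta> C"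
      using fin' by (intro sum.union_inter)
    ultimately have "sum \<theta> (N \<inter> C) = sum \<theta> N" "sum \<theta> (N \<union> C) = sum \<theta> N" "sum \<theta> (N \<inter> C) = sum \<theta> C"
      using ge N by auto
    then have "sum \<theta> (N - N \<inter> C) = 0" "sum \<theta> (C - N \<inter> C) = 0"
      using fin' by (simp_all add: sum_diff)
    moreover have "N \<noteq> V" "C \<noteq> V" using N M ge V0 by auto
    then have "N - N \<inter> C \<noteq> V" "C - N \<inter> C \<noteq> V" using N C unfolding \<C>_def by blast+
    ultimately have "N - N \<inter> C = {}" "C - N \<inter> C = {}"
      using ne0[of "N - N \<inter> C"] ne0[of "C - N \<inter> C"] N C unfolding \<C>_def by blast+
    then show False using C by auto
  qed
  show ?thesis
  proof (rule ex1I[of _ N])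
    show "N \<subseteq> V \<and> t a \<in> N \<and> h a \<notin> N \<and> sum \<theta> N > 0 \<and> closed_under S N \<and>
           (\<forall>C\<subseteq>V. closed_under S C \<longrightarrow> C \<noteq> N \<longrightarrow> sum \<theta> C < sum \<theta> N)"
      using N ah M less by (auto simp: \<C>_def)
    fix N' assume N': "N' \<subseteq> V \<and> t a \<in> N' \<and> h a \<notin> N' \<and> sum \<theta> N' > 0 \<and> closed_under S N' \<and>
           (\<forall>C\<subseteq>V. closed_under S C \<longrightarrow> C \<noteq> N' \<longrightarrow> sum \<theta> C < sum \<theta> N')"
    show "N' = N"
    proof (rule ccontr)
      assume "N' \<noteq> N"
      then have "sum \<theta> N < sum \<theta> N'" "sum \<theta> N' < sum \<theta> N"
        using N' N less[of N'] by (auto simp: \<C>_def)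
      then show False by simp
    qed
  qed
qed

lemma semistable_support_mono:
  "semistable_support \<theta> V S \<Longrightarrow> S \<subseteq> S' \<Longrightarrow> semistable_support \<theta> V S'"
  unfolding semistable_support_def closed_under_def by blast

text \<open>
  Deletion of an arrow. Supports that are stable without \<open>a\<close> occur with and without \<open>a\<close>; the others
  are sorted by the closed set that destabilises them most when \<open>a\<close> is removed.
\<close>

lemma semistable_sum_remove_arrow:
  fixes y :: "'r::comm_ring_1"
  assumes V: "finite V" and E: "finite E" and gen: "generic_weight \<theta> V" and a: "a \<in> arrows_on E V"
  defines "E' \<equiv> E - {a}"
  shows "semistable_sum y E \<theta> V = (1 + y) * semistable_sum y E' \<theta> V +
    (\<Sum>N | N \<subseteq> V \<and> t a \<in> N \<and> h a \<notin> N \<and> sum \<theta> N > 0.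
        y * semistable_sum y E' (\<theta>(t a := \<theta> (t a) + (- sum \<theta> N))) N *
        semistable_sum y E' (\<theta>(h a := \<theta> (h a) + sum \<theta> N)) (V - N) *
        (1 + y) ^ card (arrows_from E' (V - N) N))"
proof -
  let ?P = "\<lambda>S N. N \<subseteq> V \<and> t a \<in> N \<and> h a \<notin> N \<and> sum \<theta> N > 0 \<and> closed_under S N \<and>
           (\<forall>C\<subseteq>V. closed_under S C \<longrightarrow> C \<noteq> N \<longrightarrow> sum \<theta> C < sum \<theta> N)"
  define A where "A = arrows_on E' V"
  have E': "finite E'" using E by (simp add: E'_def)
  have finA: "finite A" and aA: "a \<notin> A" and Ea: "arrows_on E V = insert a A"
    using a E by (auto simp: A_def E'_def arrows_from_def)
  let ?ss = "semistable_support \<theta> V"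
  let ?K = "{S. S \<subseteq> A \<and> \<not> ?ss S \<and> ?ss (insert a S)}"
  have inj: "inj_on (insert a) {S. S \<subseteq> A \<and> Q S}" for Q
    using aA by (auto simp: inj_on_def)
  have split: "{S. S \<subseteq> insert a A \<and> ?ss S} =
      {S. S \<subseteq> A \<and> ?ss S} \<union> insert a ` {S. S \<subseteq> A \<and> ?ss (insert a S)}" (is "?X = ?Y \<union> ?Z")
  proof (intro equalityI subsetI)
    fix S assume S: "S \<in> ?X"
    show "S \<in> ?Y \<union> ?Z"
    proof (cases "a \<in> S")
      case True
      then have "S = insert a (S - {a})" by auto
      moreover have "S - {a} \<subseteq> A" using S by auto
      ultimately show ?thesis using S by (metis (no_types, lifting) UnI2 image_eqI mem_Collect_eq)
    qed (use S in auto)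
  qed (use aA in auto)
  have split2: "{S. S \<subseteq> A \<and> ?ss (insert a S)} = {S. S \<subseteq> A \<and> ?ss S} \<union> ?K"
    using semistable_support_mono[of \<theta> V] by blast
  have card: "y ^ card (insert a S) = y * y ^ card S" if "S \<subseteq> A" for S
    using that aA finA finite_subset[of S A] by (subst card_insert_disjoint) auto
  have "semistable_sum y E \<theta> V = (\<Sum>S\<in>?Y. y ^ card S) + (\<Sum>S\<in>?Z. y ^ card S)"
    unfolding semistable_sum_def Ea split
    by (rule sum.union_disjoint) (use finA aA in auto)
  also have "(\<Sum>S\<in>?Z. y ^ card S) = (\<Sum>S | S \<subseteq> A \<and> ?ss (insert a S). y * y ^ card S)"
    by (subst sum.reindex[OF inj]) (auto intro!: sum.cong card)
  also have "\<dots> = (\<Sum>S\<in>?Y. y * y ^ card S) + (\<Sum>S\<in>?K. y * y ^ card S)"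
    unfolding split2 by (rule sum.union_disjoint) (use finA in auto)
  also have "(\<Sum>S\<in>?Y. y ^ card S) + ((\<Sum>S\<in>?Y. y * y ^ card S) + (\<Sum>S\<in>?K. y * y ^ card S)) =
      (1 + y) * semistable_sum y E' \<theta> V + (\<Sum>S\<in>?K. y * y ^ card S)"
    unfolding semistable_sum_def A_def[symmetric]
    by (simp add: sum_distrib_left[symmetric] distrib_right)
  also have "(\<Sum>S\<in>?K. y * y ^ card S) =
    (\<Sum>N | N \<subseteq> V \<and> t a \<in> N \<and> h a \<notin> N \<and> sum \<theta> N > 0.
        y * semistable_sum y E' (\<theta>(t a := \<theta> (t a) + (- sum \<theta> N))) N *
        semistable_sum y E' (\<theta>(h a := \<theta> (h a) + sum \<theta> N)) (V - N) *
        (1 + y) ^ card (arrows_from E' (V - N) N))"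
  proof -
    define m where "m = (\<lambda>S. THE N. ?P S N)"
    have ex1: "\<exists>!N. ?P S N" if "S \<in> ?K" for S
      using ex1_maximal_violation[OF V gen, of a S] that by simp
    have m: "?P S (m S)" if "S \<in> ?K" for S
      unfolding m_def by (rule theI'[OF ex1[OF that]])
    have m_iff: "m S = N \<longleftrightarrow> ?P S N" if "S \<in> ?K" for S N
      using m[OF that] ex1[OF that] by blast
    have "(\<Sum>S\<in>?K. y * y ^ card S) =
        (\<Sum>N | N \<subseteq> V \<and> t a \<in> N \<and> h a \<notin> N \<and> sum \<theta> N > 0. \<Sum>S | S \<in> ?K \<and> m S = N. y * y ^ card S)"
      by (rule sum.group[symmetric, of ?K]) (use finA V m in auto)
    also have "\<dots> = (\<Sum>N | N \<subseteq> V \<and> t a \<in> N \<and> h a \<notin> N \<and> sum \<theta> N > 0.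
        y * semistable_sum y E' (\<theta>(t a := \<theta> (t a) + (- sum \<theta> N))) N *
        semistable_sum y E' (\<theta>(h a := \<theta> (h a) + sum \<theta> N)) (V - N) *
        (1 + y) ^ card (arrows_from E' (V - N) N))"
    proof (rule sum.cong)
      fix N assume "N \<in> {N. N \<subseteq> V \<and> t a \<in> N \<and> h a \<notin> N \<and> sum \<theta> N > 0}"
      then have N: "N \<subseteq> V" "t a \<in> N" "h a \<notin> N" "sum \<theta> N > 0" by auto
      have ha: "h a \<in> V - N" using a N by (auto simp: arrows_from_def)
      let ?A = "{S. S \<subseteq> arrows_on E' N \<and> semistable_support (\<theta>(t a := \<theta> (t a) + (- sum \<theta> N))) N S}"
      let ?B = "{S. S \<subseteq> arrows_on E' (V - N) \<and>
        semistable_support (\<theta>(h a := \<theta> (h a) + sum \<theta> N)) (V - N) S}"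
      have "S \<in> ?K \<and> m S = N \<longleftrightarrow> S \<subseteq> arrows_on E' V \<and> S \<inter> arrows_from E' N (V - N) = {} \<and>
          S \<inter> arrows_on E' N \<in> ?A \<and> S \<inter> arrows_on E' (V - N) \<in> ?B" for S
      proof -
        define R where "R \<longleftrightarrow> closed_under S N \<and>
           (\<forall>C\<subseteq>V. closed_under S C \<longrightarrow> C \<noteq> N \<longrightarrow> sum \<theta> C < sum \<theta> N)"
        have PR: "?P S N \<longleftrightarrow> R" using N by (simp add: R_def)
        have nss: "\<not> ?ss S" if R
          using that N by (auto simp: semistable_support_def R_def not_le)
        have "S \<in> ?K \<and> m S = N \<longleftrightarrow> S \<in> ?K \<and> ?P S N" using m_iff[of S N] by (rule conj_cong[OF refl])
        also have "\<dots> \<longleftrightarrow> S \<subseteq> A \<and> (?ss (insert a S) \<and> R)"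
          unfolding PR using nss by blast
        finally have "S \<in> ?K \<and> m S = N \<longleftrightarrow> S \<subseteq> A \<and> (?ss (insert a S) \<and> R)" .
        then have "S \<in> ?K \<and> m S = N \<longleftrightarrow> S \<subseteq> A \<and> (?ss (insert a S) \<and> closed_under S N \<and>
           (\<forall>C\<subseteq>V. closed_under S C \<longrightarrow> C \<noteq> N \<longrightarrow> sum \<theta> C < sum \<theta> N))"
          unfolding R_def .
        then show ?thesis
          using essential_decomposition[OF V gen N(1,2) ha N(4), of S E']
          by (cases "S \<subseteq> A") (simp_all add: A_def del: fun_upd_apply)
      qed
      moreover have "N \<union> (V - N) = V" using N by auto
      ultimately have "(\<Sum>S | S \<in> ?K \<and> m S = N. y * y ^ card S) =
          (\<Sum>S | S \<subseteq> arrows_on E' (N \<union> (V - N)) \<and> S \<inter> arrows_from E' N (V - N) = {} \<and>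
                S \<inter> arrows_on E' N \<in> ?A \<and> S \<inter> arrows_on E' (V - N) \<in> ?B. y * y ^ card S)"
        by presburger
      also have "\<dots> = y * (\<Sum>S | S \<subseteq> arrows_on E' (N \<union> (V - N)) \<and> S \<inter> arrows_from E' N (V - N) = {} \<and>
                S \<inter> arrows_on E' N \<in> ?A \<and> S \<inter> arrows_on E' (V - N) \<in> ?B. y ^ card S)"
        by (simp only: sum_distrib_left)
      also have "\<dots> = y * (y ^ card ({}::'a set) * (\<Sum>S\<in>?A. y ^ card S) * (\<Sum>S\<in>?B. y ^ card S) *
          (1 + y) ^ card (arrows_from E' (V - N) N))"
        by (rule arg_cong[OF sum_over_cut]) (use E' in auto)
      finally show "(\<Sum>S | S \<in> ?K \<and> m S = N. y * y ^ card S) =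
          y * semistable_sum y E' (\<theta>(t a := \<theta> (t a) + (- sum \<theta> N))) N *
        semistable_sum y E' (\<theta>(h a := \<theta> (h a) + sum \<theta> N)) (V - N) *
        (1 + y) ^ card (arrows_from E' (V - N) N)"
        by (simp add: semistable_sum_def mult.assoc del: fun_upd_apply)
    qed simp
    finally show ?thesis .
  qed
  finally show ?thesis .
qed

text \<open>
  Both terms of the deletion formula involve fewer arrows. The exponents match because the factor
  \<open>y\<close> of the arrow \<open>a\<close> compensates for the vertex sets of the two parts being counted separately.
\<close>

lemma semistable_sum_positive:
  fixes y :: "'r::comm_ring_1"
  assumes "finite V" "V \<noteq> {}" "finite E" "generic_weight \<theta> V"
  shows "\<exists>p\<in>nat_polys (1 + y). semistable_sum y E \<theta> V = y ^ (card V - 1) * p"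
  using assms
proof (induction "card (arrows_on E V)" arbitrary: E V \<theta> rule: less_induct)
  case less
  note V = less.prems(1,2) and E = less.prems(3) and gen = less.prems(4)
  have V0: "sum \<theta> V = 0" using gen by (simp add: generic_weight_def)
  show ?case
  proof (cases "arrows_on E V = {}")
    case True
    then have eq: "semistable_sum y E \<theta> V = (if semistable_support \<theta> V {} then 1 else 0)"
      by (auto simp: semistable_sum_def Collect_conv_if)
    show ?thesis
    proof (cases "card V = 1")
      case True
      then show ?thesis using eq nat_polys.zero nat_polys.one
        by (intro bexI[of _ "if semistable_support \<theta> V {} then 1 else 0"]) auto
    next
      case False
      obtain v where v: "v \<in> V" using V by auto
      have ne: "V \<noteq> {v}" using False by auto
      have "\<not> semistable_support \<theta> V {}"
      proof
        assume "semistable_support \<theta> V {}"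
        then have "sum \<theta> {v} \<le> 0" "sum \<theta> (V - {v}) \<le> 0"
          using v by (auto simp: semistable_support_def closed_under_def simp del: sum.insert)
        moreover have "sum \<theta> {v} \<noteq> 0" using gen ne v by (auto simp: generic_weight_def simp del: sum.insert)
        ultimately show False using V0 v V sum.remove[of V v \<theta>] by simp
      qed
      then show ?thesis using eq nat_polys.zero by (intro bexI[of _ 0]) auto
    qed
  next
    case False
    then obtain a where a: "a \<in> arrows_on E V" by auto
    define E' where "E' = E - {a}"
    have E': "finite E'" using E by (simp add: E'_def)
    have sm: "card (arrows_on E' N) < card (arrows_on E V)" if "N \<subseteq> V" for N
      by (rule psubset_card_mono) (use E a that in \<open>auto simp: E'_def arrows_from_def\<close>)
    obtain p where p: "p \<in> nat_polys (1 + y)" "semistable_sum y E' \<theta> V = y ^ (card V - 1) * p"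
      using less.hyps[OF sm V E' gen] by auto
    let ?T = "\<lambda>N. y * semistable_sum y E' (\<theta>(t a := \<theta> (t a) + (- sum \<theta> N))) N *
        semistable_sum y E' (\<theta>(h a := \<theta> (h a) + sum \<theta> N)) (V - N) *
        (1 + y) ^ card (arrows_from E' (V - N) N)"
    let ?I = "{N. N \<subseteq> V \<and> t a \<in> N \<and> h a \<notin> N \<and> sum \<theta> N > 0}"
    have "\<exists>p\<in>nat_polys (1 + y). ?T N = y ^ (card V - 1) * p" if "N \<in> ?I" for N
    proof -
      have N: "N \<subseteq> V" "t a \<in> N" "h a \<in> V - N" using that a by (auto simp: arrows_from_def)
      have fin: "finite N" "finite (V - N)" using V N finite_subset by auto
      have "sum \<theta> (V - N) = - sum \<theta> N" using N V V0 by (simp add: sum_diff)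
      then have gen2: "generic_weight (\<theta>(h a := \<theta> (h a) + sum \<theta> N)) (V - N)"
        using generic_weight_parts[OF V(1) gen _ N(3)] by simp
      have ne: "N \<noteq> {}" "V - N \<noteq> {}" using N by auto
      obtain p1 where p1: "p1 \<in> nat_polys (1 + y)"
        "semistable_sum y E' (\<theta>(t a := \<theta> (t a) + (- sum \<theta> N))) N = y ^ (card N - 1) * p1"
        using less.hyps[OF sm[OF N(1)] fin(1) ne(1) E' generic_weight_parts[OF V(1) gen N(1,2)]] by auto
      obtain p2 where p2: "p2 \<in> nat_polys (1 + y)"
        "semistable_sum y E' (\<theta>(h a := \<theta> (h a) + sum \<theta> N)) (V - N) = y ^ (card (V - N) - 1) * p2"
        using less.hyps[OF sm fin(2) ne(2) E' gen2] by auto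
      have "card V = card N + card (V - N)"
        using N V fin by (simp add: card_Diff_subset card_mono)
      moreover have "card N > 0" "card (V - N) > 0" using fin ne by (auto simp: card_gt_0_iff)
      ultimately have "card V - 1 = Suc ((card N - 1) + (card (V - N) - 1))" by simp
      then have "?T N = y ^ (card V - 1) * (p1 * p2 * (1 + y) ^ card (arrows_from E' (V - N) N))"
        unfolding p1(2) p2(2) by (simp add: power_add mult_ac)
      moreover have "p1 * p2 * (1 + y) ^ card (arrows_from E' (V - N) N) \<in> nat_polys (1 + y)"
        by (intro nat_polys_mult nat_polys_power p1 p2)
      ultimately show ?thesis by blast
    qed
    then have "\<forall>N\<in>?I. \<exists>p. p \<in> nat_polys (1 + y) \<and> ?T N = y ^ (card V - 1) * p"
      by (simp only: Bex_def) (rule ballI)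
    from bchoice[OF this]
    obtain P where P: "\<And>N. N \<in> ?I \<Longrightarrow> P N \<in> nat_polys (1 + y) \<and> ?T N = y ^ (card V - 1) * P N"
      by (elim exE) (erule meta_allE, erule meta_mp, erule bspec)
    have "semistable_sum y E \<theta> V = (1 + y) * (y ^ (card V - 1) * p) + (\<Sum>N\<in>?I. ?T N)"
      unfolding p(2)[symmetric] E'_def by (rule semistable_sum_remove_arrow[OF V(1) E gen a])
    also have "(\<Sum>N\<in>?I. ?T N) = (\<Sum>N\<in>?I. y ^ (card V - 1) * P N)"
      using P by (intro sum.cong) auto
    also have "(1 + y) * (y ^ (card V - 1) * p) + \<dots> = y ^ (card V - 1) * ((1 + y) * p + (\<Sum>N\<in>?I. P N))"
      by (simp add: sum_distrib_left algebra_simps)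
    finally show ?thesis
      using P p(1) by (intro bexI[of _ "(1 + y) * p + (\<Sum>N\<in>?I. P N)"])
        (auto intro!: nat_polys.add nat_polys.times_q nat_polys_sum)
  qed
qed

text \<open>
  The perturbed weight \<open>\<theta> + \<epsilon> (\<delta>\<^sub>v - 1/n)\<close> is generic: a proper nonempty subset of weight \<open>0\<close> gets a
  positive weight if it contains \<open>v\<close> and a negative one otherwise.
\<close>

lemma pointed_sum_positive:
  fixes y :: "'r::comm_ring_1"
  assumes V: "finite V" and v: "v \<in> V" and E: "finite E"
  shows "\<exists>p\<in>nat_polys (1 + y). pointed_sum y E \<theta> v V = y ^ (card V - 1) * p"
proof (cases "sum \<theta> V = 0")
  case False
  then have "pointed_sum y E \<theta> v V = 0"
    by (auto simp: pointed_sum_def pointed_support_def semistable_support_def)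
  then show ?thesis using nat_polys.zero by (intro bexI[of _ 0]) auto
next
  case V0: True
  \<comment> \<open>The perturbation stays below every nonzero weight, so it does not change their signs.\<close>
  define X where "X = insert 1 ((\<lambda>C. \<bar>sum \<theta> C\<bar>) ` {C. C \<subseteq> V \<and> sum \<theta> C \<noteq> 0})"
  define \<epsilon> where "\<epsilon> = Min X / 2"
  have X: "finite X" "\<And>x. x \<in> X \<Longrightarrow> x > 0" "X \<noteq> {}" using V by (auto simp: X_def)
  then have "Min X > 0" by simp
  then have \<epsilon>: "\<epsilon> > 0" "\<epsilon> < Min X" by (auto simp: \<epsilon>_def)
  have small: "\<epsilon> < \<bar>sum \<theta> C\<bar>" if "C \<subseteq> V" "sum \<theta> C \<noteq> 0" for C
  proof -
    have "Min X \<le> \<bar>sum \<theta> C\<bar>" using X(1) that by (intro Min_le) (auto simp: X_def)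
    with \<epsilon> show ?thesis by simp
  qed
  define n where "n = real (card V)"
  have n: "n > 0" using V v by (auto simp: n_def card_gt_0_iff)
  define \<theta>' where "\<theta>' = (\<lambda>w. \<theta> w + \<epsilon> * ((if w = v then 1 else 0) - 1 / n))"
  define \<delta> where "\<delta> = (\<lambda>C. (if v \<in> C then 1 else 0) - real (card C) / n)"
  have \<theta>': "sum \<theta>' C = sum \<theta> C + \<epsilon> * \<delta> C" if "C \<subseteq> V" for C
    using finite_subset[OF that V]
    by (simp add: \<theta>'_def \<delta>_def sum.distrib sum_distrib_left[symmetric] sum_subtractf)
  have frac: "real (card C) / n < 1" "C \<noteq> {} \<Longrightarrow> real (card C) / n > 0" if "C \<subset> V" for C
  proof -
    have "finite C" using that V by (auto intro: finite_subset)
    then show "C \<noteq> {} \<Longrightarrow> real (card C) / n > 0" using n by (auto simp: card_gt_0_iff)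
    show "real (card C) / n < 1" using psubset_card_mono[OF V that] n by (simp add: n_def)
  qed
  have \<delta>: "\<bar>\<delta> C\<bar> \<le> 1" "C \<noteq> {} \<Longrightarrow> \<delta> C \<noteq> 0" "v \<in> C \<Longrightarrow> \<delta> C > 0" "v \<notin> C \<Longrightarrow> \<delta> C \<le> 0"
    if "C \<subset> V" for C
    using frac[OF that] n by (auto simp: \<delta>_def)
  have \<delta>V: "\<delta> V = 0" using v n by (simp add: \<delta>_def n_def)
  have le: "\<bar>\<epsilon> * \<delta> C\<bar> \<le> \<epsilon>" if "C \<subset> V" for C
    using mult_left_mono[OF \<delta>(1)[OF that], of \<epsilon>] \<epsilon> by (simp add: abs_mult)
  have V0': "sum \<theta>' V = 0" using \<theta>'[of V] V0 \<delta>V by simp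
  have gen: "generic_weight \<theta>' V"
    unfolding generic_weight_def
  proof (intro conjI allI impI V0')
    fix C assume C: "C \<subset> V \<and> C \<noteq> {}"
    show "sum \<theta>' C \<noteq> 0"
      using \<theta>'[of C] C small[of C] le[of C] \<delta>(2)[of C] \<epsilon> by (cases "sum \<theta> C = 0") auto
  qed
  have iff: "sum \<theta>' C \<le> 0 \<longleftrightarrow> sum \<theta> C \<le> 0 \<and> (v \<in> C \<longrightarrow> sum \<theta> C < 0)" if C: "C \<subset> V" for C
  proof (cases "sum \<theta> C = 0")
    case True
    show ?thesis
    proof (cases "v \<in> C")
      case True
      then show ?thesis using \<delta>(3)[OF C] \<open>sum \<theta> C = 0\<close> \<theta>'[of C] C mult_pos_pos[OF \<epsilon>(1), of "\<delta> C"] by auto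
    next
      case False
      then show ?thesis using \<delta>(4)[OF C] \<open>sum \<theta> C = 0\<close> \<theta>'[of C] C mult_nonneg_nonpos[of \<epsilon> "\<delta> C"] \<epsilon> by auto
    qed
  next
    case False
    then show ?thesis using \<theta>'[of C] C small[of C] le[of C] by auto
  qed
  have "pointed_support \<theta> v V S \<longleftrightarrow> semistable_support \<theta>' V S" for S
  proof
    assume L: "pointed_support \<theta> v V S"
    have "sum \<theta>' C \<le> 0" if C: "C \<subseteq> V" "closed_under S C" for C
    proof (cases "C = V")
      case False
      then have "C \<subset> V" using C by auto
      moreover have "sum \<theta> C \<le> 0" "v \<in> C \<Longrightarrow> sum \<theta> C < 0"
        using L C \<open>C \<subset> V\<close> by (simp_all add: pointed_support_def semistable_support_def)
      ultimately show ?thesis using iff by simp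
    qed (simp add: V0')
    then show "semistable_support \<theta>' V S" by (simp add: semistable_support_def V0')
  next
    assume R: "semistable_support \<theta>' V S"
    have *: "sum \<theta> C \<le> 0 \<and> (v \<in> C \<longrightarrow> sum \<theta> C < 0)" if C: "C \<subset> V" "closed_under S C" for C
      using R C iff[OF C(1)] by (simp add: semistable_support_def)
    then have "sum \<theta> C \<le> 0" if "C \<subseteq> V" "closed_under S C" for C
      using that V0 by (cases "C = V") auto
    with * show "pointed_support \<theta> v V S"
      by (simp add: pointed_support_def semistable_support_def V0)
  qed
  then have "pointed_sum y E \<theta> v V = semistable_sum y E \<theta>' V"
    by (simp add: pointed_sum_def semistable_sum_def)
  then show ?thesis using semistable_sum_positive[OF V _ E gen, of y] v by auto
qed

end

section \<open>Spaces with well-behaved regular functions\<close>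

text \<open>
  What morphisms into affine spaces need from their source. Prevarieties have these properties, and
  so do all subsets of affine spaces, which makes it possible to argue with functions only.
\<close>

definition locally_ringed :: "'a fun_space \<Rightarrow> bool" where
  "locally_ringed X \<longleftrightarrow> function_sheaf X \<and>
     (\<forall>U. openin (zariski X) U \<longrightarrow>
        (\<forall>c. (\<lambda>x\<in>U. c) \<in> regular X U) \<and>
        (\<forall>f\<in>regular X U. \<forall>g\<in>regular X U.
           (\<lambda>x\<in>U. f x + g x) \<in> regular X U \<and> (\<lambda>x\<in>U. f x * g x) \<in> regular X U) \<and>
        (\<forall>f\<in>regular X U. openin (zariski X) {x \<in> U. f x \<noteq> 0} \<and>
           (\<lambda>x\<in>{x \<in> U. f x \<noteq> 0}. inverse (f x)) \<in> regular X {x \<in> U. f x \<noteq> 0}))"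

lemma function_sheafI_local:
  assumes reg: "\<And>U. openin (zariski X) U \<Longrightarrow> regular X U =
      {f \<in> extensional U. \<forall>x\<in>U. \<exists>W. openin (zariski X) W \<and> x \<in> W \<and> W \<subseteq> U \<and> P W f}"
    and mono: "\<And>W W' f g. P W f \<Longrightarrow> openin (zariski X) W' \<Longrightarrow> W' \<subseteq> W \<Longrightarrow>
      (\<And>x. x \<in> W' \<Longrightarrow> f x = g x) \<Longrightarrow> P W' g"
  shows "function_sheaf X"
proof -
  have ex: "\<exists>W. openin (zariski X) W \<and> x \<in> W \<and> W \<subseteq> U \<and> P W f"
    if "openin (zariski X) U" "f \<in> regular X U" "x \<in> U" for U f x
    using that(2,3) by (simp add: reg[OF that(1)])
  show ?thesis unfolding function_sheaf_def
proof (intro conjI allI impI, goal_cases)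
  case (1 U)
  then show ?case using reg by fast
next
  case (2 U W f)
  then have op: "openin (zariski X) U" "openin (zariski X) W" "W \<subseteq> U" "f \<in> regular X U" by auto
  have "\<exists>W'. openin (zariski X) W' \<and> x \<in> W' \<and> W' \<subseteq> W \<and> P W' (restrict f W)" if "x \<in> W" for x
  proof -
    have "x \<in> U" using op(3) that by auto
    from ex[OF op(1,4) this]
    obtain V where V: "openin (zariski X) V" "x \<in> V" "V \<subseteq> U" "P V f"
      by (elim exE conjE)
    have "P (V \<inter> W) (restrict f W)"
      by (rule mono[OF V(4)]) (use V op in auto)
    then show ?thesis using V op that by (intro exI[of _ "V \<inter> W"]) auto
  qed
  then show ?case by (simp add: reg[OF op(2)])
next
  case (3 U f)
  then have U: "openin (zariski X) U" and f: "f \<in> extensional U" by auto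
  from 3 have loc: "\<forall>x\<in>U. \<exists>W. openin (zariski X) W \<and> x \<in> W \<and> W \<subseteq> U \<and> restrict f W \<in> regular X W"
    by (elim conjE)
  have "\<exists>W. openin (zariski X) W \<and> x \<in> W \<and> W \<subseteq> U \<and> P W f" if x: "x \<in> U" for x
  proof -
    obtain W where W: "openin (zariski X) W" "x \<in> W" "W \<subseteq> U" "restrict f W \<in> regular X W"
      using bspec[OF loc x] by (elim exE conjE)
    then obtain V where V: "openin (zariski X) V" "x \<in> V" "V \<subseteq> W" "P V (restrict f W)"
      using ex[OF W(1,4,2)] by (elim exE conjE)
    have "P V f" by (rule mono[OF V(4)]) (use V in auto)
    then show ?thesis using V W by (intro exI[of _ V]) auto
  qed
  then show ?case using f by (simp add: reg[OF U])
qed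
qed

text \<open>
  A sheaf of functions described by a local condition inherits closure properties from the
  condition.
\<close>

lemma locally_ringedI_local:
  assumes reg: "\<And>U. openin (zariski X) U \<Longrightarrow> regular X U =
      {f \<in> extensional U. \<forall>x\<in>U. \<exists>W. openin (zariski X) W \<and> x \<in> W \<and> W \<subseteq> U \<and> P W f}"
    and mono: "\<And>W W' f g. P W f \<Longrightarrow> openin (zariski X) W' \<Longrightarrow> W' \<subseteq> W \<Longrightarrow>
      (\<And>x. x \<in> W' \<Longrightarrow> f x = g x) \<Longrightarrow> P W' g"
    and const: "\<And>W c. openin (zariski X) W \<Longrightarrow> P W (\<lambda>_. c)"
    and add: "\<And>W f g. openin (zariski X) W \<Longrightarrow> P W f \<Longrightarrow> P W g \<Longrightarrow> P W (\<lambda>x. f x + g x)"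
    and mult: "\<And>W f g. openin (zariski X) W \<Longrightarrow> P W f \<Longrightarrow> P W g \<Longrightarrow> P W (\<lambda>x. f x * g x)"
    and inv: "\<And>W f. openin (zariski X) W \<Longrightarrow> P W f \<Longrightarrow>
      openin (zariski X) {x \<in> W. f x \<noteq> 0} \<and> P {x \<in> W. f x \<noteq> 0} (\<lambda>x. inverse (f x))"
  shows "locally_ringed X"
proof -
  have ex: "\<exists>W. openin (zariski X) W \<and> x \<in> W \<and> W \<subseteq> U \<and> P W f"
    if "openin (zariski X) U" "f \<in> regular X U" "x \<in> U" for U f x
    using that(2,3) by (simp add: reg[OF that(1)])
  show ?thesis unfolding locally_ringed_def
proof (intro conjI allI impI ballI)
  show "function_sheaf X" by (rule function_sheafI_local[OF reg mono])
next
  fix U c assume U: "openin (zariski X) U"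
  have "P U (\<lambda>x\<in>U. c)" by (rule mono[OF const[OF U, of c] U]) auto
  then show "(\<lambda>x\<in>U. c) \<in> regular X U" using U by (auto simp: reg[OF U])
next
  fix U f g assume U: "openin (zariski X) U" and fg: "f \<in> regular X U" "g \<in> regular X U"
  have "\<exists>W. openin (zariski X) W \<and> x \<in> W \<and> W \<subseteq> U \<and> P W (\<lambda>x\<in>U. f x + g x) \<and> P W (\<lambda>x\<in>U. f x * g x)"
    if x: "x \<in> U" for x
  proof -
    obtain W1 where W1: "openin (zariski X) W1" "x \<in> W1" "W1 \<subseteq> U" "P W1 f"
      using ex[OF U fg(1) x] by (elim exE conjE)
    obtain W2 where W2: "openin (zariski X) W2" "x \<in> W2" "W2 \<subseteq> U" "P W2 g"
      using ex[OF U fg(2) x] by (elim exE conjE)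
    let ?W = "W1 \<inter> W2"
    have W: "openin (zariski X) ?W" using W1 W2 by auto
    have "P ?W f" "P ?W g" by (rule mono[OF W1(4) W], auto) (rule mono[OF W2(4) W], auto)
    note fg' = this
    have "P ?W (\<lambda>x\<in>U. f x + g x)"
      by (rule mono[OF add[OF W fg'] W order_refl]) (use W1 in auto)
    moreover have "P ?W (\<lambda>x\<in>U. f x * g x)"
      by (rule mono[OF mult[OF W fg'] W order_refl]) (use W1 in auto)
    ultimately show ?thesis using W W1 W2 by blast
  qed
  then show "(\<lambda>x\<in>U. f x + g x) \<in> regular X U" "(\<lambda>x\<in>U. f x * g x) \<in> regular X U"
    by (simp_all add: reg[OF U]) blast+
next
  fix U f assume U: "openin (zariski X) U" and f: "f \<in> regular X U"
  let ?D = "{x \<in> U. f x \<noteq> 0}"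
  have ex': "\<exists>W. openin (zariski X) W \<and> x \<in> W \<and> W \<subseteq> ?D \<and> P W (\<lambda>x\<in>?D. inverse (f x))" if x: "x \<in> ?D" for x
  proof -
    obtain W where W: "openin (zariski X) W" "x \<in> W" "W \<subseteq> U" "P W f"
      using ex[OF U f CollectD[OF x, THEN conjunct1]] by (elim exE conjE)
    let ?W = "{x \<in> W. f x \<noteq> 0}"
    have i: "openin (zariski X) ?W" "P ?W (\<lambda>x. inverse (f x))" using inv[OF W(1,4)] by auto
    have "P ?W (\<lambda>x\<in>?D. inverse (f x))" by (rule mono[OF i(2,1)]) (use W in auto)
    then show ?thesis using i x W by (intro exI[of _ ?W]) auto
  qed
  show D: "openin (zariski X) ?D"
    by (subst openin_subopen) (use ex' in blast)
  show "(\<lambda>x\<in>?D. inverse (f x)) \<in> regular X ?D"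
    unfolding reg[OF D] using ex' by blast
qed
qed

lemma locally_ringedD:
  assumes "locally_ringed X"
  shows "function_sheaf X"
    and "openin (zariski X) U \<Longrightarrow> (\<lambda>x\<in>U. c) \<in> regular X U"
    and "openin (zariski X) U \<Longrightarrow> f \<in> regular X U \<Longrightarrow> g \<in> regular X U \<Longrightarrow> (\<lambda>x\<in>U. f x + g x) \<in> regular X U"
    and "openin (zariski X) U \<Longrightarrow> f \<in> regular X U \<Longrightarrow> g \<in> regular X U \<Longrightarrow> (\<lambda>x\<in>U. f x * g x) \<in> regular X U"
    and "openin (zariski X) U \<Longrightarrow> f \<in> regular X U \<Longrightarrow> openin (zariski X) {x \<in> U. f x \<noteq> 0}"
    and "openin (zariski X) U \<Longrightarrow> f \<in> regular X U \<Longrightarrow>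
      (\<lambda>x\<in>{x \<in> U. f x \<noteq> 0}. inverse (f x)) \<in> regular X {x \<in> U. f x \<noteq> 0}"
  using assms unfolding locally_ringed_def by blast+

lemma function_sheafD:
  assumes "function_sheaf X"
  shows "openin (zariski X) U \<Longrightarrow> f \<in> regular X U \<Longrightarrow> f \<in> extensional U"
    and "openin (zariski X) U \<Longrightarrow> openin (zariski X) W \<Longrightarrow> W \<subseteq> U \<Longrightarrow> f \<in> regular X U \<Longrightarrow>
      restrict f W \<in> regular X W"
    and "openin (zariski X) U \<Longrightarrow> f \<in> extensional U \<Longrightarrow>
      (\<And>x. x \<in> U \<Longrightarrow> \<exists>W. openin (zariski X) W \<and> x \<in> W \<and> W \<subseteq> U \<and> restrict f W \<in> regular X W) \<Longrightarrow>
      f \<in> regular X U"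
  using assms unfolding function_sheaf_def by (blast, blast, simp)

lemma poly_funs_prod:
  "finite A \<Longrightarrow> (\<And>a. a \<in> A \<Longrightarrow> p a \<in> poly_funs I) \<Longrightarrow> (\<lambda>x. \<Prod>a\<in>A. p a x) \<in> poly_funs I"
  by (induction A rule: finite_induct) (auto intro: poly_funs.intros)

lemma zariski_affine_space:
  "zariski (affine_space I) = topology_generated_by {{x \<in> I \<rightarrow>\<^sub>E UNIV. p x \<noteq> 0} | p. p \<in> poly_funs I}"
  by (simp add: affine_space_def Let_def)

lemma openin_basic: "p \<in> poly_funs I \<Longrightarrow> openin (zariski (affine_space I)) {x \<in> I \<rightarrow>\<^sub>E UNIV. p x \<noteq> 0}"
  unfolding zariski_affine_space by (rule topology_generated_by_Basis) auto

lemma topspace_affine_space [simp]: "topspace (zariski (affine_space I)) = I \<rightarrow>\<^sub>E UNIV"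
proof -
  have "(\<lambda>_. 1) \<in> poly_funs I" by (rule poly_funs.const)
  then have "I \<rightarrow>\<^sub>E UNIV \<in> {{x \<in> I \<rightarrow>\<^sub>E UNIV. p x \<noteq> 0} | p. p \<in> poly_funs I}"
    by (intro CollectI exI[of _ "\<lambda>_. 1"]) simp
  then show ?thesis
    unfolding zariski_affine_space topology_generated_by_topspace
    by (intro equalityI Union_least Union_upper) auto
qed

text \<open>
  Basic open sets form a basis, not only a subbasis, because
  they are stable under finite intersections.
\<close>

lemma openin_affine_space_basis:
  assumes "openin (zariski (affine_space I)) U" "x \<in> U"
  shows "\<exists>p\<in>poly_funs I. p x \<noteq> 0 \<and> {y \<in> I \<rightarrow>\<^sub>E UNIV. p y \<noteq> 0} \<subseteq> U"
proof -
  have "generate_topology_on {{x \<in> I \<rightarrow>\<^sub>E UNIV. p x \<noteq> 0} | p. p \<in> poly_funs I} U"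
    using assms(1) unfolding zariski_affine_space openin_topology_generated_by_iff .
  then show ?thesis using assms(2)
  proof induction
    case (Int a b)
    then obtain p p' where "p \<in> poly_funs I" "p x \<noteq> 0" "{y \<in> I \<rightarrow>\<^sub>E UNIV. p y \<noteq> 0} \<subseteq> a"
      "p' \<in> poly_funs I" "p' x \<noteq> 0" "{y \<in> I \<rightarrow>\<^sub>E UNIV. p' y \<noteq> 0} \<subseteq> b" by blast
    then show ?case
      by (intro bexI[of _ "\<lambda>x. p x * p' x"]) (auto intro: poly_funs.mult)
  next
    case (UN K)
    then obtain k where k: "k \<in> K" "x \<in> k" by auto
    from UN.IH[OF k] obtain p where "p \<in> poly_funs I" "p x \<noteq> 0" "{y \<in> I \<rightarrow>\<^sub>E UNIV. p y \<noteq> 0} \<subseteq> k" by auto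
    then show ?case using k(1) by (intro bexI[of _ p]) auto
  next
    case (Basis s)
    then obtain p where "p \<in> poly_funs I" "s = {x \<in> I \<rightarrow>\<^sub>E UNIV. p x \<noteq> 0}" by auto
    then show ?case using Basis.prems by (intro bexI[of _ p]) auto
  qed simp
qed

text \<open>
  Regular functions in the form required by \<open>locally_ringedI_local\<close>.
\<close>

lemma regular_affine_space:
  "regular (affine_space I) U = {f \<in> extensional U. \<forall>x\<in>U. \<exists>W. openin (zariski (affine_space I)) W \<and>
     x \<in> W \<and> W \<subseteq> U \<and> (\<exists>p\<in>poly_funs I. \<exists>p'\<in>poly_funs I. \<forall>y\<in>W. p' y \<noteq> 0 \<and> f y = p y / p' y)}"
  by (simp add: affine_space_def Let_def Bex_def conj_assoc)

lemma locally_ringed_affine_space: "locally_ringed (affine_space I)"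
proof (rule locally_ringedI_local[OF regular_affine_space], goal_cases)
  case (1 W W' f g)
  then show ?case by (metis subsetD)
next
  case (2 W c)
  show ?case
    by (rule bexI[of _ "\<lambda>_. c"], rule bexI[of _ "\<lambda>_. 1"]) (auto intro: poly_funs.const)
next
  case (3 W f g)
  then obtain p p' r r' where *: "p \<in> poly_funs I" "p' \<in> poly_funs I" "\<forall>y\<in>W. p' y \<noteq> 0 \<and> f y = p y / p' y"
    "r \<in> poly_funs I" "r' \<in> poly_funs I" "\<forall>y\<in>W. r' y \<noteq> 0 \<and> g y = r y / r' y" by blast
  show ?case
    by (rule bexI[of _ "\<lambda>x. p x * r' x + r x * p' x"], rule bexI[of _ "\<lambda>x. p' x * r' x"])
       (use * in \<open>auto intro!: poly_funs.mult poly_funs.add simp: add_frac_eq\<close>)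
next
  case (4 W f g)
  then obtain p p' r r' where *: "p \<in> poly_funs I" "p' \<in> poly_funs I" "\<forall>y\<in>W. p' y \<noteq> 0 \<and> f y = p y / p' y"
    "r \<in> poly_funs I" "r' \<in> poly_funs I" "\<forall>y\<in>W. r' y \<noteq> 0 \<and> g y = r y / r' y" by blast
  show ?case
    by (rule bexI[of _ "\<lambda>x. p x * r x"], rule bexI[of _ "\<lambda>x. p' x * r' x"])
       (use * in \<open>auto intro!: poly_funs.mult\<close>)
next
  case (5 W f)
  then obtain p p' where *: "p \<in> poly_funs I" "p' \<in> poly_funs I" "\<forall>y\<in>W. p' y \<noteq> 0 \<and> f y = p y / p' y"
    by blast
  have "W \<subseteq> I \<rightarrow>\<^sub>E UNIV" using openin_subset[OF 5(1)] by simp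
  then have eq: "{x \<in> W. f x \<noteq> 0} = W \<inter> {x \<in> I \<rightarrow>\<^sub>E UNIV. p x \<noteq> 0}" using * by auto
  have "openin (zariski (affine_space I)) {x \<in> W. f x \<noteq> 0}"
    unfolding eq using 5(1) openin_basic[OF *(1)] by blast
  moreover have "\<exists>p\<in>poly_funs I. \<exists>p'\<in>poly_funs I.
        \<forall>y\<in>{x \<in> W. f x \<noteq> 0}. p' y \<noteq> 0 \<and> inverse (f y) = p y / p' y"
    by (rule bexI[of _ p'], rule bexI[of _ p]) (use * in auto)
  ultimately show ?case by blast
qed

lemma zariski_induced [simp]: "zariski (induced X S) = subtopology (zariski X) S"
  by (simp add: induced_def)

text \<open>
  The neighbourhoods in the definition are open in \<open>X\<close>; here they are replaced by open subsets of the
  induced space that lie inside \<open>U\<close>, the form required by \<open>locally_ringedI_local\<close>.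
\<close>

lemma regular_induced:
  assumes U: "openin (zariski (induced X S)) U" and X: "function_sheaf X"
  shows "regular (induced X S) U = {f \<in> extensional U. \<forall>x\<in>U. \<exists>W. openin (zariski (induced X S)) W \<and>
     x \<in> W \<and> W \<subseteq> U \<and> (\<exists>V h. openin (zariski X) V \<and> W = V \<inter> S \<and> h \<in> regular X V \<and> (\<forall>y\<in>W. f y = h y))}"
proof (intro equalityI subsetI)
  fix f assume f: "f \<in> regular (induced X S) U"
  obtain U' where U': "openin (zariski X) U'" "U = U' \<inter> S"
    using U by (auto simp: openin_subtopology)
  have "\<exists>W. openin (zariski (induced X S)) W \<and>
     x \<in> W \<and> W \<subseteq> U \<and> (\<exists>V h. openin (zariski X) V \<and> W = V \<inter> S \<and> h \<in> regular X V \<and> (\<forall>y\<in>W. f y = h y))"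
    if x: "x \<in> U" for x
  proof -
    obtain W h where W: "openin (zariski X) W" "x \<in> W" "h \<in> regular X W" "\<forall>y\<in>W \<inter> U. f y = h y"
      using f x by (auto simp: induced_def)
    have "restrict h (W \<inter> U') \<in> regular X (W \<inter> U')"
      by (rule function_sheafD(2)[OF X W(1) _ _ W(3)]) (use W U' in auto)
    then show ?thesis
      using W U' x by (intro exI[of _ "W \<inter> U' \<inter> S"] conjI exI[of _ "W \<inter> U'"] exI[of _ "restrict h (W \<inter> U')"])
        (auto simp: openin_subtopology)
  qed
  then show "f \<in> {f \<in> extensional U. \<forall>x\<in>U. \<exists>W. openin (zariski (induced X S)) W \<and>
     x \<in> W \<and> W \<subseteq> U \<and> (\<exists>V h. openin (zariski X) V \<and> W = V \<inter> S \<and> h \<in> regular X V \<and> (\<forall>y\<in>W. f y = h y))}"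
    using f by (auto simp: induced_def)
next
  fix f assume f: "f \<in> {f \<in> extensional U. \<forall>x\<in>U. \<exists>W. openin (zariski (induced X S)) W \<and>
     x \<in> W \<and> W \<subseteq> U \<and> (\<exists>V h. openin (zariski X) V \<and> W = V \<inter> S \<and> h \<in> regular X V \<and> (\<forall>y\<in>W. f y = h y))}"
  have US: "U \<subseteq> S" using U by (auto simp: openin_subtopology)
  have "\<exists>W h. openin (zariski X) W \<and> x \<in> W \<and> h \<in> regular X W \<and> (\<forall>y\<in>W \<inter> U. f y = h y)" if x: "x \<in> U" for x
  proof -
    obtain V h where "openin (zariski X) V" "x \<in> V \<inter> S" "h \<in> regular X V" "\<forall>y\<in>V \<inter> S. f y = h y"
      using f x by auto
    then show ?thesis using US by (intro exI[of _ V] exI[of _ h]) auto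
  qed
  then show "f \<in> regular (induced X S) U" using f by (auto simp: induced_def)
qed

lemma induced_germ_mono:
  assumes "function_sheaf X"
    and "\<exists>V h. openin (zariski X) V \<and> W = V \<inter> S \<and> h \<in> regular X V \<and> (\<forall>y\<in>W. f y = h y)"
    and "openin (zariski (induced X S)) W'" "W' \<subseteq> W" "\<And>x. x \<in> W' \<Longrightarrow> f x = g x"
  shows "\<exists>V h. openin (zariski X) V \<and> W' = V \<inter> S \<and> h \<in> regular X V \<and> (\<forall>y\<in>W'. g y = h y)"
proof -
  obtain V h where V: "openin (zariski X) V" "W = V \<inter> S" "h \<in> regular X V" "\<forall>y\<in>W. f y = h y"
    using assms by blast
  obtain V' where V': "openin (zariski X) V'" "W' = V' \<inter> S"
    using assms(3) by (auto simp: openin_subtopology)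
  have "restrict h (V \<inter> V') \<in> regular X (V \<inter> V')"
    by (rule function_sheafD(2)[OF assms(1) V(1) _ _ V(3)]) (use V V' in auto)
  moreover have "g y = h y" if "y \<in> W'" for y
    using V(4) assms(4) assms(5)[OF that, symmetric] that by auto
  ultimately show ?thesis
    using V V' assms(4) by (intro exI[of _ "V \<inter> V'"] exI[of _ "restrict h (V \<inter> V')"]) auto
qed

lemma function_sheaf_induced:
  assumes "function_sheaf X"
  shows "function_sheaf (induced X S)"
proof (rule function_sheafI_local[OF regular_induced[OF _ assms]], assumption, goal_cases)
  case (1 W W' f g)
  show ?case by (rule induced_germ_mono[OF assms 1])
qed

lemma locally_ringed_induced:
  assumes X: "locally_ringed X"
  shows "locally_ringed (induced X S)"
proof (rule locally_ringedI_local[OF regular_induced[OF _ locally_ringedD(1)[OF X]]], assumption, goal_cases)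
  case (1 W W' f g)
  show ?case by (rule induced_germ_mono[OF locally_ringedD(1)[OF X] 1])
next
  case (2 W c)
  then obtain V where V: "openin (zariski X) V" "W = V \<inter> S" by (auto simp: openin_subtopology)
  show ?case
    by (rule exI[of _ V], rule exI[of _ "\<lambda>x\<in>V. c"]) (use V locally_ringedD(2)[OF X] in auto)
next
  case (3 W f g)
  then obtain V h V' h' where V: "openin (zariski X) V" "W = V \<inter> S" "h \<in> regular X V" "\<forall>y\<in>W. f y = h y"
    "openin (zariski X) V'" "W = V' \<inter> S" "h' \<in> regular X V'" "\<forall>y\<in>W. g y = h' y" by blast
  let ?V = "V \<inter> V'"
  have "restrict h ?V \<in> regular X ?V" "restrict h' ?V \<in> regular X ?V" "openin (zariski X) ?V"
    using V by (auto intro: function_sheafD(2)[OF locally_ringedD(1)[OF X]])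
  from locally_ringedD(3)[OF X this(3,1,2)] show ?case
    by (intro exI[of _ ?V] exI conjI) (use V in auto)
next
  case (4 W f g)
  then obtain V h V' h' where V: "openin (zariski X) V" "W = V \<inter> S" "h \<in> regular X V" "\<forall>y\<in>W. f y = h y"
    "openin (zariski X) V'" "W = V' \<inter> S" "h' \<in> regular X V'" "\<forall>y\<in>W. g y = h' y" by blast
  let ?V = "V \<inter> V'"
  have "restrict h ?V \<in> regular X ?V" "restrict h' ?V \<in> regular X ?V" "openin (zariski X) ?V"
    using V by (auto intro: function_sheafD(2)[OF locally_ringedD(1)[OF X]])
  from locally_ringedD(4)[OF X this(3,1,2)] show ?case
    by (intro exI[of _ ?V] exI conjI) (use V in auto)
next
  case (5 W f)
  then obtain V h where V: "openin (zariski X) V" "W = V \<inter> S" "h \<in> regular X V" "\<forall>y\<in>W. f y = h y"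
    by blast
  let ?D = "{x \<in> V. h x \<noteq> 0}"
  have D: "openin (zariski X) ?D" "{x \<in> W. f x \<noteq> 0} = ?D \<inter> S"
    using V locally_ringedD(5)[OF X V(1,3)] by auto
  then have "openin (zariski (induced X S)) {x \<in> W. f x \<noteq> 0}"
    by (auto simp: openin_subtopology)
  moreover have "\<exists>V h. openin (zariski X) V \<and> {x \<in> W. f x \<noteq> 0} = V \<inter> S \<and> h \<in> regular X V \<and>
      (\<forall>y\<in>{x \<in> W. f x \<noteq> 0}. inverse (f y) = h y)"
    by (intro exI[of _ ?D] exI[of _ "\<lambda>x\<in>?D. inverse (h x)"] conjI D locally_ringedD(6)[OF X V(1,3)])
       (use V in auto)
  ultimately show ?case by blast
qed

lemma morphismD:
  assumes "morphism X Y \<phi>"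
  shows "continuous_map (zariski X) (zariski Y) \<phi>"
    and "x \<in> points X \<Longrightarrow> \<phi> x \<in> points Y"
    and "openin (zariski Y) V \<Longrightarrow> openin (zariski X) {x \<in> points X. \<phi> x \<in> V}"
    and "openin (zariski Y) V \<Longrightarrow> h \<in> regular Y V \<Longrightarrow>
      (\<lambda>x\<in>{x \<in> points X. \<phi> x \<in> V}. h (\<phi> x)) \<in> regular X {x \<in> points X. \<phi> x \<in> V}"
  using assms unfolding morphism_def continuous_map_def by (auto simp: comp_def)

lemma morphism_compose:
  assumes "morphism X Y \<phi>" "morphism Y Y' \<psi>"
  shows "morphism X Y' (\<psi> \<circ> \<phi>)"
  unfolding morphism_def
proof (intro conjI allI impI)
  show "continuous_map (zariski X) (zariski Y') (\<psi> \<circ> \<phi>)"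
    by (rule continuous_map_compose[OF morphismD(1)[OF assms(1)] morphismD(1)[OF assms(2)]])
  fix V h assume V: "openin (zariski Y') V \<and> h \<in> regular Y' V"
  let ?V = "{y \<in> points Y. \<psi> y \<in> V}"
  have "(\<lambda>x\<in>{x \<in> points X. \<phi> x \<in> ?V}. (\<lambda>y\<in>?V. h (\<psi> y)) (\<phi> x)) \<in> regular X {x \<in> points X. \<phi> x \<in> ?V}"
    by (rule morphismD(4)[OF assms(1) morphismD(3)[OF assms(2) V[THEN conjunct1]]
          morphismD(4)[OF assms(2) V[THEN conjunct1] V[THEN conjunct2]]])
  moreover have "{x \<in> points X. \<phi> x \<in> ?V} = {x \<in> points X. (\<psi> \<circ> \<phi>) x \<in> V}"
    using morphismD(2)[OF assms(1)] by auto
  moreover have "(\<lambda>x\<in>{x \<in> points X. \<phi> x \<in> ?V}. (\<lambda>y\<in>?V. h (\<psi> y)) (\<phi> x)) =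
      restrict (h \<circ> (\<psi> \<circ> \<phi>)) {x \<in> points X. (\<psi> \<circ> \<phi>) x \<in> V}"
    using morphismD(2)[OF assms(1)] by (auto simp: fun_eq_iff restrict_def)
  ultimately show "restrict (h \<circ> (\<psi> \<circ> \<phi>)) {x \<in> points X. (\<psi> \<circ> \<phi>) x \<in> V} \<in> regular X {x \<in> points X. (\<psi> \<circ> \<phi>) x \<in> V}"
    by simp
qed

lemma isomorphic_sym: "isomorphic X Y \<Longrightarrow> isomorphic Y X"
  unfolding isomorphic_def by blast

lemma isomorphic_trans:
  assumes "isomorphic X Y" "isomorphic Y Y'"
  shows "isomorphic X Y'"
proof -
  obtain \<phi> \<psi> where 1: "morphism X Y \<phi>" "morphism Y X \<psi>" "\<forall>x\<in>points X. \<psi> (\<phi> x) = x" "\<forall>y\<in>points Y. \<phi> (\<psi> y) = y"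
    using assms(1) unfolding isomorphic_def by blast
  obtain \<phi>' \<psi>' where 2: "morphism Y Y' \<phi>'" "morphism Y' Y \<psi>'" "\<forall>x\<in>points Y. \<psi>' (\<phi>' x) = x" "\<forall>y\<in>points Y'. \<phi>' (\<psi>' y) = y"
    using assms(2) unfolding isomorphic_def by blast
  have "morphism X Y' (\<phi>' \<circ> \<phi>)" "morphism Y' X (\<psi> \<circ> \<psi>')"
    by (rule morphism_compose[OF 1(1) 2(1)], rule morphism_compose[OF 2(2) 1(2)])
  then show ?thesis unfolding isomorphic_def
    using 1 2 morphismD(2)[OF 1(1)] morphismD(2)[OF 2(2)] by (intro exI[of _ "\<phi>' \<circ> \<phi>"] exI[of _ "\<psi> \<circ> \<psi>'"]) auto
qed

lemma locally_ringed_isomorphic: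
  assumes X: "function_sheaf X" and Y: "locally_ringed Y" and iso: "isomorphic X Y"
  shows "locally_ringed X"
proof -
  obtain \<phi> \<psi> where \<phi>: "morphism X Y \<phi>" and \<psi>: "morphism Y X \<psi>"
    and inv: "\<forall>x\<in>points X. \<psi> (\<phi> x) = x" "\<forall>y\<in>points Y. \<phi> (\<psi> y) = y"
    using iso unfolding isomorphic_def by blast
  \<comment> \<open>Functions on \<open>X\<close> are transported to \<open>Y\<close>, combined there and pulled back.\<close>
  define T where "T = (\<lambda>U. {y \<in> points Y. \<psi> y \<in> U})"
  define p where "p = (\<lambda>U (f :: 'a \<Rightarrow> complex). \<lambda>y\<in>T U. f (\<psi> y))"
  have T: "openin (zariski Y) (T U)" if "openin (zariski X) U" for U
    using morphismD(3)[OF \<psi> that] by (simp add: T_def)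
  have p: "p U f \<in> regular Y (T U)" if "openin (zariski X) U" "f \<in> regular X U" for U f
    using morphismD(4)[OF \<psi> that] by (simp add: T_def p_def)
  have TX: "{x \<in> points X. \<phi> x \<in> T U} = U" if "openin (zariski X) U" for U
    using openin_subset[OF that] inv morphismD(2)[OF \<phi>] by (auto simp: T_def)
  have pull: "(\<lambda>x\<in>U. k (\<phi> x)) \<in> regular X U" if "openin (zariski X) U" "k \<in> regular Y (T U)" for U k
    using morphismD(4)[OF \<phi> T[OF that(1)] that(2)] TX[OF that(1)] by simp
  have T\<phi>: "\<phi> x \<in> T U \<and> \<psi> (\<phi> x) = x" if "openin (zariski X) U" "x \<in> U" for U x
    using TX[OF that(1)] that inv openin_subset[OF that(1)] by auto
  show ?thesis unfolding locally_ringed_def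
  proof (intro conjI allI impI ballI X)
    fix U c assume U: "openin (zariski X) U"
    show "(\<lambda>x\<in>U. c) \<in> regular X U"
      using pull[OF U locally_ringedD(2)[OF Y T[OF U], of c]] T\<phi>[OF U] by (simp cong: restrict_cong)
  next
    fix U f g assume U: "openin (zariski X) U" and fg: "f \<in> regular X U" "g \<in> regular X U"
    show "(\<lambda>x\<in>U. f x + g x) \<in> regular X U"
      using pull[OF U locally_ringedD(3)[OF Y T[OF U] p[OF U fg(1)] p[OF U fg(2)]]] T\<phi>[OF U]
      by (simp add: p_def cong: restrict_cong)
    show "(\<lambda>x\<in>U. f x * g x) \<in> regular X U"
      using pull[OF U locally_ringedD(4)[OF Y T[OF U] p[OF U fg(1)] p[OF U fg(2)]]] T\<phi>[OF U]
      by (simp add: p_def cong: restrict_cong)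
  next
    fix U f assume U: "openin (zariski X) U" and f: "f \<in> regular X U"
    let ?D = "{x \<in> U. f x \<noteq> 0}"
    have eq: "{y \<in> T U. p U f y \<noteq> 0} = T ?D" by (auto simp: p_def T_def)
    have "{x \<in> points X. \<phi> x \<in> T ?D} = ?D"
      using openin_subset[OF U] inv morphismD(2)[OF \<phi>] by (auto simp: T_def)
    then show D: "openin (zariski X) ?D"
      using morphismD(3)[OF \<phi> locally_ringedD(5)[OF Y T[OF U] p[OF U f]]] by (simp add: eq)
    show "(\<lambda>x\<in>?D. inverse (f x)) \<in> regular X ?D"
      using pull[OF D locally_ringedD(6)[OF Y T[OF U] p[OF U f], unfolded eq]] T\<phi>[OF U] T\<phi>[OF D]
      by (simp add: p_def cong: restrict_cong)
  qed
qed

section \<open>Morphisms into affine spaces\<close>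

lemma regular_induced_open:
  assumes X: "function_sheaf X" and W: "openin (zariski X) W"
  shows "regular (induced X U) W = regular X W"
proof (intro equalityI subsetI)
  fix f assume f: "f \<in> regular (induced X U) W"
  show "f \<in> regular X W"
  proof (rule function_sheafD(3)[OF X W])
    show "f \<in> extensional W" using f by (simp add: induced_def)
    fix x assume x: "x \<in> W"
    obtain V h where V: "openin (zariski X) V" "x \<in> V" "h \<in> regular X V" "\<forall>y\<in>V \<inter> W. f y = h y"
      using f x by (auto simp: induced_def)
    have "restrict h (V \<inter> W) \<in> regular X (V \<inter> W)"
      by (rule function_sheafD(2)[OF X V(1) _ _ V(3)]) (use V W in auto)
    moreover have "restrict h (V \<inter> W) = restrict f (V \<inter> W)"
      using V(4) by (auto simp: restrict_def fun_eq_iff)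
    ultimately show "\<exists>W'. openin (zariski X) W' \<and> x \<in> W' \<and> W' \<subseteq> W \<and> restrict f W' \<in> regular X W'"
      using V W x by (intro exI[of _ "V \<inter> W"]) auto
  qed
next
  fix f assume f: "f \<in> regular X W"
  then show "f \<in> regular (induced X U) W"
    using function_sheafD(1)[OF X W f] W by (auto simp: induced_def)
qed

text \<open>
  The local condition is regularity after restriction to each member of the affine cover. Asking for
  all members, instead of one, makes it hold for constants on every open set.
\<close>

lemma locally_ringed_prevariety:
  assumes "prevariety X"
  shows "locally_ringed X"
proof -
  have X: "function_sheaf X" using assms by (simp add: prevariety_def)
  obtain \<U> where \<U>: "\<Union>\<U> = points X" "\<And>U. U \<in> \<U> \<Longrightarrow> openin (zariski X) U"
    and aff: "\<And>U. U \<in> \<U> \<Longrightarrow> affine_variety (induced X U)"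
    using assms unfolding prevariety_def by auto
  have lr: "locally_ringed (induced X U)" if U: "U \<in> \<U>" for U
  proof -
    obtain Y :: "(nat \<Rightarrow> complex) fun_space" where "locally_ringed Y" "isomorphic (induced X U) Y"
      using aff[OF U] locally_ringed_induced[OF locally_ringed_affine_space] unfolding affine_variety_def by auto
    then show ?thesis using function_sheaf_induced[OF X] locally_ringed_isomorphic by metis
  qed
  have eq: "regular (induced X U) (W \<inter> U) = regular X (W \<inter> U)" and op: "openin (zariski (induced X U)) (W \<inter> U)"
    and op': "openin (zariski X) (W \<inter> U)"
    if "U \<in> \<U>" "openin (zariski X) W" for U W
    using that \<U>(2) regular_induced_open[OF X, of "W \<inter> U" U] by (auto simp: openin_subtopology)
  let ?P = "\<lambda>W f. openin (zariski X) W \<and> (\<forall>U\<in>\<U>. restrict f (W \<inter> U) \<in> regular X (W \<inter> U))"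
  show ?thesis
  proof (rule locally_ringedI_local[where P = ?P])
    fix U assume U: "openin (zariski X) U"
    show "regular X U = {f \<in> extensional U. \<forall>x\<in>U. \<exists>W. openin (zariski X) W \<and> x \<in> W \<and> W \<subseteq> U \<and> ?P W f}"
    proof (intro equalityI subsetI)
      fix f assume f: "f \<in> regular X U"
      have "?P U f"
        by (intro conjI ballI U function_sheafD(2)[OF X U _ _ f]) (use op' U in auto)
      then show "f \<in> {f \<in> extensional U. \<forall>x\<in>U. \<exists>W. openin (zariski X) W \<and> x \<in> W \<and> W \<subseteq> U \<and> ?P W f}"
        using function_sheafD(1)[OF X U f] U by blast
    next
      fix f assume f: "f \<in> {f \<in> extensional U. \<forall>x\<in>U. \<exists>W. openin (zariski X) W \<and> x \<in> W \<and> W \<subseteq> U \<and> ?P W f}"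
      show "f \<in> regular X U"
      proof (rule function_sheafD(3)[OF X U])
        show "f \<in> extensional U" using f by simp
        fix x assume x: "x \<in> U"
        obtain W where W: "openin (zariski X) W" "x \<in> W" "W \<subseteq> U" "?P W f" using f x by blast
        have "x \<in> points X" using openin_subset[OF U] x by auto
        then obtain V where V: "V \<in> \<U>" "x \<in> V" using \<U>(1) by blast
        show "\<exists>W. openin (zariski X) W \<and> x \<in> W \<and> W \<subseteq> U \<and> restrict f W \<in> regular X W"
          using W V op'[OF V(1) W(1)] by (intro exI[of _ "W \<inter> V"]) auto
      qed
    qed
  next
    fix W W' f g assume P: "?P W f" and W': "openin (zariski X) W'" "W' \<subseteq> W" and fg: "\<And>x. x \<in> W' \<Longrightarrow> f x = g x"
    show "?P W' g"
    proof (intro conjI ballI W'(1))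
      fix U assume U: "U \<in> \<U>"
      have W: "openin (zariski X) W" "restrict f (W \<inter> U) \<in> regular X (W \<inter> U)" using P U by auto
      have "restrict (restrict f (W \<inter> U)) (W' \<inter> U) \<in> regular X (W' \<inter> U)"
        by (rule function_sheafD(2)[OF X op'[OF U W(1)] op'[OF U W'(1)] _ W(2)]) (use W' in auto)
      moreover have "restrict g (W' \<inter> U) = restrict (restrict f (W \<inter> U)) (W' \<inter> U)"
        using fg W' by (auto simp: restrict_def fun_eq_iff)
      ultimately show "restrict g (W' \<inter> U) \<in> regular X (W' \<inter> U)" by simp
    qed
  next
    fix W c assume W: "openin (zariski X) W"
    show "?P W (\<lambda>_. c)"
      using locally_ringedD(2)[OF lr op[OF _ W]] eq[OF _ W] W by auto
  next
    fix W f g assume W: "openin (zariski X) W" and P: "?P W f" "?P W g"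
    show "?P W (\<lambda>x. f x + g x)"
    proof (intro conjI ballI W)
      fix U assume U: "U \<in> \<U>"
      have "restrict f (W \<inter> U) \<in> regular (induced X U) (W \<inter> U)" "restrict g (W \<inter> U) \<in> regular (induced X U) (W \<inter> U)"
        using P U eq[OF U W] by auto
      from locally_ringedD(3)[OF lr[OF U] op[OF U W] this]
      show "restrict (\<lambda>x. f x + g x) (W \<inter> U) \<in> regular X (W \<inter> U)"
        using eq[OF U W] by (simp cong: restrict_cong)
    qed
    show "?P W (\<lambda>x. f x * g x)"
    proof (intro conjI ballI W)
      fix U assume U: "U \<in> \<U>"
      have "restrict f (W \<inter> U) \<in> regular (induced X U) (W \<inter> U)" "restrict g (W \<inter> U) \<in> regular (induced X U) (W \<inter> U)"
        using P U eq[OF U W] by auto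
      from locally_ringedD(4)[OF lr[OF U] op[OF U W] this]
      show "restrict (\<lambda>x. f x * g x) (W \<inter> U) \<in> regular X (W \<inter> U)"
        using eq[OF U W] by (simp cong: restrict_cong)
    qed
  next
    fix W f assume W: "openin (zariski X) W" and P: "?P W f"
    let ?D = "{x \<in> W. f x \<noteq> 0}"
    have DU: "openin (zariski (induced X U)) (?D \<inter> U) \<and>
        (\<lambda>x\<in>?D \<inter> U. inverse (f x)) \<in> regular (induced X U) (?D \<inter> U)" if U: "U \<in> \<U>" for U
    proof -
      have r: "restrict f (W \<inter> U) \<in> regular (induced X U) (W \<inter> U)"
        using P U eq[OF U W] by auto
      have e: "{x \<in> W \<inter> U. restrict f (W \<inter> U) x \<noteq> 0} = ?D \<inter> U" by auto
      have e': "(\<lambda>x\<in>?D \<inter> U. inverse (restrict f (W \<inter> U) x)) = (\<lambda>x\<in>?D \<inter> U. inverse (f x))"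
        by (auto simp: restrict_def fun_eq_iff)
      show ?thesis
        using locally_ringedD(5,6)[OF lr[OF U] op[OF U W] r] unfolding e e' by blast
    qed
    have "openin (zariski X) (?D \<inter> U)" if U: "U \<in> \<U>" for U
      using DU[OF U] \<U>(2)[OF U] openin_open_subtopology by auto
    then have "openin (zariski X) (\<Union>U\<in>\<U>. ?D \<inter> U)" by blast
    moreover have "(\<Union>U\<in>\<U>. ?D \<inter> U) = ?D" using openin_subset[OF W] \<U>(1) by blast
    ultimately have D: "openin (zariski X) ?D" by simp
    then show "openin (zariski X) ?D \<and> ?P ?D (\<lambda>x. inverse (f x))"
      using DU eq[OF _ D] by simp
  qed
qed

lemma locally_ringed_restrict:
  assumes X: "locally_ringed X" and "openin (zariski X) U" "openin (zariski X) W" "W \<subseteq> U" "f \<in> regular X U"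
  shows "restrict f W \<in> regular X W"
  using function_sheafD(2)[OF locally_ringedD(1)[OF X]] assms by blast

lemma regular_poly_compose:
  assumes T: "locally_ringed T" and p: "p \<in> poly_funs I"
    and reg: "\<And>i. i \<in> I \<Longrightarrow> (\<lambda>t\<in>points T. \<phi> t i) \<in> regular T (points T)"
  shows "(\<lambda>t\<in>points T. p (\<phi> t)) \<in> regular T (points T)"
  using p
proof induction
  case (const c)
  show ?case by (rule locally_ringedD(2)[OF T openin_topspace])
next
  case (coord i)
  then show ?case by (rule reg)
next
  case (add p p')
  from locally_ringedD(3)[OF T openin_topspace add.IH] show ?case by (simp add: restrict_def cong: if_cong)
next
  case (mult p p')
  from locally_ringedD(4)[OF T openin_topspace mult.IH] show ?case by (simp add: restrict_def cong: if_cong)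
qed

text \<open>
  Polynomials in regular functions are regular, their nonvanishing sets are open, and quotients of
  them are regular; this gives continuity and the pullback of regular functions.
\<close>

lemma morphism_into_affine:
  assumes T: "locally_ringed T" and Y: "Y \<subseteq> I \<rightarrow>\<^sub>E UNIV"
    and into: "\<And>t. t \<in> points T \<Longrightarrow> \<phi> t \<in> Y"
    and reg: "\<And>i. i \<in> I \<Longrightarrow> (\<lambda>t\<in>points T. \<phi> t i) \<in> regular T (points T)"
  shows "morphism T (induced (affine_space I) Y) \<phi>"
proof -
  have poly: "(\<lambda>t\<in>points T. p (\<phi> t)) \<in> regular T (points T)" if "p \<in> poly_funs I" for p
    by (rule regular_poly_compose[OF T that reg])
  have ne: "openin (zariski T) {t \<in> points T. p (\<phi> t) \<noteq> 0}" if "p \<in> poly_funs I" for p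
  proof -
    have "{t \<in> points T. (\<lambda>t\<in>points T. p (\<phi> t)) t \<noteq> 0} = {t \<in> points T. p (\<phi> t) \<noteq> 0}" by auto
    then show ?thesis using locally_ringedD(5)[OF T openin_topspace poly[OF that]] by simp
  qed
  have pre: "openin (zariski T) {t \<in> points T. \<phi> t \<in> U}" if U: "openin (zariski (affine_space I)) U" for U
  proof (subst openin_subopen, intro ballI)
    fix t assume t: "t \<in> {t \<in> points T. \<phi> t \<in> U}"
    then obtain p where p: "p \<in> poly_funs I" "p (\<phi> t) \<noteq> 0" "{y \<in> I \<rightarrow>\<^sub>E UNIV. p y \<noteq> 0} \<subseteq> U"
      using openin_affine_space_basis[OF U, of "\<phi> t"] by blast
    show "\<exists>V. openin (zariski T) V \<and> t \<in> V \<and> V \<subseteq> {t \<in> points T. \<phi> t \<in> U}"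
      using ne[OF p(1)] p t into Y by (intro exI[of _ "{t \<in> points T. p (\<phi> t) \<noteq> 0}"]) blast
  qed
  have into': "\<phi> ` points T \<subseteq> Y" using into by auto
  have "continuous_map (zariski T) (zariski (affine_space I)) \<phi>"
    unfolding continuous_map_def using into Y pre by auto
  then have cont: "continuous_map (zariski T) (zariski (induced (affine_space I) Y)) \<phi>"
    using into by (simp add: continuous_map_in_subtopology image_subset_iff)
  show ?thesis unfolding morphism_def
  proof (intro conjI allI impI cont)
    fix V h assume V: "openin (zariski (induced (affine_space I) Y)) V \<and> h \<in> regular (induced (affine_space I) Y) V"
    let ?V = "{t \<in> points T. \<phi> t \<in> V}"
    have opV: "openin (zariski T) ?V" using cont V by (simp add: continuous_map_def)
    show "restrict (h \<circ> \<phi>) ?V \<in> regular T ?V"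
    proof (rule function_sheafD(3)[OF locally_ringedD(1)[OF T] opV])
      fix t assume t: "t \<in> ?V"
      obtain W h' where W: "openin (zariski (affine_space I)) W" "\<phi> t \<in> W"
          "h' \<in> regular (affine_space I) W" "\<forall>y\<in>W \<inter> V. h y = h' y"
        using V t by (auto simp: induced_def)
      obtain W' p p' where W': "openin (zariski (affine_space I)) W'" "\<phi> t \<in> W'" "W' \<subseteq> W"
        "p \<in> poly_funs I" "p' \<in> poly_funs I" "\<forall>y\<in>W'. p' y \<noteq> 0 \<and> h' y = p y / p' y"
        using W(2,3) unfolding regular_affine_space by blast
      let ?W = "?V \<inter> {t \<in> points T. \<phi> t \<in> W'}"
      have opW: "openin (zariski T) ?W" by (intro openin_Int opV pre W')
      have 1: "(\<lambda>s\<in>?W. p (\<phi> s)) \<in> regular T ?W"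
      proof -
        have "restrict (\<lambda>t\<in>points T. p (\<phi> t)) ?W = (\<lambda>s\<in>?W. p (\<phi> s))"
          by (auto simp: restrict_def fun_eq_iff)
        moreover have "?W \<subseteq> points T" by auto
        ultimately show ?thesis
          using locally_ringed_restrict[OF T openin_topspace opW _ poly[OF W'(4)]] by metis
      qed
      have D: "{s \<in> points T. (\<lambda>t\<in>points T. p' (\<phi> t)) s \<noteq> 0} = {t \<in> points T. p' (\<phi> t) \<noteq> 0}" by auto
      have sub: "?W \<subseteq> {t \<in> points T. p' (\<phi> t) \<noteq> 0}" using W' by auto
      have "(\<lambda>s\<in>{t \<in> points T. p' (\<phi> t) \<noteq> 0}. inverse (p' (\<phi> s))) \<in> regular T {t \<in> points T. p' (\<phi> t) \<noteq> 0}"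
        using locally_ringedD(6)[OF T openin_topspace poly[OF W'(5)]] unfolding D by (simp cong: restrict_cong)
      from locally_ringed_restrict[OF T ne[OF W'(5)] opW sub this]
      have "restrict (\<lambda>s\<in>{t \<in> points T. p' (\<phi> t) \<noteq> 0}. inverse (p' (\<phi> s))) ?W \<in> regular T ?W" .
      moreover have "restrict (\<lambda>s\<in>{t \<in> points T. p' (\<phi> t) \<noteq> 0}. inverse (p' (\<phi> s))) ?W =
          (\<lambda>s\<in>?W. inverse (p' (\<phi> s)))"
        using sub by (auto simp: restrict_def fun_eq_iff)
      ultimately have 2: "(\<lambda>s\<in>?W. inverse (p' (\<phi> s))) \<in> regular T ?W" by simp
      have "(\<lambda>s\<in>?W. p (\<phi> s) * inverse (p' (\<phi> s))) \<in> regular T ?W"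
        using locally_ringedD(4)[OF T opW 1 2] by (simp cong: restrict_cong)
      also have "(\<lambda>s\<in>?W. p (\<phi> s) * inverse (p' (\<phi> s))) = restrict (restrict (h \<circ> \<phi>) ?V) ?W"
        using W(4) W'(3,6) by (auto simp: restrict_def fun_eq_iff field_simps)
      finally have R: "restrict (restrict (h \<circ> \<phi>) ?V) ?W \<in> regular T ?W" .
      show "\<exists>W. openin (zariski T) W \<and> t \<in> W \<and> W \<subseteq> ?V \<and> restrict (restrict (h \<circ> \<phi>) ?V) W \<in> regular T W"
      proof (intro exI[of _ ?W] conjI R opW)
        show "t \<in> ?W" using t W'(2) by simp
      qed simp
    qed simp
  qed
qed

lemma regular_poly:
  assumes "Y \<subseteq> I \<rightarrow>\<^sub>E UNIV" "p \<in> poly_funs I"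
  shows "(\<lambda>x\<in>Y. p x) \<in> regular (induced (affine_space I) Y) Y"
proof -
  let ?A = "I \<rightarrow>\<^sub>E UNIV :: ('a \<Rightarrow> complex) set"
  have one: "(\<lambda>_. 1) \<in> poly_funs I" by (rule poly_funs.const)
  have op: "openin (zariski (affine_space I)) ?A"
    using openin_topspace[of "zariski (affine_space I)"] by simp
  have "\<exists>p'\<in>poly_funs I. \<exists>p''\<in>poly_funs I. \<forall>y\<in>?A. p'' y \<noteq> 0 \<and> restrict p ?A y = p' y / p'' y"
    by (intro bexI[OF _ assms(2)] bexI[OF _ one]) auto
  then have R: "restrict p ?A \<in> regular (affine_space I) ?A"
    unfolding regular_affine_space using op by blast
  have "\<exists>W h. openin (zariski (affine_space I)) W \<and> x \<in> W \<and> h \<in> regular (affine_space I) W \<and>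
      (\<forall>y\<in>W \<inter> Y. restrict p Y y = h y)" if "x \<in> Y" for x
    by (intro exI[of _ ?A] exI[of _ "restrict p ?A"] conjI R op) (use that assms(1) in auto)
  then show ?thesis by (simp add: induced_def)
qed

lemma morphism_into_affineD:
  assumes "morphism T (induced (affine_space I) Y) \<phi>" "Y \<subseteq> I \<rightarrow>\<^sub>E UNIV"
  shows "t \<in> points T \<Longrightarrow> \<phi> t \<in> Y"
    and "i \<in> I \<Longrightarrow> (\<lambda>t\<in>points T. \<phi> t i) \<in> regular T (points T)"
proof -
  have pts: "points (induced (affine_space I) Y) = Y" using assms(2) by (auto simp: Int_absorb1)
  show 1: "\<phi> t \<in> Y" if "t \<in> points T" for t using morphismD(2)[OF assms(1) that] pts by simp
  assume i: "i \<in> I"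
  have op: "openin (zariski (induced (affine_space I) Y)) Y" using openin_topspace[of "zariski (induced (affine_space I) Y)"] unfolding pts .
  have "{t \<in> points T. \<phi> t \<in> Y} = points T" using 1 by auto
  with morphismD(4)[OF assms(1) op regular_poly[OF assms(2) poly_funs.coord[OF i]]]
  show "(\<lambda>t\<in>points T. \<phi> t i) \<in> regular T (points T)" using 1 by (simp cong: restrict_cong)
qed

section \<open>Quasi-affine varieties\<close>

lemma isomorphic_identity:
  assumes "zariski X = zariski X'" "\<And>V. openin (zariski X) V \<Longrightarrow> regular X V = regular X' V"
    and X: "function_sheaf X"
  shows "isomorphic X X'"
proof -
  have r: "restrict (h \<circ> id) {x \<in> points X. id x \<in> V} = h" "{x \<in> points X. id x \<in> V} = V"
    if V: "openin (zariski X) V" "h \<in> regular X V" for V h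
    using openin_subset[OF V(1)] function_sheafD(1)[OF X V]
    by (auto simp: restrict_def fun_eq_iff extensional_def)
  have "morphism X X' id" "morphism X' X id"
    unfolding morphism_def using assms(1,2) r by (auto simp: assms(1)[symmetric])
  then show ?thesis unfolding isomorphic_def by (intro exI[of _ id]) auto
qed

text \<open>
  An isomorphism and not an equality, since the values of \<^const>\<open>regular\<close> on subsets that are not
  open can differ.
\<close>

lemma isomorphic_induced_induced:
  assumes X: "function_sheaf X" and U: "U \<subseteq> Y"
  shows "isomorphic (induced (induced X Y) U) (induced X U)"
proof (rule isomorphic_identity)
  show "zariski (induced (induced X Y) U) = zariski (induced X U)"
    using U by (simp add: subtopology_subtopology Int_absorb1 Int_absorb2)
  show "function_sheaf (induced (induced X Y) U)"
    by (intro function_sheaf_induced X)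
  fix V assume "openin (zariski (induced (induced X Y) U)) V"
  then have V: "V \<subseteq> Y" using U by (auto simp: openin_subtopology)
  show "regular (induced (induced X Y) U) V = regular (induced X U) V"
  proof (intro equalityI subsetI)
    fix f assume f: "f \<in> regular (induced (induced X Y) U) V"
    have "\<exists>W h. openin (zariski X) W \<and> x \<in> W \<and> h \<in> regular X W \<and> (\<forall>y\<in>W \<inter> V. f y = h y)" if x: "x \<in> V" for x
    proof -
      obtain W h where W: "openin (zariski (induced X Y)) W" "x \<in> W" "h \<in> regular (induced X Y) W" "\<forall>y\<in>W \<inter> V. f y = h y"
        using f x unfolding induced_def[of "induced X Y"] by auto
      obtain W1 where W1: "openin (zariski X) W1" "W = W1 \<inter> Y"
        using W(1) by (auto simp: openin_subtopology)
      obtain W2 h' where W2: "openin (zariski X) W2" "x \<in> W2" "h' \<in> regular X W2" "\<forall>y\<in>W2 \<inter> W. h y = h' y"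
        using W(2,3) unfolding induced_def by auto
      have "restrict h' (W1 \<inter> W2) \<in> regular X (W1 \<inter> W2)"
        by (rule function_sheafD(2)[OF X W2(1) _ _ W2(3)]) (use W1 W2 in auto)
      moreover have "\<forall>y\<in>W1 \<inter> W2 \<inter> V. f y = restrict h' (W1 \<inter> W2) y"
        using W(4) W2(4) W1(2) V by auto
      ultimately show ?thesis using W(2) W1 W2(1,2)
        by (intro exI[of _ "W1 \<inter> W2"] exI[of _ "restrict h' (W1 \<inter> W2)"]) auto
    qed
    then show "f \<in> regular (induced X U) V" using f by (simp add: induced_def)
  next
    fix f assume f: "f \<in> regular (induced X U) V"
    have "\<exists>W h. openin (zariski (induced X Y)) W \<and> x \<in> W \<and> h \<in> regular (induced X Y) W \<and> (\<forall>y\<in>W \<inter> V. f y = h y)" if x: "x \<in> V" for x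
    proof -
      obtain W h where W: "openin (zariski X) W" "x \<in> W" "h \<in> regular X W" "\<forall>y\<in>W \<inter> V. f y = h y"
        using f x unfolding induced_def by auto
      have "restrict h (W \<inter> Y) \<in> regular (induced X Y) (W \<inter> Y)"
        unfolding induced_def using W by auto
      moreover have "openin (zariski (induced X Y)) (W \<inter> Y)" using W(1) by (auto simp: openin_subtopology)
      ultimately show ?thesis using W x V
        by (intro exI[of _ "W \<inter> Y"] exI[of _ "restrict h (W \<inter> Y)"]) auto
    qed
    then show "f \<in> regular (induced (induced X Y) U) V" using f unfolding induced_def[of "induced X Y"]
      by (simp add: induced_def[of X U])
  qed
qed

lemma isomorphic_affine_space_induced:
  "isomorphic (affine_space I) (induced (affine_space I) (I \<rightarrow>\<^sub>E UNIV))"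
proof (rule isomorphic_identity)
  show "function_sheaf (affine_space I)" by (rule locally_ringedD(1)[OF locally_ringed_affine_space])
  then show "regular (affine_space I) V = regular (induced (affine_space I) (I \<rightarrow>\<^sub>E UNIV)) V"
    if "openin (zariski (affine_space I)) V" for V
    using regular_induced_open that by metis
  show "zariski (affine_space I) = zariski (induced (affine_space I) (I \<rightarrow>\<^sub>E UNIV))"
    by (metis zariski_induced subtopology_topspace topspace_affine_space)
qed

lemma points_induced_affine [simp]:
  "Y \<subseteq> I \<rightarrow>\<^sub>E UNIV \<Longrightarrow> points (induced (affine_space I) Y) = Y"
  by (auto simp: Int_absorb1)

lemma locally_ringed_induced_affine: "locally_ringed (induced (affine_space I) Y)"
  by (rule locally_ringed_induced[OF locally_ringed_affine_space])

lemma poly_funs_cong: "p \<in> poly_funs I \<Longrightarrow> (\<And>i. i \<in> I \<Longrightarrow> x i = y i) \<Longrightarrow> p x = p y"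
  by (induction rule: poly_funs.induct) auto

lemma poly_funs_mono: "p \<in> poly_funs I \<Longrightarrow> I \<subseteq> J \<Longrightarrow> p \<in> poly_funs J"
  by (induction rule: poly_funs.induct) (auto intro: poly_funs.intros)

text \<open>
  A finite number of inequations, so that the set is a finite union of affine varieties.
\<close>

definition quasi_affine :: "'i set \<Rightarrow> ('i \<Rightarrow> complex) set \<Rightarrow> bool" where
  "quasi_affine I Y \<longleftrightarrow> (\<exists>P F. finite P \<and> P \<subseteq> poly_funs I \<and> F \<subseteq> poly_funs I \<and>
     Y = {x \<in> I \<rightarrow>\<^sub>E UNIV. (\<exists>p\<in>P. p x \<noteq> 0) \<and> (\<forall>f\<in>F. f x = 0)})"

text \<open>
  The Rabinowitsch trick: \<open>p x \<noteq> 0\<close> becomes the equation \<open>x\<^sub>k p(x) - 1 = 0\<close> in one more variable.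
\<close>

lemma affine_variety_basic:
  assumes p: "p \<in> poly_funs {..<k}" and F: "F \<subseteq> poly_funs {..<k::nat}"
  shows "affine_variety (induced (affine_space {..<k}) {x \<in> {..<k} \<rightarrow>\<^sub>E UNIV. p x \<noteq> 0 \<and> (\<forall>f\<in>F. f x = 0)})"
proof -
  let ?Y = "{x \<in> {..<k} \<rightarrow>\<^sub>E UNIV. p x \<noteq> 0 \<and> (\<forall>f\<in>F. f x = 0)}"
  let ?X = "induced (affine_space {..<k}) ?Y"
  define u where "u = (\<lambda>x :: nat \<Rightarrow> complex. x k * p x + (- 1))"
  let ?F = "insert u F"
  let ?Y' = "{x \<in> {..<Suc k} \<rightarrow>\<^sub>E UNIV. \<forall>f\<in>?F. f x = 0}"
  let ?X' = "induced (affine_space {..<Suc k}) ?Y'"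
  have le: "{..<k} \<subseteq> {..<Suc k}" by auto
  have u: "u \<in> poly_funs {..<Suc k}"
    unfolding u_def by (intro poly_funs.intros poly_funs_mono[OF p le]) auto
  then have F': "?F \<subseteq> poly_funs {..<Suc k}" using F poly_funs_mono[OF _ le] by auto
  define \<phi> where "\<phi> = (\<lambda>x :: nat \<Rightarrow> complex. x(k := inverse (p x)))"
  define \<psi> where "\<psi> = (\<lambda>z :: nat \<Rightarrow> complex. restrict z {..<k})"
  have same: "f (\<phi> x) = f x" "f (\<psi> x) = f x" if "f \<in> poly_funs {..<k}" for f x
    by (rule poly_funs_cong[OF that], simp add: \<phi>_def, rule poly_funs_cong[OF that], simp add: \<psi>_def)
  have Y: "?Y \<subseteq> {..<k} \<rightarrow>\<^sub>E UNIV" and Y': "?Y' \<subseteq> {..<Suc k} \<rightarrow>\<^sub>E UNIV" by auto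
  have \<phi>Y: "\<phi> x \<in> ?Y'" if x: "x \<in> ?Y" for x
  proof -
    have "\<phi> x \<in> {..<Suc k} \<rightarrow>\<^sub>E UNIV" using x by (auto simp: \<phi>_def PiE_def extensional_def)
    moreover have "u (\<phi> x) = 0" using x same(1)[OF p] by (simp add: u_def) (simp add: \<phi>_def)
    moreover have "f (\<phi> x) = 0" if "f \<in> F" for f using x F that same(1)[of f] by auto
    ultimately show ?thesis by auto
  qed
  have \<psi>Y: "\<psi> z \<in> ?Y" if z: "z \<in> ?Y'" for z
  proof -
    have "p (\<psi> z) \<noteq> 0" using z same(2)[OF p] by (auto simp: u_def)
    moreover have "f (\<psi> z) = 0" if "f \<in> F" for f using z F that same(2)[of f] by auto
    ultimately show ?thesis by (auto simp: \<psi>_def)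
  qed
  have inv1: "\<psi> (\<phi> x) = x" if "x \<in> ?Y" for x
    using that by (auto simp: \<psi>_def \<phi>_def fun_eq_iff PiE_def extensional_def)
  have inv2: "\<phi> (\<psi> z) = z" if z: "z \<in> ?Y'" for z
  proof -
    have "inverse (p (\<psi> z)) = z k"
      using z unfolding same(2)[OF p] by (auto simp: u_def intro: inverse_unique simp: mult.commute)
    then show ?thesis using z
      by (auto simp: \<psi>_def \<phi>_def fun_eq_iff PiE_def extensional_def)
  qed
  have "morphism ?X ?X' \<phi>"
  proof (rule morphism_into_affine[OF locally_ringed_induced_affine Y'])
    fix i assume "i \<in> {..<Suc k}"
    have reg: "(\<lambda>x\<in>?Y. p x) \<in> regular ?X ?Y" by (rule regular_poly[OF Y p])
    have op: "openin (zariski ?X) ?Y"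
      using openin_topspace[of "zariski ?X"] unfolding points_induced_affine[OF Y] .
    have e: "{x \<in> ?Y. restrict p ?Y x \<noteq> 0} = ?Y" by auto
    have e': "(\<lambda>x\<in>?Y. inverse (restrict p ?Y x)) = (\<lambda>x\<in>?Y. inverse (p x))"
      by (auto simp: restrict_def fun_eq_iff)
    show "(\<lambda>x\<in>points ?X. \<phi> x i) \<in> regular ?X (points ?X)"
    proof (cases "i = k")
      case True
      then show ?thesis
        using locally_ringedD(6)[OF locally_ringed_induced_affine op reg]
        unfolding e e' points_induced_affine[OF Y] by (simp add: \<phi>_def)
    next
      case False
      then have i: "(\<lambda>x. x i) \<in> poly_funs {..<k}" using \<open>i \<in> {..<Suc k}\<close> by (intro poly_funs.coord) auto
      show ?thesis
        using regular_poly[OF Y i] False unfolding points_induced_affine[OF Y] by (simp add: \<phi>_def)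
    qed
  qed (use \<phi>Y in \<open>simp only: points_induced_affine[OF Y]\<close>)
  moreover have "morphism ?X' ?X \<psi>"
  proof (rule morphism_into_affine[OF locally_ringed_induced_affine Y])
    fix i assume i: "i \<in> {..<k}"
    then have "(\<lambda>x. x i) \<in> poly_funs {..<Suc k}" by (intro poly_funs.coord) auto
    from regular_poly[OF Y' this]
    show "(\<lambda>x\<in>points ?X'. \<psi> x i) \<in> regular ?X' (points ?X')"
      using i unfolding points_induced_affine[OF Y'] by (simp add: \<psi>_def)
  qed (use \<psi>Y in \<open>simp only: points_induced_affine[OF Y']\<close>)
  ultimately have "isomorphic ?X ?X'"
    unfolding isomorphic_def points_induced_affine[OF Y] points_induced_affine[OF Y']
    using inv1 inv2 by blast
  then show ?thesis unfolding affine_variety_def using F' by blast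
qed

text \<open>
  Separatedness holds because the points where two morphisms differ are those where the difference
  of some coordinate is nonzero.
\<close>

lemma is_variety_quasi_affine:
  assumes "quasi_affine {..<k::nat} Y"
  shows "is_variety (induced (affine_space {..<k}) Y)"
proof -
  obtain P F where PF: "finite P" "P \<subseteq> poly_funs {..<k}" "F \<subseteq> poly_funs {..<k}"
    and Y: "Y = {x \<in> {..<k} \<rightarrow>\<^sub>E UNIV. (\<exists>p\<in>P. p x \<noteq> 0) \<and> (\<forall>f\<in>F. f x = 0)}"
    using assms unfolding quasi_affine_def by blast
  let ?X = "induced (affine_space {..<k}) Y"
  have sub: "Y \<subseteq> {..<k} \<rightarrow>\<^sub>E UNIV" using Y by auto
  have A: "function_sheaf (affine_space {..<k})" by (rule locally_ringedD(1)[OF locally_ringed_affine_space])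
  define D where "D = (\<lambda>p :: (nat \<Rightarrow> complex) \<Rightarrow> complex. {x \<in> {..<k} \<rightarrow>\<^sub>E UNIV. p x \<noteq> 0 \<and> (\<forall>f\<in>F. f x = 0)})"
  have D: "D p \<subseteq> Y" "openin (zariski ?X) (D p)" "affine_variety (induced ?X (D p))" if p: "p \<in> P" for p
  proof -
    show sub: "D p \<subseteq> Y" using p Y by (auto simp: D_def)
    have "D p = {x \<in> {..<k} \<rightarrow>\<^sub>E UNIV. p x \<noteq> 0} \<inter> Y" using p Y by (auto simp: D_def)
    then show "openin (zariski ?X) (D p)"
      using openin_basic[of p "{..<k}"] p PF by (auto simp: openin_subtopology)
    have "affine_variety (induced (affine_space {..<k}) (D p))"
      unfolding D_def by (rule affine_variety_basic) (use p PF in auto)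
    then show "affine_variety (induced ?X (D p))"
      using isomorphic_trans[OF isomorphic_induced_induced[OF A sub]] unfolding affine_variety_def by blast
  qed
  have "prevariety ?X" unfolding prevariety_def
  proof (intro conjI exI[of _ "D ` P"])
    show "function_sheaf ?X" by (rule function_sheaf_induced[OF A])
    show "\<Union> (D ` P) = points ?X" unfolding points_induced_affine[OF sub] using Y by (auto simp: D_def)
  qed (use D PF in auto)
  moreover have "closedin (zariski T) {t \<in> points T. f t = g t}"
    if T: "prevariety T" "morphism T ?X f" "morphism T ?X g" for T :: "(nat \<Rightarrow> complex) fun_space" and f g
  proof -
    have lr: "locally_ringed T" by (rule locally_ringed_prevariety[OF T(1)])
    note f = morphism_into_affineD[OF T(2) sub] and g = morphism_into_affineD[OF T(3) sub]
    have "openin (zariski T) {t \<in> points T. f t i \<noteq> g t i}" if i: "i \<in> {..<k}" for i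
    proof -
      \<comment> \<open>The difference of the coordinates, written as \<open>f\<^sub>i + (-1) g\<^sub>i\<close>.\<close>
      note c = locally_ringedD(2)[OF lr openin_topspace, of "-1"]
      note m = locally_ringedD(4)[OF lr openin_topspace c g(2)[OF i]]
      note d = locally_ringedD(5)[OF lr openin_topspace locally_ringedD(3)[OF lr openin_topspace f(2)[OF i] m]]
      have "{t \<in> points T. f t i \<noteq> g t i} = {t \<in> points T. (\<lambda>x\<in>points T. (\<lambda>t\<in>points T. f t i) x + (\<lambda>x\<in>points T. (\<lambda>x\<in>points T. - 1) x * (\<lambda>t\<in>points T. g t i) x) x) t \<noteq> 0}"
        by auto
      then show ?thesis using d by simp
    qed
    then have "openin (zariski T) (\<Union>i\<in>{..<k}. {t \<in> points T. f t i \<noteq> g t i})" by blast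
    moreover have "(\<Union>i\<in>{..<k}. {t \<in> points T. f t i \<noteq> g t i}) = points T - {t \<in> points T. f t = g t}"
    proof -
      have "f t = g t \<longleftrightarrow> (\<forall>i\<in>{..<k}. f t i = g t i)" if t: "t \<in> points T" for t
      proof -
        have "f t \<in> {..<k} \<rightarrow>\<^sub>E UNIV" "g t \<in> {..<k} \<rightarrow>\<^sub>E UNIV" using f(1)[OF t] g(1)[OF t] sub by auto
        from PiE_ext[OF this] show ?thesis by (intro iffI) simp_all
      qed
      then show ?thesis by auto
    qed
    ultimately show ?thesis by (simp add: closedin_def)
  qed
  ultimately show ?thesis by (simp add: is_variety_def)
qed

text \<open>
  For \<open>I' = I\<close> this renames the coordinates; a smaller \<open>I'\<close> drops coordinates that vanish identically.
\<close>

lemma isomorphic_reindex: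
  fixes b :: "'j \<Rightarrow> 'i"
  assumes b: "bij_betw b J I'" and I': "I' \<subseteq> I" and Y: "Y \<subseteq> I \<rightarrow>\<^sub>E UNIV"
    and zero: "\<And>x i. x \<in> Y \<Longrightarrow> i \<in> I - I' \<Longrightarrow> x i = 0"
  shows "isomorphic (induced (affine_space I) Y) (induced (affine_space J) ((\<lambda>x. \<lambda>j\<in>J. x (b j)) ` Y))"
proof -
  define \<phi> where "\<phi> = (\<lambda>x :: 'i \<Rightarrow> complex. \<lambda>j\<in>J. x (b j))"
  define \<psi> where "\<psi> = (\<lambda>z :: 'j \<Rightarrow> complex. \<lambda>i\<in>I. if i \<in> I' then z (inv_into J b i) else 0)"
  let ?Y' = "\<phi> ` Y"
  have Y': "?Y' \<subseteq> J \<rightarrow>\<^sub>E UNIV" by (auto simp: \<phi>_def)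
  have inv1: "\<psi> (\<phi> x) = x" if "x \<in> Y" for x
  proof
    fix i
    have x: "x \<in> I \<rightarrow>\<^sub>E UNIV" using that Y by auto
    have "inv_into J b i \<in> J \<and> b (inv_into J b i) = i" if "i \<in> I'"
      using b that by (metis bij_betw_def f_inv_into_f inv_into_into)
    then show "\<psi> (\<phi> x) i = x i"
      using x zero[OF that, of i] I' by (auto simp: \<psi>_def \<phi>_def PiE_def extensional_def)
  qed
  have inv2: "\<phi> (\<psi> z) = z" if "z \<in> ?Y'" for z using that inv1 by auto
  let ?X = "induced (affine_space I) Y" and ?X' = "induced (affine_space J) ?Y'"
  have bJ: "b j \<in> I" if "j \<in> J" for j using b that I' by (auto simp: bij_betw_def)
  have "morphism ?X ?X' \<phi>"
  proof (rule morphism_into_affine[OF locally_ringed_induced_affine Y'])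
    fix j assume j: "j \<in> J"
    show "(\<lambda>x\<in>points ?X. \<phi> x j) \<in> regular ?X (points ?X)"
      using regular_poly[OF Y poly_funs.coord[OF bJ[OF j]]] j
      unfolding points_induced_affine[OF Y] by (simp add: \<phi>_def)
  qed (simp only: points_induced_affine[OF Y] imageI)
  moreover have "morphism ?X' ?X \<psi>"
  proof (rule morphism_into_affine[OF locally_ringed_induced_affine Y])
    fix i assume i: "i \<in> I"
    show "(\<lambda>x\<in>points ?X'. \<psi> x i) \<in> regular ?X' (points ?X')"
    proof (cases "i \<in> I'")
      case True
      then have "inv_into J b i \<in> J" using b by (metis bij_betw_def inv_into_into)
      then show ?thesis
        using regular_poly[OF Y' poly_funs.coord] i True
        unfolding points_induced_affine[OF Y'] by (simp add: \<psi>_def)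
    next
      case False
      then show ?thesis
        using regular_poly[OF Y' poly_funs.const, of 0] i
        unfolding points_induced_affine[OF Y'] by (simp add: \<psi>_def)
    qed
  qed (use inv1 in \<open>auto simp only: points_induced_affine[OF Y']\<close>)
  ultimately have "isomorphic ?X ?X'"
    unfolding isomorphic_def points_induced_affine[OF Y] points_induced_affine[OF Y']
    using inv1 inv2 by blast
  then show ?thesis by (simp add: \<phi>_def)
qed

section \<open>Classes of loci cut out by supports\<close>

lemma k0_of_variety_add:
  "k0_of_variety X = k0_of_variety Y + k0_of_variety U"
  if "k0_gen X - k0_gen Y - k0_gen U \<in> k0_relations"
  using ideal_generated_base[OF that]
  by transfer (simp add: cong_ideal_def algebra_simps)

lemma k0_of_variety_isomorphic:
  assumes "isomorphic (of_variety X) (of_variety Y)"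
  shows "k0_of_variety X = k0_of_variety Y"
proof -
  have "k0_gen X - k0_gen Y \<in> k0_relations" using assms by (auto simp: k0_relations_def)
  from ideal_generated_base[OF this] show ?thesis by transfer (simp add: cong_ideal_def)
qed

lemma k0_of_variety_product:
  assumes "is_product P p p' X Y"
  shows "k0_of_variety P = k0_of_variety X * k0_of_variety Y"
proof -
  have "k0_gen P - k0_gen X * k0_gen Y \<in> k0_relations" using assms unfolding k0_relations_def by blast
  from ideal_generated_base[OF this] show ?thesis by transfer (simp add: cong_ideal_def)
qed

lemma k0_of_variety_point:
  assumes "isomorphic (of_variety P) (affine_space ({} :: nat set))"
  shows "k0_of_variety P = 1"
proof -
  have "k0_gen P - 1 \<in> k0_relations" using assms unfolding k0_relations_def by blast
  from ideal_generated_base[OF this] show ?thesis by transfer (simp add: cong_ideal_def)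
qed

lemma k0_class_isomorphic:
  assumes "isomorphic X X'"
  shows "k0_class X = k0_class X'"
proof -
  have "(\<lambda>V. isomorphic (of_variety V) X) = (\<lambda>V. isomorphic (of_variety V) X')"
    by (intro ext iffI) (erule isomorphic_trans[OF _ assms], erule isomorphic_trans[OF _ isomorphic_sym[OF assms]])
  then show ?thesis by (simp add: k0_class_def)
qed

lemma k0_class_eqI:
  assumes "isomorphic (of_variety V) X"
  shows "k0_class X = k0_of_variety V"
proof -
  have "isomorphic (of_variety (SOME V. isomorphic (of_variety V) X)) X" using assms by (rule someI)
  then have "isomorphic (of_variety (SOME V. isomorphic (of_variety V) X)) (of_variety V)"
    by (rule isomorphic_trans[OF _ isomorphic_sym[OF assms]])
  then show ?thesis unfolding k0_class_def by (rule k0_of_variety_isomorphic)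
qed

lemma isomorphic_refl: "function_sheaf X \<Longrightarrow> isomorphic X X"
  by (rule isomorphic_identity) auto

lemma function_sheaf_induced_affine: "function_sheaf (induced (affine_space I) Y)"
  by (rule locally_ringedD(1)[OF locally_ringed_induced_affine])

lemma quasi_affine_subset: "quasi_affine I Y \<Longrightarrow> Y \<subseteq> I \<rightarrow>\<^sub>E UNIV"
  by (auto simp: quasi_affine_def)

lemma of_variety_quasi_affine:
  "quasi_affine {..<k} Y \<Longrightarrow> of_variety (Variety (induced (affine_space {..<k}) Y)) = induced (affine_space {..<k}) Y"
  by (rule Variety_inverse) (simp add: is_variety_quasi_affine)

lemma k0_class_quasi_affine:
  assumes "quasi_affine {..<k} Y"
  shows "k0_class (induced (affine_space {..<k}) Y) = k0_of_variety (Variety (induced (affine_space {..<k}) Y))"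
  by (rule k0_class_eqI) (simp add: of_variety_quasi_affine[OF assms] isomorphic_refl function_sheaf_induced_affine)

lemma quasi_affine_Int_zero:
  assumes "quasi_affine I Y" "p \<in> poly_funs I"
  shows "quasi_affine I {x \<in> Y. p x = 0}"
proof -
  obtain P F where "finite P" "P \<subseteq> poly_funs I" "F \<subseteq> poly_funs I"
    "Y = {x \<in> I \<rightarrow>\<^sub>E UNIV. (\<exists>p\<in>P. p x \<noteq> 0) \<and> (\<forall>f\<in>F. f x = 0)}"
    using assms(1) unfolding quasi_affine_def by blast
  then show ?thesis unfolding quasi_affine_def using assms(2)
    by (intro exI[of _ P] exI[of _ "insert p F"]) auto
qed

lemma quasi_affine_Int_nonzero:
  assumes "quasi_affine I Y" "p \<in> poly_funs I"
  shows "quasi_affine I {x \<in> Y. p x \<noteq> 0}"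
proof -
  obtain P F where "finite P" "P \<subseteq> poly_funs I" "F \<subseteq> poly_funs I"
    "Y = {x \<in> I \<rightarrow>\<^sub>E UNIV. (\<exists>p\<in>P. p x \<noteq> 0) \<and> (\<forall>f\<in>F. f x = 0)}"
    using assms(1) unfolding quasi_affine_def by blast
  then show ?thesis unfolding quasi_affine_def using assms(2)
    by (intro exI[of _ "(\<lambda>p' x. p x * p' x) ` P"] exI[of _ F]) (auto intro: poly_funs.mult)
qed

text \<open>
  The scissor relation for the hypersurface defined by \<open>p\<close>.
\<close>

lemma k0_class_cut:
  assumes Y: "quasi_affine {..<k::nat} Y" and p: "p \<in> poly_funs {..<k}"
  shows "k0_class (induced (affine_space {..<k}) Y) =
    k0_class (induced (affine_space {..<k}) {x \<in> Y. p x = 0}) +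
    k0_class (induced (affine_space {..<k}) {x \<in> Y. p x \<noteq> 0})"
proof -
  let ?A = "affine_space {..<k} :: (nat \<Rightarrow> complex) fun_space"
  let ?S = "{x \<in> Y. p x = 0}" and ?U = "{x \<in> Y. p x \<noteq> 0}"
  let ?V = "\<lambda>Y :: (nat \<Rightarrow> complex) set. Variety (induced ?A Y)"
  have A: "function_sheaf ?A" by (rule locally_ringedD(1)[OF locally_ringed_affine_space])
  note sub = quasi_affine_subset[OF Y]
  note S = quasi_affine_Int_zero[OF Y p] and U = quasi_affine_Int_nonzero[OF Y p]
  have pts: "points (induced ?A Y) = Y" by (rule points_induced_affine[OF sub])
  have "openin (zariski (induced ?A Y)) (Y - ?S)"
  proof -
    have "Y - ?S = {x \<in> {..<k} \<rightarrow>\<^sub>E UNIV. p x \<noteq> 0} \<inter> Y" using sub by auto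
    then show ?thesis using openin_basic[OF p] by (auto simp: openin_subtopology)
  qed
  then have cl: "closedin (zariski (induced ?A Y)) ?S"
    unfolding closedin_def pts by auto
  have iS: "isomorphic (induced ?A ?S) (induced (induced ?A Y) ?S)"
    by (rule isomorphic_sym[OF isomorphic_induced_induced[OF A]]) auto
  have iU: "isomorphic (induced ?A ?U) (induced (induced ?A Y) (points (induced ?A Y) - ?S))"
  proof -
    have "points (induced ?A Y) - ?S = ?U" unfolding pts by auto
    moreover have "isomorphic (induced ?A ?U) (induced (induced ?A Y) ?U)"
      by (rule isomorphic_sym[OF isomorphic_induced_induced[OF A]]) auto
    ultimately show ?thesis by simp
  qed
  have "k0_gen (?V Y) - k0_gen (?V ?S) - k0_gen (?V ?U) \<in> k0_relations"
    unfolding k0_relations_def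
    by (rule UnI1, rule UnI1, rule UnI2, rule CollectI, intro exI conjI, rule refl)
       (use cl iS iU in \<open>simp_all only: of_variety_quasi_affine[OF Y] of_variety_quasi_affine[OF S] of_variety_quasi_affine[OF U]\<close>)
  then show ?thesis
    unfolding k0_class_quasi_affine[OF Y] k0_class_quasi_affine[OF S] k0_class_quasi_affine[OF U]
    by (rule k0_of_variety_add)
qed

lemma quasi_affine_all: "quasi_affine I (I \<rightarrow>\<^sub>E UNIV)"
  unfolding quasi_affine_def
  by (intro exI[of _ "{\<lambda>_. 1}"] exI[of _ "{}"]) (auto intro: poly_funs.const)

lemma quasi_affine_empty: "quasi_affine I {}"
  unfolding quasi_affine_def by (intro exI[of _ "{}"]) auto

text \<open>
  Cutting the empty set gives twice the empty set.
\<close>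

lemma k0_class_empty: "k0_class (induced (affine_space {..<k::nat}) {}) = 0"
  using k0_class_cut[OF quasi_affine_empty poly_funs.const, of k 1] by simp

text \<open>
  Morphisms into affine spaces are tuples of regular functions, hence affine spaces satisfy the
  universal property of products.
\<close>

lemma k0_class_affine_space_Suc:
  "k0_class (induced (affine_space {..<Suc k}) ({..<Suc k} \<rightarrow>\<^sub>E UNIV)) =
   k0_class (induced (affine_space {..<k}) ({..<k} \<rightarrow>\<^sub>E UNIV)) * lefschetz"
proof -
  let ?X = "\<lambda>n::nat. induced (affine_space {..<n}) ({..<n} \<rightarrow>\<^sub>E UNIV)"
  let ?V = "\<lambda>n. Variety (?X n)"
  have V: "of_variety (?V n) = ?X n" for n by (rule of_variety_quasi_affine[OF quasi_affine_all])
  have pts: "points (?X n) = {..<n} \<rightarrow>\<^sub>E UNIV" for n by simp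
  have lr: "locally_ringed (?X n)" for n by (rule locally_ringed_induced_affine)
  have coord: "(\<lambda>x\<in>points (?X n). x i) \<in> regular (?X n) (points (?X n))" if "i < n" for n i
    using regular_poly[OF order_refl poly_funs.coord[of i "{..<n}"]] that unfolding pts by simp
  have lef: "lefschetz = k0_class (?X 1)"
  proof -
    have "{..<1} = {0::nat}" by auto
    then show ?thesis unfolding lefschetz_def
      using k0_class_isomorphic[OF isomorphic_affine_space_induced[of "{0::nat}"]] by simp
  qed
  define p where "p = (\<lambda>x :: nat \<Rightarrow> complex. restrict x {..<k})"
  define p' where "p' = (\<lambda>x :: nat \<Rightarrow> complex. \<lambda>_\<in>{..<1::nat}. x k)"
  have "is_product (?V (Suc k)) p p' (?V k) (?V 1)"
    unfolding is_product_def V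
  proof (intro conjI allI impI)
    show "morphism (?X (Suc k)) (?X k) p"
    proof (rule morphism_into_affine[OF lr order_refl])
      show "(\<lambda>t\<in>points (?X (Suc k)). p t i) \<in> regular (?X (Suc k)) (points (?X (Suc k)))" if "i \<in> {..<k}" for i
        using coord[of i "Suc k"] that by (simp add: p_def del: points_induced_affine)
    qed (simp add: p_def)
    show "morphism (?X (Suc k)) (?X 1) p'"
    proof (rule morphism_into_affine[OF lr order_refl])
      show "(\<lambda>t\<in>points (?X (Suc k)). p' t i) \<in> regular (?X (Suc k)) (points (?X (Suc k)))" if "i \<in> {..<1}" for i
        using coord[of k "Suc k"] that by (simp add: p'_def del: points_induced_affine)
    qed (simp add: p'_def)
    fix T f g assume fg: "morphism (of_variety T) (?X k) f \<and> morphism (of_variety T) (?X 1) g"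
    let ?T = "of_variety T"
    have "is_variety ?T" using of_variety by auto
    then have T: "locally_ringed ?T" by (auto simp: is_variety_def intro: locally_ringed_prevariety)
    note f = morphism_into_affineD[OF conjunct1[OF fg] order_refl]
    note g = morphism_into_affineD[OF conjunct2[OF fg] order_refl]
    define h where "h = (\<lambda>t. (f t)(k := g t 0))"
    have ht: "h t \<in> {..<Suc k} \<rightarrow>\<^sub>E UNIV \<and> p (h t) = f t \<and> p' (h t) = g t" if t: "t \<in> points ?T" for t
    proof -
      have 1: "f t \<in> {..<k} \<rightarrow>\<^sub>E UNIV" "g t \<in> {..<1} \<rightarrow>\<^sub>E UNIV" using f(1)[OF t] g(1)[OF t] by auto
      have "h t \<in> {..<Suc k} \<rightarrow>\<^sub>E UNIV" using 1(1) by (auto simp: h_def PiE_def extensional_def)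
      moreover have "p (h t) = f t"
        using 1(1) by (auto simp: p_def h_def fun_eq_iff PiE_def extensional_def)
      moreover have "p' (h t) = g t"
        using 1(2) by (auto simp: p'_def h_def fun_eq_iff PiE_def extensional_def restrict_def)
      ultimately show ?thesis by blast
    qed
    have "morphism ?T (?X (Suc k)) h"
    proof (rule morphism_into_affine[OF T order_refl])
      show "h t \<in> {..<Suc k} \<rightarrow>\<^sub>E UNIV" if "t \<in> points ?T" for t using ht[OF that] by blast
      show "(\<lambda>t\<in>points ?T. h t i) \<in> regular ?T (points ?T)" if i: "i \<in> {..<Suc k}" for i
      proof (cases "i = k")
        case True
        then show ?thesis using g(2)[of 0] by (simp add: h_def)
      next
        case False
        then show ?thesis using f(2)[of i] i by (simp add: h_def)
      qed
    qed
    then show "\<exists>h. morphism ?T (?X (Suc k)) h \<and> (\<forall>t\<in>points ?T. p (h t) = f t \<and> p' (h t) = g t)"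
      using ht by blast
    fix h h' t
    assume hh: "morphism ?T (?X (Suc k)) h \<and> morphism ?T (?X (Suc k)) h' \<and>
             (\<forall>t\<in>points ?T. p (h t) = p (h' t) \<and> p' (h t) = p' (h' t))"
    show "\<forall>t\<in>points ?T. h t = h' t"
    proof
      fix t assume t: "t \<in> points ?T"
      have e: "h t \<in> {..<Suc k} \<rightarrow>\<^sub>E UNIV" "h' t \<in> {..<Suc k} \<rightarrow>\<^sub>E UNIV"
        by (rule morphism_into_affineD(1)[OF conjunct1[OF hh] order_refl t],
            rule morphism_into_affineD(1)[OF conjunct1[OF conjunct2[OF hh]] order_refl t])
      have eq: "p (h t) = p (h' t)" "p' (h t) = p' (h' t)" using hh t by auto
      show "h t = h' t"
      proof (rule PiE_ext[OF e])
        fix i assume "i \<in> {..<Suc k}"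
        then show "h t i = h' t i"
          using fun_cong[OF eq(1), of i] fun_cong[OF eq(2), of 0]
          by (cases "i = k") (auto simp: p_def p'_def)
      qed
    qed
  qed
  from k0_of_variety_product[OF this] show ?thesis
    unfolding lef by (simp only: k0_class_quasi_affine[OF quasi_affine_all])
qed

lemma k0_class_affine_space:
  "k0_class (induced (affine_space {..<k::nat}) ({..<k} \<rightarrow>\<^sub>E UNIV)) = lefschetz ^ k"
proof (induction k)
  case 0
  have "isomorphic (of_variety (Variety (induced (affine_space {..<0}) ({..<0} \<rightarrow>\<^sub>E UNIV)))) (affine_space ({}::nat set))"
    unfolding of_variety_quasi_affine[OF quasi_affine_all]
    using isomorphic_sym[OF isomorphic_affine_space_induced[of "{}::nat set"]] by simp
  from k0_of_variety_point[OF this] show ?case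
    by (simp only: k0_class_quasi_affine[OF quasi_affine_all] power_0)
next
  case (Suc k)
  then show ?case by (simp add: k0_class_affine_space_Suc mult.commute)
qed

definition coordinate_locus :: "'i set \<Rightarrow> 'i set \<Rightarrow> 'i set \<Rightarrow> 'i set set \<Rightarrow> ('i \<Rightarrow> complex) set" where
  "coordinate_locus I E0 E1 \<F> =
     {x \<in> I \<rightarrow>\<^sub>E UNIV. (\<forall>i\<in>E0. x i = 0) \<and> (\<forall>i\<in>E1. x i \<noteq> 0) \<and> {i \<in> I. x i \<noteq> 0} \<in> \<F>}"

text \<open>
  For a family that is closed under enlargement, having a support in \<open>\<F>\<close> means that the product of
  the coordinates in some member of \<open>\<F>\<close> does not vanish.
\<close>

lemma quasi_affine_coordinate_locus:
  assumes "finite I" "E0 \<subseteq> I" "E1 \<subseteq> I"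
    and up: "\<And>S S'. S \<in> \<F> \<Longrightarrow> S \<subseteq> S' \<Longrightarrow> S' \<subseteq> I \<Longrightarrow> S' \<in> \<F>"
  shows "quasi_affine I (coordinate_locus I E0 E1 \<F>)"
  unfolding quasi_affine_def
proof (intro exI conjI)
  let ?P = "(\<lambda>S x. \<Prod>i\<in>S \<union> E1. x i) ` {S. S \<in> \<F> \<and> S \<subseteq> I} :: (('a \<Rightarrow> complex) \<Rightarrow> complex) set"
  let ?F = "(\<lambda>i x. x i) ` E0 :: (('a \<Rightarrow> complex) \<Rightarrow> complex) set"
  show "finite ?P" using assms(1) by auto
  have fin: "finite (S \<union> E1)" if "S \<subseteq> I" for S using that assms(1,3) finite_subset by blast
  show "?P \<subseteq> poly_funs I"
    using assms fin by (auto intro!: poly_funs_prod poly_funs.coord)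
  show "?F \<subseteq> poly_funs I" using assms(2) by (auto intro: poly_funs.coord)
  show "coordinate_locus I E0 E1 \<F> = {x \<in> I \<rightarrow>\<^sub>E UNIV. (\<exists>p\<in>?P. p x \<noteq> 0) \<and> (\<forall>f\<in>?F. f x = 0)}"
  proof (intro equalityI subsetI)
    fix x assume x: "x \<in> coordinate_locus I E0 E1 \<F>"
    have "(\<Prod>i\<in>{i \<in> I. x i \<noteq> 0} \<union> E1. x i) \<noteq> 0"
      using x fin[of "{i \<in> I. x i \<noteq> 0}"] by (auto simp: coordinate_locus_def)
    then show "x \<in> {x \<in> I \<rightarrow>\<^sub>E UNIV. (\<exists>p\<in>?P. p x \<noteq> 0) \<and> (\<forall>f\<in>?F. f x = 0)}"
      using x unfolding coordinate_locus_def by auto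
  next
    fix x assume x: "x \<in> {x \<in> I \<rightarrow>\<^sub>E UNIV. (\<exists>p\<in>?P. p x \<noteq> 0) \<and> (\<forall>f\<in>?F. f x = 0)}"
    then obtain S where S: "S \<in> \<F>" "S \<subseteq> I" "(\<Prod>i\<in>S \<union> E1. x i) \<noteq> 0" by auto
    have nz: "\<forall>i\<in>S \<union> E1. x i \<noteq> 0" using S fin[OF S(2)] by auto
    have "{i \<in> I. x i \<noteq> 0} \<in> \<F>" by (rule up[OF S(1)]) (use nz S in auto)
    then show "x \<in> coordinate_locus I E0 E1 \<F>"
      using x nz by (auto simp: coordinate_locus_def)
  qed
qed

lemma coordinate_locus_cut:
  "{x \<in> coordinate_locus I E0 E1 \<F>. x e = 0} = coordinate_locus I (insert e E0) E1 \<F>"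
  "{x \<in> coordinate_locus I E0 E1 \<F>. x e \<noteq> 0} = coordinate_locus I E0 (insert e E1) \<F>"
  by (auto simp: coordinate_locus_def)

lemma k0_class_coordinate_subspace:
  assumes "E0 \<subseteq> {..<k::nat}"
  shows "k0_class (induced (affine_space {..<k}) (coordinate_locus {..<k} E0 {} UNIV)) = lefschetz ^ (k - card E0)"
proof -
  let ?Y = "coordinate_locus {..<k} E0 {} UNIV"
  have fin: "finite E0" using assms finite_subset by auto
  have "card ({..<k} - E0) = k - card E0" using assms fin by (simp add: card_Diff_subset)
  then obtain b where b: "bij_betw b {..<k - card E0} ({..<k} - E0)"
    using bij_betw_from_nat_into_finite[of "{..<k} - E0"] by auto
  let ?m = "k - card E0"
  have "isomorphic (induced (affine_space {..<k}) ?Y)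
      (induced (affine_space {..<?m}) ((\<lambda>x. \<lambda>j\<in>{..<?m}. x (b j)) ` ?Y))"
    by (rule isomorphic_reindex[OF b]) (auto simp: coordinate_locus_def)
  moreover have "(\<lambda>x. \<lambda>j\<in>{..<?m}. x (b j)) ` ?Y = {..<?m} \<rightarrow>\<^sub>E UNIV"
  proof (intro equalityI subsetI)
    fix z :: "nat \<Rightarrow> complex" assume z: "z \<in> {..<?m} \<rightarrow>\<^sub>E UNIV"
    let ?x = "\<lambda>i\<in>{..<k}. if i \<in> E0 then 0 else z (inv_into {..<?m} b i)"
    have bj: "b j \<in> {..<k} - E0 \<and> inv_into {..<?m} b (b j) = j" if "j < ?m" for j
      using b that by (auto simp: bij_betw_def)
    have xY: "?x \<in> ?Y" using assms by (auto simp: coordinate_locus_def)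
    have eq: "(\<lambda>j\<in>{..<?m}. ?x (b j)) = z"
      using bj z by (auto simp: fun_eq_iff PiE_def extensional_def)
    show "z \<in> (\<lambda>x. \<lambda>j\<in>{..<?m}. x (b j)) ` ?Y"
      by (rule image_eqI[where x = ?x]) (simp_all only: eq xY)
  qed (auto split: if_splits)
  ultimately show ?thesis
    using k0_class_affine_space[of ?m] by (simp only: k0_class_isomorphic)
qed

text \<open>
  Inclusion-exclusion: requiring one more coordinate to be nonzero subtracts the class of the
  hyperplane section, \<open>\<bbbL>\<^sup>n\<^sup>+\<^sup>1 - \<bbbL>\<^sup>n = (\<bbbL> - 1) \<bbbL>\<^sup>n\<close>.
\<close>

lemma k0_class_torus:
  assumes "finite E1" "E1 \<subseteq> {..<k::nat}" "E0 \<subseteq> {..<k}" "E0 \<inter> E1 = {}"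
  shows "k0_class (induced (affine_space {..<k}) (coordinate_locus {..<k} E0 E1 UNIV)) =
    (lefschetz - 1) ^ card E1 * lefschetz ^ (k - card E0 - card E1)"
  using assms
proof (induction E1 arbitrary: E0 rule: finite_induct)
  case empty
  then show ?case by (simp add: k0_class_coordinate_subspace)
next
  case (insert e E1)
  let ?c = "\<lambda>E0 E1. k0_class (induced (affine_space {..<k}) (coordinate_locus {..<k} E0 E1 UNIV))"
  let ?n = "k - card E0 - card (insert e E1)"
  have e: "e \<in> {..<k}" "e \<notin> E0" "e \<notin> E1" using insert by auto
  have fin: "finite E0" using insert.prems finite_subset by auto
  have "E0 \<union> insert e E1 \<subseteq> {..<k}" using insert.prems by auto
  then have "card (E0 \<union> insert e E1) \<le> k" using card_mono[of "{..<k}" "E0 \<union> insert e E1"] by simp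
  then have "card E0 + card (insert e E1) \<le> k"
    using insert.prems fin insert.hyps by (subst (asm) card_Un_disjoint) auto
  then have n: "k - card E0 - card E1 = Suc ?n" "k - card (insert e E0) - card E1 = ?n"
    using insert.hyps fin e by auto
  have "?c E0 E1 = ?c (insert e E0) E1 + ?c E0 (insert e E1)"
    unfolding coordinate_locus_cut[symmetric]
    by (rule k0_class_cut[OF quasi_affine_coordinate_locus poly_funs.coord]) (use insert.prems e in auto)
  moreover have "?c E0 E1 = (lefschetz - 1) ^ card E1 * lefschetz ^ Suc ?n"
    using insert.IH[of E0] insert.prems n by simp
  moreover have "?c (insert e E0) E1 = (lefschetz - 1) ^ card E1 * lefschetz ^ ?n"
    using insert.IH[of "insert e E0"] insert.prems n e by simp
  ultimately have "?c E0 (insert e E1) = (lefschetz - 1) ^ card E1 * lefschetz ^ Suc ?n - (lefschetz - 1) ^ card E1 * lefschetz ^ ?n"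
    by (simp add: algebra_simps)
  also have "\<dots> = (lefschetz - 1) ^ card (insert e E1) * lefschetz ^ ?n"
    using insert.hyps by (simp add: algebra_simps)
  finally show ?case .
qed

text \<open>
  Cutting along all coordinate hyperplanes leaves one torus for every support in the family.
\<close>

lemma k0_class_coordinate_locus:
  assumes "E1 \<subseteq> {..<k::nat}" "E0 \<subseteq> {..<k}" "E0 \<inter> E1 = {}"
    and up: "\<And>S S'. S \<in> \<F> \<Longrightarrow> S \<subseteq> S' \<Longrightarrow> S' \<subseteq> {..<k} \<Longrightarrow> S' \<in> \<F>"
  shows "k0_class (induced (affine_space {..<k}) (coordinate_locus {..<k} E0 E1 \<F>)) =
    (\<Sum>S | S \<in> \<F> \<and> E1 \<subseteq> S \<and> S \<subseteq> {..<k} - E0. (lefschetz - 1) ^ card S)"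
  using assms(1-3)
proof (induction "card ({..<k} - E0 - E1)" arbitrary: E0 E1)
  case 0
  then have k: "{..<k} - E0 = E1" by auto
  have S: "E1 \<subseteq> S \<and> S \<subseteq> {..<k} - E0 \<longleftrightarrow> S = E1" for S using k by auto
  have supp: "{i \<in> {..<k}. x i \<noteq> 0} = E1" if "\<forall>i\<in>E0. x i = 0" "\<forall>i\<in>E1. x i \<noteq> 0" for x :: "nat \<Rightarrow> complex"
    using that k 0 by auto
  show ?case
  proof (cases "E1 \<in> \<F>")
    case True
    have "coordinate_locus {..<k} E0 E1 \<F> = coordinate_locus {..<k} E0 E1 UNIV"
      using supp True by (auto simp: coordinate_locus_def)
    moreover have "k - card E0 - card E1 = 0"
    proof -
      have "card {..<k} = card E0 + card E1"
        using k 0 by (metis card_Un_disjoint finite_lessThan finite_subset Un_Diff_cancel sup.absorb_iff2)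
      then show ?thesis by simp
    qed
    moreover have "finite E1" by (rule finite_subset[OF 0(2)]) simp
    ultimately have "k0_class (induced (affine_space {..<k}) (coordinate_locus {..<k} E0 E1 \<F>)) = (lefschetz - 1) ^ card E1"
      using k0_class_torus[of E1 k E0] 0 by simp
    moreover have "{S. S \<in> \<F> \<and> E1 \<subseteq> S \<and> S \<subseteq> {..<k} - E0} = {E1}" using S True by auto
    ultimately show ?thesis by simp
  next
    case False
    have "coordinate_locus {..<k} E0 E1 \<F> = {}"
      using supp False by (auto simp: coordinate_locus_def)
    moreover have "{S. S \<in> \<F> \<and> E1 \<subseteq> S \<and> S \<subseteq> {..<k} - E0} = {}" using S False by auto
    ultimately show ?thesis by (simp only: k0_class_empty sum.empty)
  qed
next
  case (Suc n)
  let ?c = "\<lambda>E0 E1. k0_class (induced (affine_space {..<k}) (coordinate_locus {..<k} E0 E1 \<F>))"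
  have "{..<k} - E0 - E1 \<noteq> {}" using Suc.hyps(2) by (metis card.empty nat.distinct(1))
  then obtain e where e: "e \<in> {..<k}" "e \<notin> E0" "e \<notin> E1" by auto
  have d: "{..<k} - insert e E0 - E1 = ({..<k} - E0 - E1) - {e}" "{..<k} - E0 - insert e E1 = ({..<k} - E0 - E1) - {e}"
    by auto
  have n: "n = card ({..<k} - insert e E0 - E1)" "n = card ({..<k} - E0 - insert e E1)"
    unfolding d using Suc.hyps(2) e by simp_all
  have "?c E0 E1 = ?c (insert e E0) E1 + ?c E0 (insert e E1)"
    unfolding coordinate_locus_cut[symmetric]
    by (rule k0_class_cut[OF quasi_affine_coordinate_locus poly_funs.coord]) (use Suc.prems e up in auto)
  also have "?c (insert e E0) E1 = (\<Sum>S | S \<in> \<F> \<and> E1 \<subseteq> S \<and> S \<subseteq> {..<k} - insert e E0. (lefschetz - 1) ^ card S)"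
    by (rule Suc.hyps(1)[OF n(1)]) (use Suc.prems e in auto)
  also have "?c E0 (insert e E1) = (\<Sum>S | S \<in> \<F> \<and> insert e E1 \<subseteq> S \<and> S \<subseteq> {..<k} - E0. (lefschetz - 1) ^ card S)"
    by (rule Suc.hyps(1)[OF n(2)]) (use Suc.prems e in auto)
  also have "(\<Sum>S | S \<in> \<F> \<and> E1 \<subseteq> S \<and> S \<subseteq> {..<k} - insert e E0. (lefschetz - 1) ^ card S) +
      (\<Sum>S | S \<in> \<F> \<and> insert e E1 \<subseteq> S \<and> S \<subseteq> {..<k} - E0. (lefschetz - 1) ^ card S) =
      (\<Sum>S\<in>{S. S \<in> \<F> \<and> E1 \<subseteq> S \<and> S \<subseteq> {..<k} - insert e E0} \<union>
        {S. S \<in> \<F> \<and> insert e E1 \<subseteq> S \<and> S \<subseteq> {..<k} - E0}. (lefschetz - 1) ^ card S)"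
    by (rule sum.union_disjoint[symmetric]) auto
  also have "{S. S \<in> \<F> \<and> E1 \<subseteq> S \<and> S \<subseteq> {..<k} - insert e E0} \<union>
        {S. S \<in> \<F> \<and> insert e E1 \<subseteq> S \<and> S \<subseteq> {..<k} - E0} = {S. S \<in> \<F> \<and> E1 \<subseteq> S \<and> S \<subseteq> {..<k} - E0}"
    using e by auto
  finally show ?case .
qed

lemma k0_class_support_locus:
  fixes I :: "'i set"
  assumes I: "finite I" and up: "\<And>S S'. S \<in> \<F> \<Longrightarrow> S \<subseteq> S' \<Longrightarrow> S' \<subseteq> I \<Longrightarrow> S' \<in> \<F>"
  shows "k0_class (induced (affine_space I) {x \<in> I \<rightarrow>\<^sub>E UNIV. {i \<in> I. x i \<noteq> 0} \<in> \<F>}) =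
    (\<Sum>S | S \<in> \<F> \<and> S \<subseteq> I. (lefschetz - 1) ^ card S)"
proof -
  let ?Y = "{x \<in> I \<rightarrow>\<^sub>E UNIV. {i \<in> I. x i \<noteq> 0} \<in> \<F>} :: ('i \<Rightarrow> complex) set"
  obtain b where b: "bij_betw b {..<card I} I"
    using bij_betw_from_nat_into_finite[OF I] by auto
  let ?k = "card I"
  define \<G> where "\<G> = {T. T \<subseteq> {..<?k} \<and> b ` T \<in> \<F>}"
  have inj: "inj_on b {..<?k}" and img: "b ` {..<?k} = I" using b by (auto simp: bij_betw_def)
  have "isomorphic (induced (affine_space I) ?Y) (induced (affine_space {..<?k}) ((\<lambda>x. \<lambda>j\<in>{..<?k}. x (b j)) ` ?Y))"
    by (rule isomorphic_reindex[OF b]) auto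
  moreover have "(\<lambda>x. \<lambda>j\<in>{..<?k}. x (b j)) ` ?Y = coordinate_locus {..<?k} {} {} \<G>"
  proof (intro equalityI subsetI)
    fix z assume "z \<in> (\<lambda>x. \<lambda>j\<in>{..<?k}. x (b j)) ` ?Y"
    then obtain x where x: "x \<in> ?Y" "z = (\<lambda>j\<in>{..<?k}. x (b j))" by auto
    have "b ` {j \<in> {..<?k}. z j \<noteq> 0} = {i \<in> b ` {..<?k}. x i \<noteq> 0}"
      unfolding x(2) by auto
    then have "b ` {j \<in> {..<?k}. z j \<noteq> 0} = {i \<in> I. x i \<noteq> 0}" unfolding img .
    then show "z \<in> coordinate_locus {..<?k} {} {} \<G>"
      using x by (auto simp: coordinate_locus_def \<G>_def)
  next
    fix z assume z: "z \<in> coordinate_locus {..<?k} {} {} \<G>"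
    let ?x = "\<lambda>i\<in>I. z (inv_into {..<?k} b i)"
    have inv: "inv_into {..<?k} b (b j) = j \<and> b j \<in> I" if "j < ?k" for j
      using inj img that by auto
    have eq: "(\<lambda>j\<in>{..<?k}. ?x (b j)) = z"
      using inv z by (auto simp: coordinate_locus_def fun_eq_iff PiE_def extensional_def)
    have "{i \<in> b ` {..<?k}. ?x i \<noteq> 0} = b ` {j \<in> {..<?k}. z j \<noteq> 0}"
      using inv by auto
    then have "{i \<in> I. ?x i \<noteq> 0} = b ` {j \<in> {..<?k}. z j \<noteq> 0}" unfolding img .
    then have xY: "?x \<in> ?Y" using z by (auto simp: coordinate_locus_def \<G>_def)
    show "z \<in> (\<lambda>x. \<lambda>j\<in>{..<?k}. x (b j)) ` ?Y"
      by (rule image_eqI[where x = ?x]) (simp_all only: eq xY)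
  qed
  ultimately have "k0_class (induced (affine_space I) ?Y) =
      k0_class (induced (affine_space {..<?k}) (coordinate_locus {..<?k} {} {} \<G>))"
    by (simp only: k0_class_isomorphic)
  also have "\<dots> = (\<Sum>T | T \<in> \<G> \<and> {} \<subseteq> T \<and> T \<subseteq> {..<?k} - {}. (lefschetz - 1) ^ card T)"
  proof (rule k0_class_coordinate_locus)
    fix S S' assume "S \<in> \<G>" "S \<subseteq> S'" "S' \<subseteq> {..<?k}"
    then show "S' \<in> \<G>" using up[of "b ` S" "b ` S'"] img by (auto simp: \<G>_def)
  qed auto
  also have "\<dots> = (\<Sum>S | S \<in> \<F> \<and> S \<subseteq> I. (lefschetz - 1) ^ card S)"
  proof (rule sum.reindex_bij_witness[where j = "\<lambda>T. b ` T" and i = "\<lambda>S. inv_into {..<?k} b ` S"])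
    fix T assume T: "T \<in> {T. T \<in> \<G> \<and> {} \<subseteq> T \<and> T \<subseteq> {..<?k} - {}}"
    show "inv_into {..<?k} b ` b ` T = T" using T inj by (intro inv_into_image_cancel) auto
    show "b ` T \<in> {S. S \<in> \<F> \<and> S \<subseteq> I}" using T img by (auto simp: \<G>_def)
    have "inj_on b T" using T inj by (auto intro: inj_on_subset)
    then show "(lefschetz - 1) ^ card (b ` T) = (lefschetz - 1) ^ card T" by (simp add: card_image)
  next
    fix S assume S: "S \<in> {S. S \<in> \<F> \<and> S \<subseteq> I}"
    show eq: "b ` inv_into {..<?k} b ` S = S" using S img by (intro image_inv_into_cancel[OF img]) auto
    have "inv_into {..<?k} b ` S \<subseteq> {..<?k}" using S img inv_into_into[of _ b "{..<?k}"] by blast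
    then show "inv_into {..<?k} b ` S \<in> {T. T \<in> \<G> \<and> {} \<subseteq> T \<and> T \<subseteq> {..<?k} - {}}"
      using S eq by (auto simp: \<G>_def)
  qed
  finally show ?thesis .
qed

section \<open>Rational functions inside the motivic ring\<close>

lemma of_rat_fun_add: "of_rat_fun (a + b) = of_rat_fun a + of_rat_fun b"
proof -
  have "tensor_gen 1 (a + b) - tensor_gen 1 a - tensor_gen 1 b \<in> tensor_relations"
    unfolding tensor_relations_def by blast
  from ideal_generated_base[OF this] show ?thesis
    by (simp add: of_rat_fun_def tensor.abs_eq plus_motivic.abs_eq motivic.abs_eq_iff cong_ideal_def diff_diff_eq)
qed

lemma of_rat_fun_0 [simp]: "of_rat_fun 0 = 0"
  using of_rat_fun_add[of 0 0] by simp

lemma of_rat_fun_sum: "of_rat_fun (sum f A) = (\<Sum>a\<in>A. of_rat_fun (f a))"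
  by (induction A rule: infinite_finite_induct) (simp_all add: of_rat_fun_add)

lemma of_rat_fun_diff: "of_rat_fun (a - b) = of_rat_fun a - of_rat_fun b"
  using of_rat_fun_add[of "a - b" b] by (simp add: algebra_simps)

lemma of_rat_fun_power: "of_rat_fun (a ^ n) = of_rat_fun a ^ n"
  by (induction n) (simp_all add: of_rat_fun_1 of_rat_fun_mult[symmetric])

lemma tensor_add: "tensor (a + a') b = tensor a b + tensor a' b"
proof -
  have "tensor_gen (a + a') b - tensor_gen a b - tensor_gen a' b \<in> tensor_relations"
    unfolding tensor_relations_def by blast
  from ideal_generated_base[OF this] show ?thesis
    by (simp add: tensor.abs_eq plus_motivic.abs_eq motivic.abs_eq_iff cong_ideal_def diff_diff_eq)
qed

lemma tensor_lefschetz: "tensor lefschetz 1 = of_rat_fun (q_half\<^sup>2)"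
proof -
  have "tensor_gen (lefschetz * 1) 1 - tensor_gen 1 (q_half\<^sup>2 * 1) \<in> tensor_relations"
    unfolding tensor_relations_def by blast
  from ideal_generated_base[OF this] show ?thesis
    by (simp add: of_rat_fun_def tensor.abs_eq motivic.abs_eq_iff cong_ideal_def)
qed

lemma tensor_mult: "tensor (a * a') 1 = tensor a 1 * tensor a' 1"
  by (simp add: tensor.abs_eq times_motivic.abs_eq tensor_gen_def mult_single)

lemma tensor_1: "tensor 1 1 = 1"
  using of_rat_fun_1 by (simp add: of_rat_fun_def)

lemma tensor_0: "tensor 0 b = 0"
  using tensor_add[of 0 0 b] by simp

lemma tensor_sum: "tensor (sum f A) b = (\<Sum>a\<in>A. tensor (f a) b)"
  by (induction A rule: infinite_finite_induct) (simp_all add: tensor_0 tensor_add)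

lemma tensor_power: "tensor (a ^ n) 1 = tensor a 1 ^ n"
  by (induction n) (simp_all add: tensor_1 tensor_mult)

lemma tensor_lefschetz_minus_1_power: "tensor ((lefschetz - 1) ^ n) 1 = of_rat_fun ((q_half\<^sup>2 - 1) ^ n)"
proof -
  have "tensor (lefschetz - 1) 1 + tensor 1 1 = tensor lefschetz 1"
    by (simp add: tensor_add[symmetric])
  then have "tensor (lefschetz - 1) 1 = of_rat_fun (q_half\<^sup>2 - 1)"
    by (simp add: of_rat_fun_diff of_rat_fun_1 tensor_1 tensor_lefschetz algebra_simps)
  then show ?thesis by (simp add: tensor_power of_rat_fun_power)
qed

lemma motivic_class_support_locus:
  assumes "finite I" "\<And>S S'. S \<in> \<F> \<Longrightarrow> S \<subseteq> S' \<Longrightarrow> S' \<subseteq> I \<Longrightarrow> S' \<in> \<F>"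
  shows "motivic_class (induced (affine_space I) {x \<in> I \<rightarrow>\<^sub>E UNIV. {i \<in> I. x i \<noteq> 0} \<in> \<F>}) =
    of_rat_fun (\<Sum>S | S \<in> \<F> \<and> S \<subseteq> I. (q_half\<^sup>2 - 1) ^ card S)"
proof -
  have "k0_class (induced (affine_space I) {x \<in> I \<rightarrow>\<^sub>E UNIV. {i \<in> I. x i \<noteq> 0} \<in> \<F>}) =
    (\<Sum>S | S \<in> \<F> \<and> S \<subseteq> I. (lefschetz - 1) ^ card S)"
    by (rule k0_class_support_locus[OF assms(1)]) (rule assms(2))
  then show ?thesis
    by (simp only: motivic_class_def tensor_sum tensor_lefschetz_minus_1_power of_rat_fun_sum)
qed

lemma q_half_nonzero: "q_half \<noteq> 0" and q_half_square: "q_half\<^sup>2 - 1 \<noteq> 0"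
  by (simp_all add: q_half_def Zero_fract_def One_fract_def eq_fract power2_eq_square
          poly_eq_iff[of _ 1]) (auto simp: coeff_pCons split: nat.splits)

section \<open>Slopes as linear inequalities\<close>

lemma upper_half_iff: "z \<in> upper_half \<longleftrightarrow> Im z > 0 \<or> Im z = 0 \<and> Re z < 0"
proof
  assume "z \<in> upper_half"
  then obtain r \<phi> where *: "r > 0" "0 < \<phi>" "\<phi> \<le> 1" "z = of_real r * exp (\<i> * of_real (pi * \<phi>))"
    by (auto simp: upper_half_def)
  have z: "Re z = r * cos (pi * \<phi>)" "Im z = r * sin (pi * \<phi>)"
    unfolding *(4) by (simp_all add: Re_exp Im_exp)
  show "Im z > 0 \<or> Im z = 0 \<and> Re z < 0"
  proof (cases "\<phi> = 1")
    case True
    then show ?thesis using z * by simp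
  next
    case False
    then have "0 < pi * \<phi>" "pi * \<phi> < pi" using * by auto
    then show ?thesis using z * sin_gt_zero by simp
  qed
next
  assume a: "Im z > 0 \<or> Im z = 0 \<and> Re z < 0"
  then have nz: "z \<noteq> 0" by auto
  have "0 < Arg2pi z" "Arg2pi z \<le> pi"
    using a Arg2pi_lt_pi[of z] Arg2pi_eq_pi[of z] pi_gt_zero by (auto simp: complex_is_Real_iff)
  moreover have "z = of_real (norm z) * exp (\<i> * of_real (pi * (Arg2pi z / pi)))"
    using Arg2pi_eq[of z] by simp
  ultimately show "z \<in> upper_half" unfolding upper_half_def
    using nz by (intro CollectI exI[of _ "norm z"] exI[of _ "Arg2pi z / pi"]) auto
qed

lemma upper_half_add: "z \<in> upper_half \<Longrightarrow> w \<in> upper_half \<Longrightarrow> z + w \<in> upper_half"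
  by (auto simp: upper_half_iff)

lemma upper_half_sum:
  "finite A \<Longrightarrow> A \<noteq> {} \<Longrightarrow> (\<And>a. a \<in> A \<Longrightarrow> f a \<in> upper_half) \<Longrightarrow> sum f A \<in> upper_half"
  by (induction A rule: finite_ne_induct) (auto intro: upper_half_add)

text \<open>
  In the closed upper half plane the slope is minus the cotangent of the argument, so comparing
  slopes is comparing arguments.
\<close>

lemma slope_le_iff:
  assumes "z \<in> upper_half" "w \<in> upper_half"
  shows "ereal (- Re z) / ereal (Im z) \<le> ereal (- Re w) / ereal (Im w) \<longleftrightarrow> Im (z * cnj w) \<le> 0"
proof -
  have im: "Im (z * cnj w) = Im z * Re w - Re z * Im w" by simp
  have inf: "ereal (- Re x) / ereal (Im x) = \<infinity>" if "Im x = 0" "Re x < 0" for x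
    using that by (simp add: divide_ereal_def zero_ereal_def[symmetric])
  consider "Im z > 0" "Im w > 0" | "Im w = 0" "Re w < 0" | "Im z = 0" "Re z < 0" "Im w > 0"
    using assms by (auto simp: upper_half_iff)
  then show ?thesis
  proof cases
    case 1
    then show ?thesis unfolding im by (simp add: field_simps)
  next
    case 2
    moreover have "Im z \<ge> 0" using assms by (auto simp: upper_half_iff)
    ultimately show ?thesis unfolding im by (simp add: inf mult_nonneg_nonpos)
  next
    case 3
    then show ?thesis unfolding im by (simp add: inf zero_le_mult_iff)
  qed
qed

lemma on_ray_iff:
  assumes "z \<in> upper_half" "u \<in> upper_half"
  shows "z \<in> {of_real r * u | r. r > 0} \<longleftrightarrow> Im (z * cnj u) = 0"
proof
  assume "z \<in> {of_real r * u | r. r > 0}"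
  then show "Im (z * cnj u) = 0" by auto
next
  assume a: "Im (z * cnj u) = 0"
  then have *: "Im z * Re u = Re z * Im u" by simp
  show "z \<in> {of_real r * u | r. r > 0}"
  proof (cases "Im u = 0")
    case True
    then have "Re u < 0" using assms by (auto simp: upper_half_iff)
    then have "Im z = 0" using * True by simp
    then have "Re z < 0" using assms by (auto simp: upper_half_iff)
    then have "z = of_real (Re z / Re u) * u" "Re z / Re u > 0"
      using True \<open>Re u < 0\<close> \<open>Im z = 0\<close> by (auto simp: complex_eq_iff zero_less_divide_iff)
    then show ?thesis by blast
  next
    case False
    then have u: "Im u > 0" using assms by (auto simp: upper_half_iff)
    have "Im z \<noteq> 0"
    proof
      assume "Im z = 0"
      then have "Re z = 0" using * u by simp
      then show False using \<open>Im z = 0\<close> assms by (auto simp: upper_half_iff)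
    qed
    then have "Im z > 0" using assms by (auto simp: upper_half_iff)
    then have "z = of_real (Im z / Im u) * u" "Im z / Im u > 0"
      using * u by (auto simp: complex_eq_iff field_simps)
    then show ?thesis by blast
  qed
qed

section \<open>Semistability of abelian representations\<close>

lemma subspace_complex_iff: "vector_space_over_itself.subspace (N :: complex set) \<longleftrightarrow> N = {0} \<or> N = UNIV"
proof
  assume N: "vector_space_over_itself.subspace N"
  show "N = {0} \<or> N = UNIV"
  proof (cases "N \<subseteq> {0}")
    case True
    then show ?thesis using vector_space_over_itself.subspace_0[OF N] by auto
  next
    case False
    then obtain z where z: "z \<in> N" "z \<noteq> 0" by auto
    have "w \<in> N" for w
      using vector_space_over_itself.subspace_scale[OF N z(1), of "w / z"] z(2) by simp
    then show ?thesis by auto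
  qed
qed (auto simp: vector_space_over_itself.subspace_def)

lemma UNIV_complex_not_0: "(UNIV :: complex set) \<noteq> {0}"
  by (metis UNIV_I one_neq_zero singletonD)

lemma dim_complex_0: "vector_space_over_itself.dim ({0} :: complex set) = 0"
  by simp

lemma dim_complex_UNIV: "vector_space_over_itself.dim (UNIV :: complex set) = 1"
  using vector_space_over_itself.dim_UNIV[where 'a = complex] by simp

definition subset_dim :: "'v set \<Rightarrow> 'v \<Rightarrow>\<^sub>0 int" where
  "subset_dim C = (\<Sum>v\<in>C. Poly_Mapping.single v 1)"

lemma dim_vector_eq:
  assumes "finite (verts P)" "\<And>v. v \<in> verts P \<Longrightarrow> N v = {0} \<or> N v = (UNIV :: complex set)"
  shows "dim_vector P N = subset_dim {v \<in> verts P. N v \<noteq> {0}}"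
proof -
  have "dim_vector P N = (\<Sum>v\<in>verts P. if N v \<noteq> {0} then Poly_Mapping.single v 1 else 0)"
    unfolding dim_vector_def
  proof (rule sum.cong[OF refl])
    fix v assume "v \<in> verts P"
    then consider "N v = {0}" | "N v = UNIV" "N v \<noteq> {0}" using assms(2)[of v]
      by (cases "N v = {0}") auto
    then show "Poly_Mapping.single v (int (vector_space_over_itself.dim (N v))) =
        (if N v \<noteq> {0} then Poly_Mapping.single v 1 else 0)"
      by cases (simp_all add: dim_complex_0 dim_complex_UNIV)
  qed
  also have "\<dots> = subset_dim {v \<in> verts P. N v \<noteq> {0}}"
    unfolding subset_dim_def using assms(1) by (simp add: sum.inter_filter)
  finally show ?thesis .
qed

lemma lookup_subset_dim: "finite C \<Longrightarrow> Poly_Mapping.lookup (subset_dim C) v = (if v \<in> C then 1 else 0)"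
  by (simp add: subset_dim_def lookup_sum lookup_single when_def)

lemma induced_stability_subset_dim:
  assumes "finite C"
  shows "induced_stability Z (subset_dim C) = (\<Sum>v\<in>C. Z (Poly_Mapping.single (fst v) 1))"
proof -
  have "Poly_Mapping.keys (subset_dim C) = C"
    using assms by (auto simp: in_keys_iff lookup_subset_dim split: if_splits)
  then show ?thesis unfolding induced_stability_def using assms by (simp add: lookup_subset_dim)
qed

text \<open>
  A subspace of a line is \<open>0\<close> or everything, so a subrepresentation is the choice of a set of
  vertices that is closed under the arrows in the support.
\<close>

lemma semistable_iff_closed_subsets:
  assumes P: "wf_digraph P" and fin: "finite (verts P)"
  shows "semistable P W x \<longleftrightarrow> (\<forall>C\<subseteq>verts P. C \<noteq> {} \<longrightarrow> C \<noteq> verts P \<longrightarrow>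
     (\<forall>a\<in>arcs P. x a \<noteq> 0 \<longrightarrow> tail P a \<in> C \<longrightarrow> head P a \<in> C) \<longrightarrow>
     slope W (subset_dim C) \<le> slope W (subset_dim (verts P)))"
proof -
  have U: "dim_vector P (\<lambda>_. UNIV :: complex set) = subset_dim (verts P)"
    by (subst dim_vector_eq[OF fin]) (simp_all add: UNIV_complex_not_0)
  have ht: "tail P a \<in> verts P" "head P a \<in> verts P" if "a \<in> arcs P" for a
    using P that by (auto simp: wf_digraph_def)
  show ?thesis
  proof (intro iffI allI impI)
    fix C assume ss: "semistable P W x" and C: "C \<subseteq> verts P" "C \<noteq> {}" "C \<noteq> verts P"
      "\<forall>a\<in>arcs P. x a \<noteq> 0 \<longrightarrow> tail P a \<in> C \<longrightarrow> head P a \<in> C"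
    define N :: "'a \<Rightarrow> complex set" where "N = (\<lambda>v. if v \<in> C then UNIV else {0})"
    have "subrep P x N"
      unfolding subrep_def using C(4) ht
      by (auto simp: subspace_complex_iff N_def)
    moreover have "\<exists>v\<in>verts P. N v \<noteq> {0}"
      using C(1,2) UNIV_complex_not_0 unfolding N_def by auto
    moreover have "\<exists>v\<in>verts P. N v \<noteq> UNIV"
      using C(1,3) UNIV_complex_not_0 unfolding N_def by auto
    ultimately have "slope W (dim_vector P N) \<le> slope W (subset_dim (verts P))"
      using ss unfolding semistable_def U by blast
    moreover have "dim_vector P N = subset_dim C"
    proof -
      have "{v \<in> verts P. N v \<noteq> {0}} = C"
        using C(1) UNIV_complex_not_0 unfolding N_def by auto
      moreover have "N v = {0} \<or> N v = UNIV" for v by (simp add: N_def)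
      ultimately show ?thesis using dim_vector_eq[OF fin, of N] by simp
    qed
    ultimately show "slope W (subset_dim C) \<le> slope W (subset_dim (verts P))" by simp
  next
    assume R: "\<forall>C\<subseteq>verts P. C \<noteq> {} \<longrightarrow> C \<noteq> verts P \<longrightarrow>
     (\<forall>a\<in>arcs P. x a \<noteq> 0 \<longrightarrow> tail P a \<in> C \<longrightarrow> head P a \<in> C) \<longrightarrow>
     slope W (subset_dim C) \<le> slope W (subset_dim (verts P))"
    show "semistable P W x" unfolding semistable_def U
    proof (intro allI impI)
      fix N assume N: "subrep P x N \<and> (\<exists>v\<in>verts P. N v \<noteq> {0}) \<and> (\<exists>v\<in>verts P. N v \<noteq> UNIV)"
      have sub: "N v = {0} \<or> N v = UNIV" if "v \<in> verts P" for v
        using N that by (auto simp: subrep_def subspace_complex_iff)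
      let ?C = "{v \<in> verts P. N v \<noteq> {0}}"
      have cl: "head P a \<in> ?C" if a: "a \<in> arcs P" "x a \<noteq> 0" "tail P a \<in> ?C" for a
      proof -
        have "1 \<in> N (tail P a)" using a(3) sub[of "tail P a"] by auto
        moreover have "\<forall>a\<in>arcs P. \<forall>z\<in>N (tail P a). x a * z \<in> N (head P a)"
          using N by (simp add: subrep_def)
        ultimately have "x a * 1 \<in> N (head P a)" using a(1) by (simp del: mult_1_right)
        then show ?thesis using a(2) ht[OF a(1)] by auto
      qed
      have ne: "?C \<noteq> {}" using N by blast
      have ne': "?C \<noteq> verts P"
      proof -
        obtain w where "w \<in> verts P" "N w \<noteq> UNIV" using N by blast
        with sub[of w] show ?thesis by blast
      qed
      have "?C \<subseteq> verts P" by blast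
      from R[THEN spec, THEN mp, THEN mp, THEN mp, OF this ne ne'] cl
      have "slope W (subset_dim ?C) \<le> slope W (subset_dim (verts P))" by simp
      then show "slope W (dim_vector P N) \<le> slope W (subset_dim (verts P))"
        using dim_vector_eq[OF fin sub] by simp
    qed
  qed
qed

section \<open>Vertex sets with prescribed dimension vectors\<close>

text \<open>
  The ends of an arrow of \<open>Q(\<alpha>)\<close>. They do not depend on \<open>\<alpha>\<close>, so all these quivers live on the single
  vertex set \<open>Q\<^sub>0 \<times> \<nat>\<close>, and vertex subsets of one \<open>Q(\<alpha>)\<close> can be compared with other \<open>Q(\<beta>)\<close>.
\<close>

definition arrow_tail :: "('v, 'e) pre_digraph \<Rightarrow> 'e \<times> nat \<times> nat \<Rightarrow> 'v \<times> nat" where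
  "arrow_tail Q = (\<lambda>(a, k, k'). (tail Q a, k))"

definition arrow_head :: "('v, 'e) pre_digraph \<Rightarrow> 'e \<times> nat \<times> nat \<Rightarrow> 'v \<times> nat" where
  "arrow_head Q = (\<lambda>(a, k, k'). (head Q a, k'))"

interpretation thickened: arrow_ends "arrow_tail Q" "arrow_head Q" for Q .

definition thick_arrows :: "('v, 'e) pre_digraph \<Rightarrow> ('e \<times> nat \<times> nat) set" where
  "thick_arrows Q = {(a, k, k'). a \<in> arcs Q}"

abbreviation arrows_between ::
    "('v, 'e) pre_digraph \<Rightarrow> ('v \<times> nat) set \<Rightarrow> ('v \<times> nat) set \<Rightarrow> ('e \<times> nat \<times> nat) set" where
  "arrows_between Q \<equiv> thickened.arrows_from Q (thick_arrows Q)"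

lemma in_arrows_between:
  "(a, k, k') \<in> arrows_between Q W U \<longleftrightarrow> a \<in> arcs Q \<and> (tail Q a, k) \<in> W \<and> (head Q a, k') \<in> U"
  unfolding thickened.arrows_from_def by (simp add: thick_arrows_def arrow_tail_def arrow_head_def)

text \<open>
  Up to the positive factor \<open>\<bar>u\<bar>\<close> the signed distance from the line through \<open>u\<close>.
\<close>

definition ray_weight :: "(('v \<Rightarrow>\<^sub>0 int) \<Rightarrow> complex) \<Rightarrow> complex \<Rightarrow> 'v \<times> nat \<Rightarrow> real" where
  "ray_weight Z u v = Im (Z (Poly_Mapping.single (fst v) 1) * cnj u)"

abbreviation layers :: "('v, 'e) pre_digraph \<Rightarrow> ('v \<Rightarrow>\<^sub>0 int) \<Rightarrow> ('v \<times> nat) set" where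
  "layers Q \<alpha> \<equiv> verts (abelian_quiver Q \<alpha>)"

definition layer_dim :: "('v \<times> nat) set \<Rightarrow> 'v \<Rightarrow>\<^sub>0 int" where
  "layer_dim W = (\<Sum>v\<in>W. Poly_Mapping.single (fst v) 1)"

lemma lookup_layer_dim: "finite W \<Longrightarrow> Poly_Mapping.lookup (layer_dim W) i = int (card {v \<in> W. fst v = i})"
proof -
  assume W: "finite W"
  have "Poly_Mapping.lookup (layer_dim W) i = (\<Sum>v\<in>W. if fst v = i then 1 else 0)"
    by (simp add: layer_dim_def lookup_sum lookup_single when_def eq_commute)
  also have "\<dots> = int (card {v \<in> W. fst v = i})" using W by (simp add: sum.If_cases Int_def)
  finally show ?thesis .
qed

lemma keys_layer_dim: "finite W \<Longrightarrow> Poly_Mapping.keys (layer_dim W) = fst ` W"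
  by (force simp: in_keys_iff lookup_layer_dim card_eq_0_iff)

lemma layer_dim_union:
  "finite W \<Longrightarrow> finite U \<Longrightarrow> W \<inter> U = {} \<Longrightarrow> layer_dim (W \<union> U) = layer_dim W + layer_dim U"
  by (simp add: layer_dim_def sum.union_disjoint)

lemma layer_dim_Gamma_plus: "finite W \<Longrightarrow> fst ` W \<subseteq> verts Q \<Longrightarrow> layer_dim W \<in> Gamma_plus Q"
  by (simp add: Gamma_plus_def Gamma_def keys_layer_dim lookup_layer_dim)

lemma height_layer_dim: "finite W \<Longrightarrow> height (layer_dim W) = int (card W)"
proof (induction W rule: finite_induct)
  case empty
  then show ?case by (simp add: layer_dim_def)
next
  case (insert v W)
  have "layer_dim (insert v W) = Poly_Mapping.single (fst v) 1 + layer_dim W"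
    using insert by (simp add: layer_dim_def)
  moreover have "height (Poly_Mapping.single (fst v) 1) = 1"
    by (simp add: height_def)
  ultimately show ?case using insert by (simp add: height_add)
qed

lemma finite_layers: "finite (layers Q \<alpha>)"
proof -
  have "layers Q \<alpha> \<subseteq> (SIGMA i:Poly_Mapping.keys \<alpha>. {..nat (Poly_Mapping.lookup \<alpha> i)})"
    by (auto simp: abelian_quiver_def in_keys_iff)
  moreover have "finite (SIGMA i:Poly_Mapping.keys \<alpha>. {..nat (Poly_Mapping.lookup \<alpha> i)})" by auto
  ultimately show ?thesis by (rule finite_subset)
qed

lemma layers_verts: "fst ` layers Q \<alpha> \<subseteq> verts Q"
  by (auto simp: abelian_quiver_def)

lemma card_layer:
  assumes "\<alpha> \<in> Gamma_plus Q"
  shows "int (card {v \<in> layers Q \<alpha>. fst v = i}) = Poly_Mapping.lookup \<alpha> i"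
proof (cases "i \<in> verts Q")
  case True
  have "{v \<in> layers Q \<alpha>. fst v = i} = (\<lambda>k. (i, k)) ` {1..nat (Poly_Mapping.lookup \<alpha> i)}"
    using True by (auto simp: abelian_quiver_def)
  then have "card {v \<in> layers Q \<alpha>. fst v = i} = nat (Poly_Mapping.lookup \<alpha> i)"
    by (simp add: card_image inj_on_def)
  then show ?thesis using assms by (simp add: Gamma_plus_def)
next
  case False
  then have "{v \<in> layers Q \<alpha>. fst v = i} = {}" by (auto simp: abelian_quiver_def)
  then have "card {v \<in> layers Q \<alpha>. fst v = i} = 0" by (simp only: card.empty)
  moreover have "i \<notin> Poly_Mapping.keys \<alpha>" using assms False by (auto simp: Gamma_plus_def Gamma_def)
  ultimately show ?thesis by (simp add: in_keys_iff)
qed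

lemma layer_dim_layers:
  assumes "\<alpha> \<in> Gamma_plus Q"
  shows "layer_dim (layers Q \<alpha>) = \<alpha>"
  by (rule poly_mapping_eqI) (simp add: lookup_layer_dim finite_layers card_layer[OF assms])

lemma finite_arrows_between:
  assumes Q: "quiver Q" and fin: "finite W" "finite U" and sub: "fst ` W \<subseteq> verts Q" "fst ` U \<subseteq> verts Q"
  shows "finite (arrows_between Q W U)"
proof -
  let ?A = "\<Union>i\<in>fst ` W. \<Union>j\<in>fst ` U. {a \<in> arcs Q. tail Q a = i \<and> head Q a = j}"
  have "finite ?A" using Q fin sub unfolding quiver_def by (intro finite_UN_I finite_imageI) auto
  moreover have "arrows_between Q W U \<subseteq> ?A \<times> (snd ` W \<times> snd ` U)"
  proof
    fix x assume x: "x \<in> arrows_between Q W U"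
    obtain a k k' where [simp]: "x = (a, k, k')" by (cases x)
    show "x \<in> ?A \<times> (snd ` W \<times> snd ` U)" using x by (force simp: in_arrows_between)
  qed
  ultimately show ?thesis using fin by (meson finite_SigmaI finite_imageI finite_subset)
qed

lemma arrow_form_layer_dim:
  assumes Q: "quiver Q" and fin: "finite W" "finite U" and sub: "fst ` W \<subseteq> verts Q" "fst ` U \<subseteq> verts Q"
  shows "arrow_form Q (layer_dim W) (layer_dim U) = int (card (arrows_between Q W U))"
proof -
  let ?A = "{a \<in> arcs Q. tail Q a \<in> fst ` W \<and> head Q a \<in> fst ` U}"
  have eq: "?A = (\<Union>i\<in>fst ` W. \<Union>j\<in>fst ` U. {a \<in> arcs Q. tail Q a = i \<and> head Q a = j})" by auto
  have finA: "finite ?A"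
    unfolding eq using Q fin sub unfolding quiver_def by (intro finite_UN_I finite_imageI) auto
  let ?B = "\<lambda>a. {v \<in> W. fst v = tail Q a} \<times> {v \<in> U. fst v = head Q a}"
  have "arrow_form Q (layer_dim W) (layer_dim U) =
      (\<Sum>a\<in>?A. int (card {v \<in> W. fst v = tail Q a}) * int (card {v \<in> U. fst v = head Q a}))"
    unfolding arrow_form_def using fin by (simp add: keys_layer_dim lookup_layer_dim)
  also have "\<dots> = int (card (Sigma ?A ?B))"
    using finA fin by (simp add: card_cartesian_product)
  also have "card (Sigma ?A ?B) = card (arrows_between Q W U)"
  proof (rule bij_betw_same_card[of "\<lambda>(a, v, w). (a, snd v, snd w)"], rule bij_betwI[where
        g = "\<lambda>(a, k, k'). (a, (tail Q a, k), (head Q a, k'))"])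
    show "(\<lambda>(a, v, w). (a, snd v, snd w)) \<in> Sigma ?A ?B \<rightarrow> arrows_between Q W U"
      by (force simp: in_arrows_between)
    show "(\<lambda>(a, k, k'). (a, (tail Q a, k), (head Q a, k'))) \<in> arrows_between Q W U \<rightarrow> Sigma ?A ?B"
      by (force simp: in_arrows_between)
  qed auto
  finally show ?thesis .
qed

text \<open>
  The normalisation of \<open>f\<^sub>Z\<close>, for an arbitrary finite set of vertices.
\<close>

definition weighted_sum :: "('v, 'e) pre_digraph \<Rightarrow> ('v \<times> nat) set \<Rightarrow> rat_fun \<Rightarrow> rat_fun" where
  "weighted_sum Q W s =
     q_half powi (int (card W) - int (card (arrows_between Q W W))) / (q_half\<^sup>2 - 1) ^ card W * s"

definition ray_count :: "('v, 'e) pre_digraph \<Rightarrow> (('v \<Rightarrow>\<^sub>0 int) \<Rightarrow> complex) \<Rightarrow> complex \<Rightarrow> ('v \<times> nat) set \<Rightarrow> rat_fun" where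
  "ray_count Q Z u W = weighted_sum Q W
     (thickened.semistable_sum Q (q_half\<^sup>2 - 1) (thick_arrows Q) (ray_weight Z u) W)"

definition pointed_count ::
    "('v, 'e) pre_digraph \<Rightarrow> (('v \<Rightarrow>\<^sub>0 int) \<Rightarrow> complex) \<Rightarrow> complex \<Rightarrow> 'v \<times> nat \<Rightarrow> ('v \<times> nat) set \<Rightarrow> rat_fun" where
  "pointed_count Q Z u v W = weighted_sum Q W
     (thickened.pointed_sum Q (q_half\<^sup>2 - 1) (thick_arrows Q) (ray_weight Z u) v W)"

context
  fixes Q :: "('v, 'e) pre_digraph" and Z :: "('v \<Rightarrow>\<^sub>0 int) \<Rightarrow> complex" and u :: complex and l :: "complex set"
  assumes Q: "quiver Q" and Z: "stability_function Q Z"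
    and u: "u \<in> upper_half" and l: "l = {of_real r * u | r. r > 0}"
begin

lemma Z_layer_dim:
  assumes "finite W" "fst ` W \<subseteq> verts Q"
  shows "Z (layer_dim W) = (\<Sum>v\<in>W. Z (Poly_Mapping.single (fst v) 1))"
proof -
  have add: "Z (\<alpha> + \<beta>) = Z \<alpha> + Z \<beta>" if "\<alpha> \<in> Gamma Q" "\<beta> \<in> Gamma Q" for \<alpha> \<beta>
    using Z that by (auto simp: stability_function_def)
  have Z0: "Z 0 = 0" using add[of 0 0] by (simp add: Gamma_def)
  show ?thesis using assms
  proof (induction W rule: finite_induct)
    case (insert v W)
    have "layer_dim (insert v W) = Poly_Mapping.single (fst v) 1 + layer_dim W"
      using insert.hyps by (simp add: layer_dim_def)
    moreover have "Poly_Mapping.single (fst v) 1 \<in> Gamma Q" "layer_dim W \<in> Gamma Q"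
      using insert.prems insert.hyps layer_dim_Gamma_plus[of W Q] by (auto simp: Gamma_def Gamma_plus_def)
    ultimately show ?case using insert add by simp
  qed (simp add: layer_dim_def Z0)
qed

lemma Z_layer_dim_upper_half:
  assumes "finite W" "fst ` W \<subseteq> verts Q" "W \<noteq> {}"
  shows "(\<Sum>v\<in>W. Z (Poly_Mapping.single (fst v) 1)) \<in> upper_half"
  using assms Z by (intro upper_half_sum) (auto simp: stability_function_def)

lemma on_ray_iff_weight:
  assumes "finite W" "fst ` W \<subseteq> verts Q" "W \<noteq> {}"
  shows "Z (layer_dim W) \<in> l \<longleftrightarrow> sum (ray_weight Z u) W = 0"
proof -
  have "Z (layer_dim W) \<in> l \<longleftrightarrow> Im (Z (layer_dim W) * cnj u) = 0"
    unfolding l using Z_layer_dim_upper_half[OF assms] Z_layer_dim[OF assms(1,2)] u by (intro on_ray_iff) simp_all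
  also have "Im (Z (layer_dim W) * cnj u) = sum (ray_weight Z u) W"
    unfolding Z_layer_dim[OF assms(1,2)] ray_weight_def[abs_def] by (simp only: sum_distrib_right Im_sum)
  finally show ?thesis .
qed

lemma wf_abelian_quiver: "wf_digraph (abelian_quiver Q \<alpha>)"
  using Q by (auto simp: wf_digraph_def quiver_def abelian_quiver_def)

lemma arcs_abelian_quiver: "arcs (abelian_quiver Q \<alpha>) = arrows_between Q (layers Q \<alpha>) (layers Q \<alpha>)"
proof (rule set_eqI)
  fix x :: "'e \<times> nat \<times> nat"
  obtain a k k' where [simp]: "x = (a, k, k')" by (cases x)
  show "x \<in> arcs (abelian_quiver Q \<alpha>) \<longleftrightarrow> x \<in> arrows_between Q (layers Q \<alpha>) (layers Q \<alpha>)"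
    using Q by (auto simp: in_arrows_between quiver_def wf_digraph_def abelian_quiver_def)
qed

lemma ends_abelian_quiver: "tail (abelian_quiver Q \<alpha>) = arrow_tail Q" "head (abelian_quiver Q \<alpha>) = arrow_head Q"
  by (auto simp: abelian_quiver_def arrow_tail_def arrow_head_def)

lemma slope_subset_le_iff:
  assumes V: "finite V" "fst ` V \<subseteq> verts Q" and ray: "Z (layer_dim V) \<in> l" "V \<noteq> {}" and C: "C \<subseteq> V" "C \<noteq> {}"
  shows "slope (induced_stability Z) (subset_dim C) \<le> slope (induced_stability Z) (subset_dim V) \<longleftrightarrow>
    sum (ray_weight Z u) C \<le> 0"
proof -
  have finC: "finite C" and subC: "fst ` C \<subseteq> verts Q" using V C finite_subset by auto
  let ?z = "\<Sum>v\<in>C. Z (Poly_Mapping.single (fst v) 1)" and ?w = "\<Sum>v\<in>V. Z (Poly_Mapping.single (fst v) 1)"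
  have z: "?z \<in> upper_half" and w: "?w \<in> upper_half"
    using Z_layer_dim_upper_half V finC subC C ray by auto
  obtain r where r: "r > 0" "?w = of_real r * u" using ray V unfolding l by (auto simp: Z_layer_dim)
  have "slope (induced_stability Z) (subset_dim C) \<le> slope (induced_stability Z) (subset_dim V) \<longleftrightarrow>
      Im (?z * cnj ?w) \<le> 0"
    unfolding slope_def induced_stability_subset_dim[OF finC] induced_stability_subset_dim[OF V(1)]
    by (rule slope_le_iff[OF z w])
  also have "Im (?z * cnj ?w) = r * Im (?z * cnj u)" unfolding r(2) by (simp add: algebra_simps)
  also have "Im (?z * cnj u) = sum (ray_weight Z u) C"
    unfolding ray_weight_def[abs_def] by (simp only: sum_distrib_right Im_sum)
  finally show ?thesis using r(1) by (simp add: mult_le_0_iff)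
qed

text \<open>
  The semistable locus consists of the representations whose support is semistable for the weight;
  this family is closed under enlargement, since more arrows leave fewer closed sets.
\<close>

lemma f_inv_eq_ray_count:
  assumes "\<alpha> \<in> Gamma_plus Q" "\<alpha> \<noteq> 0" "Z \<alpha> \<in> l"
  shows "f_inv Q Z \<alpha> = of_rat_fun (ray_count Q Z u (layers Q \<alpha>))"
proof -
  let ?V = "layers Q \<alpha>" and ?A = "arrows_between Q (layers Q \<alpha>) (layers Q \<alpha>)"
  note dim = layer_dim_layers[OF assms(1)]
  have V: "finite ?V" "fst ` ?V \<subseteq> verts Q" by (rule finite_layers, rule layers_verts)
  have ne: "?V \<noteq> {}" using assms(2) dim by (auto simp: layer_dim_def)
  have finA: "finite ?A" by (rule finite_arrows_between[OF Q V(1) V(1) V(2) V(2)])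
  have ray: "Z (layer_dim ?V) \<in> l" using assms(3) dim by simp
  then have V0: "sum (ray_weight Z u) ?V = 0" using on_ray_iff_weight[OF V ne] by simp
  let ?ss = "thickened.semistable_support Q (ray_weight Z u) ?V"
  have ss: "semistable (abelian_quiver Q \<alpha>) (induced_stability Z) x \<longleftrightarrow> ?ss {a \<in> ?A. x a \<noteq> 0}" for x
  proof -
    have cl: "thickened.closed_under Q {a \<in> ?A. x a \<noteq> 0} C \<longleftrightarrow>
        (\<forall>a\<in>?A. x a \<noteq> 0 \<longrightarrow> arrow_tail Q a \<in> C \<longrightarrow> arrow_head Q a \<in> C)" for C
      unfolding thickened.closed_under_def by blast
    have "semistable (abelian_quiver Q \<alpha>) (induced_stability Z) x \<longleftrightarrow>
        (\<forall>C\<subseteq>?V. C \<noteq> {} \<longrightarrow> C \<noteq> ?V \<longrightarrow> thickened.closed_under Q {a \<in> ?A. x a \<noteq> 0} C \<longrightarrow>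
          slope (induced_stability Z) (subset_dim C) \<le> slope (induced_stability Z) (subset_dim ?V))"
      unfolding semistable_iff_closed_subsets[OF wf_abelian_quiver finite_layers] arcs_abelian_quiver ends_abelian_quiver cl
      by (rule refl)
    also have "\<dots> \<longleftrightarrow> (\<forall>C\<subseteq>?V. thickened.closed_under Q {a \<in> ?A. x a \<noteq> 0} C \<longrightarrow> sum (ray_weight Z u) C \<le> 0)"
    proof -
      have "(C \<noteq> {} \<longrightarrow> C \<noteq> ?V \<longrightarrow> thickened.closed_under Q {a \<in> ?A. x a \<noteq> 0} C \<longrightarrow>
          slope (induced_stability Z) (subset_dim C) \<le> slope (induced_stability Z) (subset_dim ?V)) \<longleftrightarrow>
          (thickened.closed_under Q {a \<in> ?A. x a \<noteq> 0} C \<longrightarrow> sum (ray_weight Z u) C \<le> 0)" if C: "C \<subseteq> ?V" for C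
        using slope_subset_le_iff[OF V ray ne C] V0 by (cases "C = {}"; cases "C = ?V") simp_all
      then show ?thesis by auto
    qed
    finally show ?thesis using V0 by (simp add: thickened.semistable_support_def)
  qed
  have "motivic_class (semistable_locus (abelian_quiver Q \<alpha>) (induced_stability Z)) =
      motivic_class (induced (affine_space ?A) {x \<in> ?A \<rightarrow>\<^sub>E UNIV. {a \<in> ?A. x a \<noteq> 0} \<in> Collect ?ss})"
    unfolding semistable_locus_def arcs_abelian_quiver ss by simp
  also have "\<dots> = of_rat_fun (\<Sum>S | S \<in> Collect ?ss \<and> S \<subseteq> ?A. (q_half\<^sup>2 - 1) ^ card S)"
    by (rule motivic_class_support_locus[OF finA]) (auto intro: thickened.semistable_support_mono)
  also have "(\<Sum>S | S \<in> Collect ?ss \<and> S \<subseteq> ?A. (q_half\<^sup>2 - 1) ^ card S) =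
      thickened.semistable_sum Q (q_half\<^sup>2 - 1) (thick_arrows Q) (ray_weight Z u) ?V"
    unfolding thickened.semistable_sum_def by (rule sum.cong) auto
  finally have M: "motivic_class (semistable_locus (abelian_quiver Q \<alpha>) (induced_stability Z)) =
    of_rat_fun (thickened.semistable_sum Q (q_half\<^sup>2 - 1) (thick_arrows Q) (ray_weight Z u) ?V)" .
  have h: "height \<alpha> = int (card ?V)" using height_layer_dim[OF V(1)] dim by simp
  have a: "arrow_form Q \<alpha> \<alpha> = int (card ?A)"
    using arrow_form_layer_dim[OF Q V(1) V(1) V(2) V(2)] dim by simp
  show ?thesis
    unfolding f_inv_def M of_rat_fun_mult ray_count_def weighted_sum_def h a by (simp add: power_int_of_nat)
qed

end

section \<open>The Euler derivation of the exponential formula\<close>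

definition splits :: "('v, 'e) pre_digraph \<Rightarrow> ('v \<Rightarrow>\<^sub>0 int) \<Rightarrow> (('v \<Rightarrow>\<^sub>0 int) \<times> ('v \<Rightarrow>\<^sub>0 int)) set" where
  "splits Q \<alpha> = {(\<beta>, \<gamma>). \<beta> \<in> Gamma_plus Q \<and> \<gamma> \<in> Gamma_plus Q \<and> \<beta> + \<gamma> = \<alpha>}"

lemma finite_splits_set: "finite (splits Q \<alpha>)"
  unfolding splits_def by (rule finite_splits)

lemma mps_mult_splits: "mps_mult Q A B \<alpha> = (\<Sum>(\<beta>, \<gamma>)\<in>splits Q \<alpha>. A \<beta> * B \<gamma>)"
  by (simp add: mps_mult_def splits_def)

text \<open>
  Both sides are sums over decompositions of \<open>\<alpha>\<close> into three summands.
\<close>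

lemma mps_mult_left_commute: "mps_mult Q A (mps_mult Q B C) \<alpha> = mps_mult Q B (mps_mult Q A C) \<alpha>"
proof -
  let ?T = "SIGMA (\<beta>, \<gamma>):splits Q \<alpha>. splits Q \<gamma>"
  have eq: "mps_mult Q A (mps_mult Q B C) \<alpha> = (\<Sum>((\<beta>, \<gamma>), (\<delta>, \<epsilon>))\<in>?T. A \<beta> * (B \<delta> * C \<epsilon>))"
    for A B C :: "'a mps"
    unfolding mps_mult_splits sum_distrib_left case_prod_unfold
    by (subst sum.Sigma) (simp_all add: finite_splits_set case_prod_unfold)
  have "(\<Sum>((\<beta>, \<gamma>), (\<delta>, \<epsilon>))\<in>?T. A \<beta> * (B \<delta> * C \<epsilon>)) = (\<Sum>((\<beta>, \<gamma>), (\<delta>, \<epsilon>))\<in>?T. B \<beta> * (A \<delta> * C \<epsilon>))"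
    by (rule sum.reindex_bij_witness[where
          i = "\<lambda>((\<beta>, \<gamma>), (\<delta>, \<epsilon>)). ((\<delta>, \<beta> + \<epsilon>), (\<beta>, \<epsilon>))" and
          j = "\<lambda>((\<beta>, \<gamma>), (\<delta>, \<epsilon>)). ((\<delta>, \<beta> + \<epsilon>), (\<beta>, \<epsilon>))"])
       (auto simp: splits_def Gamma_plus_add add_ac mult.left_commute)
  then show ?thesis unfolding eq .
qed

lemma mps_power_large:
  assumes "A 0 = 0"
  shows "\<alpha> \<in> Gamma_plus Q \<Longrightarrow> height \<alpha> < int n \<Longrightarrow> mps_power Q A n \<alpha> = 0"
proof (induction n arbitrary: \<alpha>)
  case 0
  then show ?case using height_pos[of \<alpha> Q] by (cases "\<alpha> = 0") auto
next
  case (Suc n)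
  have "A \<beta> * mps_power Q A n \<gamma> = 0" if s: "(\<beta>, \<gamma>) \<in> splits Q \<alpha>" for \<beta> \<gamma>
  proof (cases "\<beta> = 0")
    case False
    then have "height \<gamma> < height \<alpha>"
      using s height_pos[of \<beta> Q] height_add[of \<beta> \<gamma>] by (auto simp: splits_def)
    then show ?thesis using Suc s by (simp add: splits_def)
  qed (simp add: assms)
  then show ?case by (auto simp: mps_mult_splits intro!: sum.neutral)
qed

text \<open>
  The derivation \<open>x\<^sub>i \<partial>/\<partial>x\<^sub>i\<close>.
\<close>

definition euler :: "'v \<Rightarrow> 'v mps \<Rightarrow> 'v mps" where
  "euler i A \<alpha> = of_rat_fun (of_int (Poly_Mapping.lookup \<alpha> i)) * A \<alpha>"

lemma euler_mps_mult:
  "euler i (mps_mult Q A B) \<alpha> = mps_mult Q (euler i A) B \<alpha> + mps_mult Q A (euler i B) \<alpha>"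
proof -
  have "of_rat_fun (of_int (Poly_Mapping.lookup \<alpha> i)) * (A \<beta> * B \<gamma>) =
      euler i A \<beta> * B \<gamma> + A \<beta> * euler i B \<gamma>" if "(\<beta>, \<gamma>) \<in> splits Q \<alpha>" for \<beta> \<gamma>
  proof -
    have "\<alpha> = \<beta> + \<gamma>" using that by (auto simp: splits_def)
    then show ?thesis by (simp add: euler_def lookup_add of_rat_fun_add algebra_simps)
  qed
  then show ?thesis
    unfolding euler_def[of i "mps_mult Q A B"] mps_mult_splits sum_distrib_left sum.distrib[symmetric]
    by (intro sum.cong) auto
qed

lemma mps_mult_cong:
  "(\<And>\<gamma>. \<gamma> \<in> Gamma_plus Q \<Longrightarrow> B \<gamma> = C \<gamma>) \<Longrightarrow> mps_mult Q A B \<alpha> = mps_mult Q A C \<alpha>"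
  unfolding mps_mult_splits by (intro sum.cong) (auto simp: splits_def)

lemma mps_mult_scale: "mps_mult Q A (\<lambda>\<gamma>. c * B \<gamma>) \<alpha> = c * mps_mult Q A B \<alpha>"
  unfolding mps_mult_splits sum_distrib_left by (intro sum.cong) (auto simp: mult_ac)

lemma euler_mps_power:
  "euler i (mps_power Q A (Suc n)) \<alpha> = of_rat_fun (of_nat (Suc n)) * mps_mult Q (euler i A) (mps_power Q A n) \<alpha>"
proof (induction n arbitrary: \<alpha>)
  case 0
  have "euler i mps_one = (\<lambda>_. 0)"
    by (rule ext) (simp add: euler_def mps_one_def)
  then show ?case by (simp add: euler_mps_mult of_rat_fun_1) (simp add: mps_mult_splits case_prod_unfold)
next
  case (Suc n)
  have IH: "euler i (mps_power Q A (Suc n)) = (\<lambda>\<gamma>. of_rat_fun (of_nat (Suc n)) * mps_mult Q (euler i A) (mps_power Q A n) \<gamma>)"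
    by (rule ext) (rule Suc.IH)
  have "euler i (mps_power Q A (Suc (Suc n))) \<alpha> = mps_mult Q (euler i A) (mps_power Q A (Suc n)) \<alpha> +
      of_rat_fun (of_nat (Suc n)) * mps_mult Q A (mps_mult Q (euler i A) (mps_power Q A n)) \<alpha>"
    unfolding mps_power.simps(2)[of Q A "Suc n"] euler_mps_mult IH mps_mult_scale ..
  also have "mps_mult Q A (mps_mult Q (euler i A) (mps_power Q A n)) \<alpha> =
      mps_mult Q (euler i A) (mps_power Q A (Suc n)) \<alpha>"
    unfolding mps_mult_left_commute[of Q A] mps_power.simps ..
  also have "mps_mult Q (euler i A) (mps_power Q A (Suc n)) \<alpha> +
      of_rat_fun (of_nat (Suc n)) * mps_mult Q (euler i A) (mps_power Q A (Suc n)) \<alpha> =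
      of_rat_fun (of_nat (Suc (Suc n))) * mps_mult Q (euler i A) (mps_power Q A (Suc n)) \<alpha>"
    unfolding of_nat_Suc[of "Suc n"] of_rat_fun_add of_rat_fun_1 by (simp only: distrib_right mult_1_left)
  finally show ?case .
qed

text \<open>
  Derivative of the exponential. The partial sums that define its coefficients can be extended, as
  high powers of a series without constant term have no coefficient at \<open>\<alpha>\<close>.
\<close>

lemma euler_mps_exp:
  assumes A: "A 0 = 0" and \<alpha>: "\<alpha> \<in> Gamma_plus Q"
  shows "euler i (mps_exp Q A) \<alpha> = mps_mult Q (euler i A) (mps_exp Q A) \<alpha>"
proof -
  let ?N = "nat (height \<alpha>)"
  let ?c = "\<lambda>n. of_rat_fun (1 / fact n)"
  have nonneg: "height \<gamma> \<ge> 0" if "\<gamma> \<in> Gamma_plus Q" for \<gamma>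
    using height_pos[OF that] by (cases "\<gamma> = 0") auto
  have exp: "mps_exp Q A \<gamma> = (\<Sum>n\<le>M. ?c n * mps_power Q A n \<gamma>)"
    if \<gamma>: "\<gamma> \<in> Gamma_plus Q" and M: "nat (height \<gamma>) \<le> M" for \<gamma> M
    unfolding mps_exp_def
  proof (rule sum.mono_neutral_left)
    show "\<forall>n\<in>{..M} - {..nat (height \<gamma>)}. ?c n * mps_power Q A n \<gamma> = 0"
    proof
      fix n assume "n \<in> {..M} - {..nat (height \<gamma>)}"
      then have "height \<gamma> < int n" by auto
      from mps_power_large[of A, OF A \<gamma> this] show "?c n * mps_power Q A n \<gamma> = 0" by simp
    qed
  qed (use M in auto)
  \<comment> \<open>\<open>D A\<^sup>n\<^sup>+\<^sup>1 / (n + 1)! = (D A) A\<^sup>n / n!\<close>\<close>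
  have step: "?c (Suc n) * euler i (mps_power Q A (Suc n)) \<alpha> = ?c n * mps_mult Q (euler i A) (mps_power Q A n) \<alpha>" for n
  proof -
    have nz: "(of_nat (Suc n) :: rat_fun) \<noteq> 0"
      by (rule of_nat_neq_0)
    have "(1 / fact (Suc n)) * of_nat (Suc n) = (1 / fact n :: rat_fun)"
      using nz unfolding fact_Suc by (metis nonzero_divide_mult_cancel_left times_divide_eq_left mult_1_left)
    then have "?c (Suc n) * of_rat_fun (of_nat (Suc n)) = ?c n"
      by (simp only: of_rat_fun_mult)
    then show ?thesis unfolding euler_mps_power by (simp only: mult.assoc[symmetric])
  qed
  \<comment> \<open>One more term than in the definition, to be lost again when the index is shifted.\<close>
  have "euler i (mps_exp Q A) \<alpha> = (\<Sum>n\<le>Suc ?N. ?c n * euler i (mps_power Q A n) \<alpha>)"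
    unfolding euler_def exp[OF \<alpha> le_SucI[OF order_refl]] sum_distrib_left by (simp only: mult.left_commute)
  also have "\<dots> = ?c 0 * euler i (mps_power Q A 0) \<alpha> + (\<Sum>n\<le>?N. ?c (Suc n) * euler i (mps_power Q A (Suc n)) \<alpha>)"
    by (rule sum.atMost_Suc_shift)
  also have "euler i (mps_power Q A 0) \<alpha> = 0" by (simp add: euler_def mps_one_def)
  also have "(\<Sum>n\<le>?N. ?c (Suc n) * euler i (mps_power Q A (Suc n)) \<alpha>) =
      (\<Sum>n\<le>?N. mps_mult Q (euler i A) (\<lambda>\<gamma>. ?c n * mps_power Q A n \<gamma>) \<alpha>)"
    unfolding step mps_mult_scale ..
  also have "\<dots> = mps_mult Q (euler i A) (\<lambda>\<gamma>. \<Sum>n\<le>?N. ?c n * mps_power Q A n \<gamma>) \<alpha>"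
    unfolding mps_mult_splits case_prod_unfold sum_distrib_left by (rule sum.swap)
  also have "\<dots> = mps_mult Q (euler i A) (mps_exp Q A) \<alpha>"
    unfolding mps_mult_splits
  proof (rule sum.cong[OF refl], clarify)
    fix \<beta> \<gamma> assume s: "(\<beta>, \<gamma>) \<in> splits Q \<alpha>"
    then have \<gamma>: "\<gamma> \<in> Gamma_plus Q" and "height \<gamma> \<le> height \<alpha>"
      using nonneg[of \<beta>] height_add[of \<beta> \<gamma>] by (auto simp: splits_def)
    then show "euler i A \<beta> * (\<Sum>n\<le>?N. ?c n * mps_power Q A n \<gamma>) = euler i A \<beta> * mps_exp Q A \<gamma>"
      by (simp only: exp[OF \<gamma> nat_mono])
  qed
  finally show ?thesis by simp
qed

section \<open>Counting vertex subsets by dimension vector\<close>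

lemma multi_fact_superset:
  assumes "finite A" "Poly_Mapping.keys \<beta> \<subseteq> A"
  shows "multi_fact \<beta> = (\<Prod>i\<in>A. fact (nat (Poly_Mapping.lookup \<beta> i)))"
  unfolding multi_fact_def using assms by (intro prod.mono_neutral_left) (auto simp: in_keys_iff)

lemma multi_fact_add_single:
  assumes "\<And>i. Poly_Mapping.lookup \<beta> i \<ge> 0"
  shows "multi_fact (\<beta> + Poly_Mapping.single j 1) = nat (Poly_Mapping.lookup \<beta> j + 1) * multi_fact \<beta>"
proof -
  let ?A = "insert j (Poly_Mapping.keys \<beta>)"
  have sub: "Poly_Mapping.keys (\<beta> + Poly_Mapping.single j 1) \<subseteq> ?A"
    using Poly_Mapping.keys_add[of \<beta> "Poly_Mapping.single j (1::int)"] by auto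
  have "multi_fact (\<beta> + Poly_Mapping.single j 1) =
      (\<Prod>i\<in>?A. fact (nat (Poly_Mapping.lookup (\<beta> + Poly_Mapping.single j 1) i)))"
    by (rule multi_fact_superset) (use sub in auto)
  also have "\<dots> = (\<Prod>i\<in>?A. (if i = j then nat (Poly_Mapping.lookup \<beta> j + 1) else 1) * fact (nat (Poly_Mapping.lookup \<beta> i)))"
  proof (rule prod.cong[OF refl])
    fix i
    show "fact (nat (Poly_Mapping.lookup (\<beta> + Poly_Mapping.single j 1) i)) =
        (if i = j then nat (Poly_Mapping.lookup \<beta> j + 1) else 1) * fact (nat (Poly_Mapping.lookup \<beta> i))"
      using assms[of j] by (auto simp: lookup_add lookup_single nat_add_distrib)
  qed
  also have "\<dots> = nat (Poly_Mapping.lookup \<beta> j + 1) * multi_fact \<beta>"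
    by (simp add: prod.distrib multi_fact_superset[of ?A \<beta>] subset_insertI)
  finally show ?thesis .
qed

text \<open>
  The number is a product of binomial coefficients, one for every vertex of \<open>Q\<close>. A new vertex over
  \<open>j\<close> multiplies the right-hand side by its multiplicity \<open>\<beta>\<^sub>j + \<gamma>\<^sub>j\<close>; the subsets without the new
  vertex account for the summand \<open>\<gamma>\<^sub>j\<close>, those with it for \<open>\<beta>\<^sub>j\<close>.
\<close>

lemma count_subsets_of_dim:
  fixes U :: "('v \<times> nat) set"
  assumes "finite U" "layer_dim U = \<beta> + \<gamma>"
    and "\<And>i. Poly_Mapping.lookup \<beta> i \<ge> 0" "\<And>i. Poly_Mapping.lookup \<gamma> i \<ge> 0"
  shows "card {W. W \<subseteq> U \<and> layer_dim W = \<beta>} * multi_fact \<beta> * multi_fact \<gamma> = multi_fact (layer_dim U)"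
  using assms
proof (induction U arbitrary: \<beta> \<gamma> rule: finite_induct)
  case empty
  have "Poly_Mapping.lookup \<beta> i = 0 \<and> Poly_Mapping.lookup \<gamma> i = 0" for i
  proof -
    have "Poly_Mapping.lookup (\<beta> + \<gamma>) i = 0" using empty.prems(1)[symmetric] by (simp add: layer_dim_def)
    then show ?thesis using empty.prems(2,3)[of i] by (simp add: lookup_add)
  qed
  then have "\<beta> = 0" "\<gamma> = 0" by (auto intro: poly_mapping_eqI)
  moreover have "{W. W \<subseteq> {} \<and> layer_dim W = 0} = {{} :: ('v \<times> nat) set}" by (auto simp: layer_dim_def)
  ultimately show ?case by (simp add: layer_dim_def multi_fact_def)
next
  case (insert w U)
  let ?e = "Poly_Mapping.single (fst w) (1::int)"
  let ?l = "Poly_Mapping.lookup"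
  have dimU: "layer_dim (insert w U) = layer_dim U + ?e"
    using insert.hyps by (simp add: layer_dim_def add.commute)
  have eq: "layer_dim U + ?e = \<beta> + \<gamma>" using insert.prems(1) dimU by simp
  have lk: "?l (layer_dim U) i + ?l ?e i = ?l \<beta> i + ?l \<gamma> i" for i
    using arg_cong[OF eq, of "\<lambda>x. ?l x i"] by (simp only: lookup_add)
  have le: "?l (layer_dim W) i \<le> ?l (layer_dim U) i" if "W \<subseteq> U" for W i
  proof -
    have "finite W" using that insert.hyps finite_subset by auto
    moreover have "{v \<in> W. fst v = i} \<subseteq> {v \<in> U. fst v = i}" using that by auto
    ultimately show ?thesis using insert.hyps by (simp add: lookup_layer_dim card_mono)
  qed
  let ?P1 = "{W. W \<subseteq> U \<and> layer_dim W = \<beta>}" and ?P2 = "{W. W \<subseteq> U \<and> layer_dim W + ?e = \<beta>}"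
  have fin: "finite ?P1" "finite ?P2" using insert.hyps by auto
  have dimW: "layer_dim (insert w W) = layer_dim W + ?e" if "W \<subseteq> U" for W
  proof -
    have "finite W" "w \<notin> W" using that insert.hyps finite_subset by auto
    then show ?thesis by (simp add: layer_dim_def add.commute)
  qed
  have split: "{W. W \<subseteq> insert w U \<and> layer_dim W = \<beta>} = ?P1 \<union> insert w ` ?P2"
  proof (intro equalityI subsetI)
    fix W assume W: "W \<in> {W. W \<subseteq> insert w U \<and> layer_dim W = \<beta>}"
    show "W \<in> ?P1 \<union> insert w ` ?P2"
    proof (cases "w \<in> W")
      case True
      then have W': "W = insert w (W - {w})" "W - {w} \<subseteq> U" using W by auto
      then have "W - {w} \<in> ?P2" using dimW[OF W'(2)] W by auto
      then show ?thesis using W'(1) by blast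
    qed (use W in auto)
  qed (use dimW in auto)
  have inj: "inj_on (insert w) ?P2" using insert.hyps by (auto simp: inj_on_def)
  have "card {W. W \<subseteq> insert w U \<and> layer_dim W = \<beta>} = card ?P1 + card ?P2"
    unfolding split using fin insert.hyps by (subst card_Un_disjoint) (auto simp: card_image[OF inj])
  moreover have "card ?P1 * multi_fact \<beta> * multi_fact \<gamma> = nat (?l \<gamma> (fst w)) * multi_fact (layer_dim U)"
  proof (cases "?l \<gamma> (fst w) = 0")
    case True
    have "\<not> (W \<subseteq> U \<and> layer_dim W = \<beta>)" for W
      using le[of W "fst w"] lk[of "fst w"] True by (auto simp: lookup_single)
    then have "?P1 = {}" by blast
    then have "card ?P1 = 0" by (simp only: card.empty)
    then show ?thesis using True by simp
  next
    case False
    define \<gamma>' where "\<gamma>' = \<gamma> - ?e"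
    have \<gamma>: "\<gamma> = \<gamma>' + ?e" by (simp add: \<gamma>'_def)
    have nn: "?l \<gamma>' i \<ge> 0" for i
      using insert.prems(3)[of i] insert.prems(3)[of "fst w"] False
      by (auto simp: \<gamma>'_def lookup_minus lookup_single when_def)
    have "layer_dim U = \<beta> + \<gamma>'" using eq unfolding \<gamma> by (simp add: add.assoc[symmetric])
    from insert.IH[OF this insert.prems(2) nn]
    have IH: "card ?P1 * multi_fact \<beta> * multi_fact \<gamma>' = multi_fact (layer_dim U)" .
    have "multi_fact \<gamma> = nat (?l \<gamma> (fst w)) * multi_fact \<gamma>'"
      unfolding \<gamma> multi_fact_add_single[OF nn] by (simp add: lookup_add)
    then show ?thesis using IH by (simp add: mult_ac)
  qed
  moreover have "card ?P2 * multi_fact \<beta> * multi_fact \<gamma> = nat (?l \<beta> (fst w)) * multi_fact (layer_dim U)"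
  proof (cases "?l \<beta> (fst w) = 0")
    case True
    have "\<not> (W \<subseteq> U \<and> layer_dim W + ?e = \<beta>)" for W
    proof
      assume W: "W \<subseteq> U \<and> layer_dim W + ?e = \<beta>"
      then have "finite W" using insert.hyps finite_subset by auto
      moreover have "?l (layer_dim W) (fst w) + 1 = 0" using W True by (auto simp: lookup_add)
      ultimately show False by (simp add: lookup_layer_dim)
    qed
    then have "?P2 = {}" by blast
    then have "card ?P2 = 0" by (simp only: card.empty)
    then show ?thesis using True by simp
  next
    case False
    define \<beta>' where "\<beta>' = \<beta> - ?e"
    have \<beta>: "\<beta> = \<beta>' + ?e" by (simp add: \<beta>'_def)
    have nn: "?l \<beta>' i \<ge> 0" for i
      using insert.prems(2)[of i] insert.prems(2)[of "fst w"] False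
      by (auto simp: \<beta>'_def lookup_minus lookup_single when_def)
    have "layer_dim U = \<beta>' + \<gamma>" using eq unfolding \<beta> by (simp add: add_ac)
    from insert.IH[OF this nn insert.prems(3)]
    have IH: "card {W. W \<subseteq> U \<and> layer_dim W = \<beta>'} * multi_fact \<beta>' * multi_fact \<gamma> = multi_fact (layer_dim U)" .
    have P2: "?P2 = {W. W \<subseteq> U \<and> layer_dim W = \<beta>'}" unfolding \<beta> by simp
    have "multi_fact \<beta> = nat (?l \<beta> (fst w)) * multi_fact \<beta>'"
      unfolding \<beta> multi_fact_add_single[OF nn] by (simp add: lookup_add)
    then show ?thesis using IH unfolding P2 by (simp add: mult_ac)
  qed
  moreover have "multi_fact (layer_dim (insert w U)) = (nat (?l \<gamma> (fst w)) + nat (?l \<beta> (fst w))) * multi_fact (layer_dim U)"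
  proof -
    have "?l (layer_dim U) i \<ge> 0" for i using insert.hyps by (simp add: lookup_layer_dim)
    then have "multi_fact (layer_dim (insert w U)) = nat (?l (layer_dim U) (fst w) + 1) * multi_fact (layer_dim U)"
      unfolding dimU by (rule multi_fact_add_single)
    also have "?l (layer_dim U) (fst w) + 1 = ?l \<gamma> (fst w) + ?l \<beta> (fst w)"
      using lk[of "fst w"] by simp
    finally show ?thesis using insert.prems(2,3) by (simp add: nat_add_distrib)
  qed
  ultimately show ?case by (simp add: distrib_right)
qed

text \<open>
  The number of subsets through a given vertex is that of all subsets of the remaining vertices with
  dimension vector smaller by one at that place. These are the coefficients that the Euler derivation
  produces.
\<close>

lemma count_pointed_subsets_of_dim:
  assumes V: "finite V" "v \<in> V" "layer_dim V = \<beta> + \<gamma>"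
    and nn: "\<And>i. Poly_Mapping.lookup \<beta> i \<ge> 0" "\<And>i. Poly_Mapping.lookup \<gamma> i \<ge> 0"
  shows "card {W. W \<subseteq> V \<and> v \<in> W \<and> layer_dim W = \<beta>} * nat (Poly_Mapping.lookup (layer_dim V) (fst v)) * multi_fact \<beta> * multi_fact \<gamma> =
    nat (Poly_Mapping.lookup \<beta> (fst v)) * multi_fact (layer_dim V)"
proof -
  let ?e = "Poly_Mapping.single (fst v) (1::int)" and ?l = "Poly_Mapping.lookup"
  let ?U = "V - {v}"
  have U: "finite ?U" using V by simp
  have Uv: "V = insert v ?U" using V by auto
  have dimI: "layer_dim (insert v W) = layer_dim W + ?e" if "W \<subseteq> ?U" for W
  proof -
    have "finite W" "v \<notin> W" using that U finite_subset by auto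
    then show ?thesis by (simp add: layer_dim_def add.commute)
  qed
  have dimV: "layer_dim V = layer_dim ?U + ?e" using dimI[of ?U] Uv by simp
  have S: "{W. W \<subseteq> V \<and> v \<in> W \<and> layer_dim W = \<beta>} = insert v ` {W. W \<subseteq> ?U \<and> layer_dim W + ?e = \<beta>}"
  proof (intro equalityI subsetI)
    fix W assume W: "W \<in> {W. W \<subseteq> V \<and> v \<in> W \<and> layer_dim W = \<beta>}"
    then have W': "W = insert v (W - {v})" "W - {v} \<subseteq> ?U" by auto
    then have "W - {v} \<in> {W. W \<subseteq> ?U \<and> layer_dim W + ?e = \<beta>}" using dimI[OF W'(2)] W by auto
    then show "W \<in> insert v ` {W. W \<subseteq> ?U \<and> layer_dim W + ?e = \<beta>}" using W'(1) by blast
  qed (use dimI V in auto)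
  have inj: "inj_on (insert v) {W. W \<subseteq> ?U \<and> layer_dim W + ?e = \<beta>}" by (auto simp: inj_on_def)
  have c: "card {W. W \<subseteq> V \<and> v \<in> W \<and> layer_dim W = \<beta>} = card {W. W \<subseteq> ?U \<and> layer_dim W + ?e = \<beta>}"
    unfolding S by (rule card_image[OF inj])
  show ?thesis
  proof (cases "?l \<beta> (fst v) = 0")
    case True
    have "\<not> (W \<subseteq> ?U \<and> layer_dim W + ?e = \<beta>)" for W
    proof
      assume W: "W \<subseteq> ?U \<and> layer_dim W + ?e = \<beta>"
      then have "finite W" using U finite_subset by auto
      moreover have "?l (layer_dim W) (fst v) + 1 = 0" using W True by (auto simp: lookup_add)
      ultimately show False by (simp add: lookup_layer_dim)
    qed
    then have "{W. W \<subseteq> ?U \<and> layer_dim W + ?e = \<beta>} = {}" by blast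
    then have "card {W. W \<subseteq> V \<and> v \<in> W \<and> layer_dim W = \<beta>} = 0" unfolding c by (simp only: card.empty)
    then show ?thesis using True by simp
  next
    case False
    define \<beta>' where "\<beta>' = \<beta> - ?e"
    have \<beta>: "\<beta> = \<beta>' + ?e" by (simp add: \<beta>'_def)
    have nn': "?l \<beta>' i \<ge> 0" for i
      using nn(1)[of i] nn(1)[of "fst v"] False by (auto simp: \<beta>'_def lookup_minus lookup_single when_def)
    have "layer_dim ?U = \<beta>' + \<gamma>" using V(3) unfolding \<beta> dimV by (simp add: add_ac)
    from count_subsets_of_dim[OF U this nn' nn(2)]
    have IH: "card {W. W \<subseteq> ?U \<and> layer_dim W = \<beta>'} * multi_fact \<beta>' * multi_fact \<gamma> = multi_fact (layer_dim ?U)" .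
    have P2: "{W. W \<subseteq> ?U \<and> layer_dim W + ?e = \<beta>} = {W. W \<subseteq> ?U \<and> layer_dim W = \<beta>'}" unfolding \<beta> by simp
    have m1: "multi_fact \<beta> = nat (?l \<beta> (fst v)) * multi_fact \<beta>'"
      unfolding \<beta> multi_fact_add_single[OF nn'] by (simp add: lookup_add)
    have "?l (layer_dim ?U) i \<ge> 0" for i using U by (simp add: lookup_layer_dim)
    then have m2: "multi_fact (layer_dim V) = nat (?l (layer_dim V) (fst v)) * multi_fact (layer_dim ?U)"
      unfolding dimV by (subst multi_fact_add_single) (simp_all add: lookup_add)
    show ?thesis unfolding c P2 m1 m2 IH[symmetric] by (simp only: mult_ac)
  qed
qed

section \<open>The recursion for normalised counts\<close>

context arrow_ends begin

lemma closed_under_image: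
  assumes \<pi>: "inj_on \<pi> W" and S: "S \<subseteq> arrows_on E W" and C: "C \<subseteq> W"
    and th: "\<And>a. a \<in> arrows_on E W \<Longrightarrow> t (\<rho> a) = \<pi> (t a) \<and> h (\<rho> a) = \<pi> (h a)"
  shows "closed_under (\<rho> ` S) (\<pi> ` C) \<longleftrightarrow> closed_under S C"
proof -
  have "\<pi> v \<in> \<pi> ` C \<longleftrightarrow> v \<in> C" if "v \<in> W" for v
    using \<pi> C that by (metis inj_on_image_mem_iff)
  moreover have "t a \<in> W \<and> h a \<in> W" if "a \<in> S" for a using S that by (auto simp: arrows_from_def)
  moreover have "t (\<rho> a) = \<pi> (t a) \<and> h (\<rho> a) = \<pi> (h a)" if "a \<in> S" for a using th S that by auto
  ultimately show ?thesis unfolding closed_under_def by simp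
qed

text \<open>
  Renaming vertices and arrows compatibly, and preserving the weight, preserves semistability.
\<close>

lemma semistable_sum_relabel:
  assumes \<pi>: "bij_betw \<pi> W W'" and \<rho>: "bij_betw \<rho> (arrows_on E W) (arrows_on E W')"
    and th: "\<And>a. a \<in> arrows_on E W \<Longrightarrow> t (\<rho> a) = \<pi> (t a) \<and> h (\<rho> a) = \<pi> (h a)"
    and \<theta>: "\<And>v. v \<in> W \<Longrightarrow> \<theta> (\<pi> v) = \<theta> v"
  shows "semistable_sum y E \<theta> W' = semistable_sum y E \<theta> W"
proof -
  have inj: "inj_on \<pi> W" "inj_on \<rho> (arrows_on E W)" and W': "W' = \<pi> ` W" and E': "arrows_on E W' = \<rho> ` arrows_on E W"
    using \<pi> \<rho> by (auto simp: bij_betw_def)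
  have sum: "sum \<theta> (\<pi> ` C) = sum \<theta> C" if C: "C \<subseteq> W" for C
  proof -
    have "sum \<theta> (\<pi> ` C) = (\<Sum>v\<in>C. \<theta> (\<pi> v))"
      using sum.reindex[OF inj_on_subset[OF inj(1) C], of \<theta>] by simp
    then show ?thesis using \<theta> C by (simp add: subset_iff)
  qed
  have ss: "semistable_support \<theta> W' (\<rho> ` S) \<longleftrightarrow> semistable_support \<theta> W S" if S: "S \<subseteq> arrows_on E W" for S
    unfolding semistable_support_def W' all_subset_image
    using sum closed_under_image[OF inj(1) S _ th] by auto
  show ?thesis unfolding semistable_sum_def
  proof (rule sum.reindex_bij_witness[where j = "\<lambda>S'. inv_into (arrows_on E W) \<rho> ` S'" and i = "\<lambda>S. \<rho> ` S"])
    fix S' assume S': "S' \<in> {S. S \<subseteq> arrows_on E W' \<and> semistable_support \<theta> W' S}"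
    show eq: "\<rho> ` inv_into (arrows_on E W) \<rho> ` S' = S'"
      using S' E' by (intro image_inv_into_cancel[OF E'[symmetric]]) auto
    have sub: "inv_into (arrows_on E W) \<rho> ` S' \<subseteq> arrows_on E W"
      using S' unfolding E' by (auto intro: inv_into_into)
    then show "inv_into (arrows_on E W) \<rho> ` S' \<in> {S. S \<subseteq> arrows_on E W \<and> semistable_support \<theta> W S}"
      using ss[OF sub] S' eq by simp
    have "inj_on (inv_into (arrows_on E W) \<rho>) S'"
      using S' unfolding E' by (auto intro: inj_on_inv_into)
    then show "y ^ card (inv_into (arrows_on E W) \<rho> ` S') = y ^ card S'" by (simp add: card_image)
  next
    fix S assume S: "S \<in> {S. S \<subseteq> arrows_on E W \<and> semistable_support \<theta> W S}"
    show "inv_into (arrows_on E W) \<rho> ` \<rho> ` S = S" using S inj(2) by (intro inv_into_image_cancel) auto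
    show "\<rho> ` S \<in> {S. S \<subseteq> arrows_on E W' \<and> semistable_support \<theta> W' S}"
      using S ss[of S] E' by auto
  qed
qed

lemma arrows_from_arrows_on:
  "W \<subseteq> V \<Longrightarrow> U \<subseteq> V \<Longrightarrow> arrows_from (arrows_on E V) W U = arrows_from E W U"
  by (auto simp: arrows_from_def)

end

lemma ex_bij_preserving_fst:
  assumes fin: "finite W" "finite W'" and dim: "layer_dim W = layer_dim W'"
  shows "\<exists>\<pi>. bij_betw \<pi> W W' \<and> (\<forall>v\<in>W. fst (\<pi> v) = fst v)"
proof -
  have ex: "\<exists>b. bij_betw b {v \<in> W. fst v = i} {v \<in> W'. fst v = i}" for i
  proof -
    have "int (card {v \<in> W. fst v = i}) = int (card {v \<in> W'. fst v = i})"
      using arg_cong[OF dim, of "\<lambda>x. Poly_Mapping.lookup x i"] fin by (simp only: lookup_layer_dim)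
    then show ?thesis using fin by (intro finite_same_card_bij) auto
  qed
  define b where "b = (\<lambda>i. SOME b. bij_betw b {v \<in> W. fst v = i} {v \<in> W'. fst v = i})"
  have b: "bij_betw (b i) {v \<in> W. fst v = i} {v \<in> W'. fst v = i}" for i
    unfolding b_def by (rule someI_ex[OF ex])
  define \<pi> where "\<pi> = (\<lambda>v. b (fst v) v)"
  have f: "\<pi> v \<in> W' \<and> fst (\<pi> v) = fst v" if "v \<in> W" for v
    using bspec[OF bij_betwE[OF b[of "fst v"]], of v] that by (simp add: \<pi>_def)
  have "inj_on \<pi> W"
  proof (rule inj_onI)
    fix v w assume vw: "v \<in> W" "w \<in> W" "\<pi> v = \<pi> w"
    then have "fst v = fst w" using f by metis
    then have eq: "b (fst v) v = b (fst v) w" using vw(3) by (simp add: \<pi>_def)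
    have "inj_on (b (fst v)) {x \<in> W. fst x = fst v}" using b by (simp add: bij_betw_def)
    from inj_onD[OF this eq] show "v = w" using vw(1,2) \<open>fst v = fst w\<close> by simp
  qed
  moreover have "\<pi> ` W = W'"
  proof (intro equalityI subsetI)
    fix w assume "w \<in> W'"
    then have "w \<in> b (fst w) ` {v \<in> W. fst v = fst w}" using b[of "fst w"] by (simp add: bij_betw_def)
    then obtain v where "v \<in> W" "fst v = fst w" "w = b (fst w) v" by auto
    then show "w \<in> \<pi> ` W" by (intro image_eqI[of _ _ v]) (simp_all add: \<pi>_def)
  next
    fix w assume "w \<in> \<pi> ` W"
    then show "w \<in> W'" using f by (elim imageE) simp
  qed
  ultimately have "bij_betw \<pi> W W'" by (simp add: bij_betw_def)
  then show ?thesis using f by (intro exI[of _ \<pi>]) simp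
qed

text \<open>
  Vertices over the same vertex of \<open>Q\<close> are interchangeable.
\<close>

lemma ray_count_cong:
  assumes fin: "finite W" "finite W'" and dim: "layer_dim W = layer_dim W'"
  shows "ray_count Q Z u W = ray_count Q Z u W'"
proof -
  obtain \<pi> where \<pi>: "bij_betw \<pi> W W'" "\<And>v. v \<in> W \<Longrightarrow> fst (\<pi> v) = fst v"
    using ex_bij_preserving_fst[OF assms] by blast
  define \<sigma> where "\<sigma> = inv_into W \<pi>"
  have \<sigma>: "\<pi> (\<sigma> w) = w" "\<sigma> w \<in> W" "fst (\<sigma> w) = fst w" if "w \<in> W'" for w
  proof -
    show "\<pi> (\<sigma> w) = w" "\<sigma> w \<in> W" using \<pi>(1) that by (auto simp: \<sigma>_def bij_betw_def f_inv_into_f inv_into_into)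
    then show "fst (\<sigma> w) = fst w" using \<pi>(2)[of "\<sigma> w"] by simp
  qed
  have \<sigma>': "\<sigma> (\<pi> v) = v" "\<pi> v \<in> W'" if "v \<in> W" for v
    using \<pi>(1) that by (auto simp: \<sigma>_def bij_betw_def)
  have p: "\<pi> (i, k) = (i, snd (\<pi> (i, k)))" if "(i, k) \<in> W" for i k
    using \<pi>(2)[OF that] by (simp add: prod_eq_iff)
  have s: "\<sigma> (i, k) = (i, snd (\<sigma> (i, k)))" if "(i, k) \<in> W'" for i k
    using \<sigma>(3)[OF that] by (simp add: prod_eq_iff)
  \<comment> \<open>An arrow is moved along with both of its ends.\<close>
  define \<rho> where "\<rho> = (\<lambda>(a, k, k'). (a, snd (\<pi> (tail Q a, k)), snd (\<pi> (head Q a, k'))) :: 'b \<times> nat \<times> nat)"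
  have \<rho>: "bij_betw \<rho> (arrows_between Q W W) (arrows_between Q W' W')"
  proof (rule bij_betwI[where g = "\<lambda>(a, k, k'). (a, snd (\<sigma> (tail Q a, k)), snd (\<sigma> (head Q a, k')))"])
    show "\<rho> \<in> arrows_between Q W W \<rightarrow> arrows_between Q W' W'"
    proof
      fix x assume x: "x \<in> arrows_between Q W W"
      obtain a k k' where [simp]: "x = (a, k, k')" by (cases x)
      have "(tail Q a, k) \<in> W" "(head Q a, k') \<in> W" "a \<in> arcs Q" using x by (auto simp: in_arrows_between)
      then show "\<rho> x \<in> arrows_between Q W' W'"
        using \<sigma>'(2) p[symmetric] by (simp add: \<rho>_def in_arrows_between)
    qed
    show "(\<lambda>(a, k, k'). (a, snd (\<sigma> (tail Q a, k)), snd (\<sigma> (head Q a, k')))) \<in> arrows_between Q W' W' \<rightarrow> arrows_between Q W W"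
    proof
      fix x assume x: "x \<in> arrows_between Q W' W'"
      obtain a k k' where [simp]: "x = (a, k, k')" by (cases x)
      have "(tail Q a, k) \<in> W'" "(head Q a, k') \<in> W'" "a \<in> arcs Q" using x by (auto simp: in_arrows_between)
      then show "(case x of (a, k, k') \<Rightarrow> (a, snd (\<sigma> (tail Q a, k)), snd (\<sigma> (head Q a, k')))) \<in> arrows_between Q W W"
        using \<sigma>(2) s[symmetric] by (simp add: in_arrows_between)
    qed
  next
    fix x assume x: "x \<in> arrows_between Q W W"
    obtain a k k' where [simp]: "x = (a, k, k')" by (cases x)
    have m: "(tail Q a, k) \<in> W" "(head Q a, k') \<in> W" using x by (auto simp: in_arrows_between)
    show "(case \<rho> x of (a, k, k') \<Rightarrow> (a, snd (\<sigma> (tail Q a, k)), snd (\<sigma> (head Q a, k')))) = x"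
      using \<sigma>'(1)[OF m(1)] \<sigma>'(1)[OF m(2)] by (simp add: \<rho>_def p[OF m(1), symmetric] p[OF m(2), symmetric])
  next
    fix x assume x: "x \<in> arrows_between Q W' W'"
    obtain a k k' where [simp]: "x = (a, k, k')" by (cases x)
    have m: "(tail Q a, k) \<in> W'" "(head Q a, k') \<in> W'" using x by (auto simp: in_arrows_between)
    show "\<rho> (case x of (a, k, k') \<Rightarrow> (a, snd (\<sigma> (tail Q a, k)), snd (\<sigma> (head Q a, k')))) = x"
      using \<sigma>(1)[OF m(1)] \<sigma>(1)[OF m(2)] by (simp add: \<rho>_def s[OF m(1), symmetric] s[OF m(2), symmetric])
  qed
  have "thickened.semistable_sum Q y (thick_arrows Q) (ray_weight Z u) W' =
      thickened.semistable_sum Q y (thick_arrows Q) (ray_weight Z u) W" for y :: rat_fun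
  proof (rule thickened.semistable_sum_relabel[OF \<pi>(1) \<rho>])
    fix x assume x: "x \<in> arrows_between Q W W"
    obtain a k k' where [simp]: "x = (a, k, k')" by (cases x)
    have "(tail Q a, k) \<in> W" "(head Q a, k') \<in> W" using x by (auto simp: in_arrows_between)
    then show "arrow_tail Q (\<rho> x) = \<pi> (arrow_tail Q x) \<and> arrow_head Q (\<rho> x) = \<pi> (arrow_head Q x)"
      using p[symmetric] by (simp add: arrow_tail_def arrow_head_def \<rho>_def)
  qed (simp add: ray_weight_def \<pi>(2))
  then show ?thesis
    using bij_betw_same_card[OF \<rho>] bij_betw_same_card[OF \<pi>(1)] by (simp add: ray_count_def weighted_sum_def)
qed

text \<open>
  Sums of this shape are values of a rational polynomial that is positive at \<open>q\<^sup>1\<^sup>/\<^sup>2 = 2\<close>.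
\<close>

lemma sum_powers_nonzero:
  assumes "finite A" "A \<noteq> {}"
  shows "(\<Sum>S\<in>A. (q_half\<^sup>2 - 1) ^ n S) \<noteq> (0 :: rat_fun)"
proof -
  let ?p = "[:-1, 0, 1:] :: rat poly"
  have q: "q_half\<^sup>2 - 1 = Fract ?p 1"
  proof -
    have "[:0, 0, 1:] - 1 = ?p" by (simp add: one_pCons)
    then show ?thesis by (simp add: q_half_def power2_eq_square One_fract_def)
  qed
  have pow: "Fract r 1 ^ k = Fract (r ^ k) 1" for r :: "rat poly" and k
    by (induction k) (simp_all add: One_fract_def)
  have s: "(\<Sum>S\<in>A. Fract (r S) 1) = Fract (\<Sum>S\<in>A. r S) 1" for r :: "_ \<Rightarrow> rat poly"
    using assms(1) by (induction A rule: finite_induct) (simp_all add: Zero_fract_def)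
  have "poly (\<Sum>S\<in>A. ?p ^ n S) 2 = (\<Sum>S\<in>A. 3 ^ n S)" by (simp add: poly_sum)
  also have "\<dots> > (0::rat)" using assms by (intro sum_pos) auto
  finally have "(\<Sum>S\<in>A. ?p ^ n S) \<noteq> 0" by auto
  then show ?thesis unfolding q pow s by (simp add: Zero_fract_def eq_fract)
qed

lemma weighted_sum_eq_0_iff: "weighted_sum Q W s = 0 \<longleftrightarrow> s = 0"
  using q_half_nonzero q_half_square by (simp add: weighted_sum_def power_int_eq_0_iff)

text \<open>
  Apart from the factors of the two parts, the normalisation contributes
  \<open>q\<^sup>-\<^sup>1\<^sup>/\<^sup>2\<close> for every arrow between them, in either direction. If the two directions are equally
  frequent, this is cancelled by the power of \<open>q\<close> coming from the free arrows in one direction.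
\<close>

lemma weighted_sum_union:
  assumes Q: "quiver Q" and fin: "finite W" "finite U" and sub: "fst ` W \<subseteq> verts Q" "fst ` U \<subseteq> verts Q"
    and disj: "W \<inter> U = {}" and bal: "card (arrows_between Q W U) = card (arrows_between Q U W)"
  shows "weighted_sum Q (W \<union> U) (s * s' * (q_half\<^sup>2) ^ card (arrows_between Q U W)) =
    weighted_sum Q W s * weighted_sum Q U s'"
proof -
  let ?r = "\<lambda>W U. card (arrows_between Q W U)"
  have finA: "finite (arrows_between Q X Y)" if "X \<in> {W, U}" "Y \<in> {W, U}" for X Y
    using that fin sub by (intro finite_arrows_between[OF Q]) auto
  have e: "arrows_between Q (W \<union> U) (W \<union> U) = (arrows_between Q W W \<union> arrows_between Q U U) \<union>
      (arrows_between Q W U \<union> arrows_between Q U W)"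
    by (auto simp: thickened.arrows_from_def)
  have d: "arrows_between Q W W \<inter> arrows_between Q U U = {}" "arrows_between Q W U \<inter> arrows_between Q U W = {}"
    "(arrows_between Q W W \<union> arrows_between Q U U) \<inter> (arrows_between Q W U \<union> arrows_between Q U W) = {}"
    using disj by (auto simp: thickened.arrows_from_def)
  have "card ((arrows_between Q W W \<union> arrows_between Q U U) \<union> (arrows_between Q W U \<union> arrows_between Q U W)) =
      card (arrows_between Q W W \<union> arrows_between Q U U) + card (arrows_between Q W U \<union> arrows_between Q U W)"
    by (rule card_Un_disjoint[OF _ _ d(3)]) (use finA in auto)
  also have "card (arrows_between Q W W \<union> arrows_between Q U U) = ?r W W + ?r U U"
    by (rule card_Un_disjoint[OF _ _ d(1)]) (use finA in auto)
  also have "card (arrows_between Q W U \<union> arrows_between Q U W) = ?r W U + ?r U W"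
    by (rule card_Un_disjoint[OF _ _ d(2)]) (use finA in auto)
  finally have "?r (W \<union> U) (W \<union> U) = ?r W W + ?r U U + (?r W U + ?r U W)" unfolding e .
  then have r: "int (card (W \<union> U)) - int (?r (W \<union> U) (W \<union> U)) + 2 * int (?r U W) =
      (int (card W) - int (?r W W)) + (int (card U) - int (?r U U))"
    using fin disj bal by (simp add: card_Un_disjoint)
  have "q_half powi (int (card (W \<union> U)) - int (?r (W \<union> U) (W \<union> U))) * (q_half\<^sup>2) ^ ?r U W =
      q_half powi (int (card (W \<union> U)) - int (?r (W \<union> U) (W \<union> U)) + 2 * int (?r U W))"
    using q_half_nonzero by (simp add: power_int_add power_int_mult power_int_of_nat)
  also have "\<dots> = q_half powi (int (card W) - int (?r W W)) * q_half powi (int (card U) - int (?r U U))"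
    unfolding r by (rule power_int_add) (simp add: q_half_nonzero)
  finally have P: "q_half powi (int (card (W \<union> U)) - int (?r (W \<union> U) (W \<union> U))) * (q_half\<^sup>2) ^ ?r U W =
      q_half powi (int (card W) - int (?r W W)) * q_half powi (int (card U) - int (?r U U))" .
  have "weighted_sum Q (W \<union> U) (s * s' * (q_half\<^sup>2) ^ ?r U W) =
      q_half powi (int (card (W \<union> U)) - int (?r (W \<union> U) (W \<union> U))) * (q_half\<^sup>2) ^ ?r U W *
      (s * s' / ((q_half\<^sup>2 - 1) ^ card W * (q_half\<^sup>2 - 1) ^ card U))"
    using fin disj by (simp add: weighted_sum_def card_Un_disjoint power_add)
  also have "\<dots> = weighted_sum Q W s * weighted_sum Q U s'"
    unfolding P weighted_sum_def by simp
  finally show ?thesis .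
qed

lemma weighted_sum_add: "weighted_sum Q W (\<Sum>i\<in>I. s i) = (\<Sum>i\<in>I. weighted_sum Q W (s i))"
  by (simp add: weighted_sum_def sum_distrib_left)

lemma ray_count_nonzeroD:
  assumes "ray_count Q Z u W \<noteq> 0"
  shows "sum (ray_weight Z u) W = 0"
proof (rule ccontr)
  assume "sum (ray_weight Z u) W \<noteq> 0"
  then have "thickened.semistable_sum Q (q_half\<^sup>2 - 1) (thick_arrows Q) (ray_weight Z u) W = 0"
    by (simp add: thickened.semistable_sum_def thickened.semistable_support_def)
  then show False using assms by (simp add: ray_count_def weighted_sum_def)
qed

text \<open>
  Pointed supports are semistable, and a nonempty sum of powers of \<open>q - 1\<close> is nonzero.
\<close>

lemma pointed_count_nonzeroD:
  assumes Q: "quiver Q" and W: "finite W" "fst ` W \<subseteq> verts Q" and nz: "pointed_count Q Z u v W \<noteq> 0"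
  shows "ray_count Q Z u W \<noteq> 0"
proof -
  let ?E = "arrows_between Q W W"
  have fin: "finite ?E" using finite_arrows_between[OF Q W(1,1,2,2)] .
  let ?A = "{S. S \<subseteq> ?E \<and> thickened.semistable_support Q (ray_weight Z u) W S}"
  have "{S. S \<subseteq> ?E \<and> thickened.pointed_support Q (ray_weight Z u) v W S} \<noteq> {}"
  proof
    assume "{S. S \<subseteq> ?E \<and> thickened.pointed_support Q (ray_weight Z u) v W S} = {}"
    then have "pointed_count Q Z u v W = 0"
      unfolding pointed_count_def thickened.pointed_sum_def by (simp only: sum.empty) (simp add: weighted_sum_def)
    with nz show False by simp
  qed
  then have "?A \<noteq> {}" unfolding thickened.pointed_support_def by blast
  moreover have "finite ?A" using fin by simp
  ultimately show ?thesis
    using sum_powers_nonzero[of ?A card]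
    unfolding ray_count_def weighted_sum_eq_0_iff thickened.semistable_sum_def by simp
qed

text \<open>
  The orthogonality hypothesis is available for exactly those pairs of vertex sets whose term in the
  sum does not vanish.
\<close>

lemma ray_count_recursion:
  assumes Q: "quiver Q" and V: "finite V" "fst ` V \<subseteq> verts Q" "v \<in> V"
    and orth: "\<And>W U. W \<subseteq> V \<Longrightarrow> U \<subseteq> V \<Longrightarrow> ray_count Q Z u W \<noteq> 0 \<Longrightarrow> ray_count Q Z u U \<noteq> 0 \<Longrightarrow>
      card (arrows_between Q W U) = card (arrows_between Q U W)"
  shows "ray_count Q Z u V = (\<Sum>W | W \<subseteq> V \<and> v \<in> W. pointed_count Q Z u v W * ray_count Q Z u (V - W))"
proof -
  let ?y = "q_half\<^sup>2 - 1" and ?E = "thick_arrows Q" and ?\<theta> = "ray_weight Z u"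
  let ?EV = "arrows_between Q V V"
  have fin: "finite ?EV" using finite_arrows_between[OF Q V(1,1,2,2)] .
  have ss: "thickened.semistable_sum Q ?y ?EV ?\<theta> W = thickened.semistable_sum Q ?y ?E ?\<theta> W" if "W \<subseteq> V" for W
    using that by (simp add: thickened.semistable_sum_def thickened.arrows_from_arrows_on)
  have ps: "thickened.pointed_sum Q ?y ?EV ?\<theta> v W = thickened.pointed_sum Q ?y ?E ?\<theta> v W" if "W \<subseteq> V" for W
    using that by (simp add: thickened.pointed_sum_def thickened.arrows_from_arrows_on)
  have "thickened.semistable_sum Q ?y ?E ?\<theta> V = (\<Sum>W | W \<subseteq> V \<and> v \<in> W.
      thickened.pointed_sum Q ?y ?E ?\<theta> v W * thickened.semistable_sum Q ?y ?E ?\<theta> (V - W) *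
      (q_half\<^sup>2) ^ card (arrows_between Q (V - W) W))"
    unfolding ss[OF order_refl, symmetric] thickened.semistable_sum_recursion[OF V(1) fin V(3)]
    by (intro sum.cong refl) (simp add: ss ps thickened.arrows_from_arrows_on)
  then have "ray_count Q Z u V = (\<Sum>W | W \<subseteq> V \<and> v \<in> W. weighted_sum Q V (
      thickened.pointed_sum Q ?y ?E ?\<theta> v W * thickened.semistable_sum Q ?y ?E ?\<theta> (V - W) *
      (q_half\<^sup>2) ^ card (arrows_between Q (V - W) W)))"
    by (simp add: ray_count_def weighted_sum_add)
  also have "\<dots> = (\<Sum>W | W \<subseteq> V \<and> v \<in> W. pointed_count Q Z u v W * ray_count Q Z u (V - W))"
  proof (rule sum.cong[OF refl])
    fix W assume "W \<in> {W. W \<subseteq> V \<and> v \<in> W}"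
    then have W: "W \<subseteq> V" by simp
    let ?p = "thickened.pointed_sum Q ?y ?E ?\<theta> v W" and ?s = "thickened.semistable_sum Q ?y ?E ?\<theta> (V - W)"
    have f: "finite W" "finite (V - W)" "fst ` W \<subseteq> verts Q" "fst ` (V - W) \<subseteq> verts Q"
      using W V finite_subset by auto
    show "weighted_sum Q V (?p * ?s * (q_half\<^sup>2) ^ card (arrows_between Q (V - W) W)) =
        pointed_count Q Z u v W * ray_count Q Z u (V - W)"
    proof (cases "?p = 0 \<or> ?s = 0")
      case True
      then show ?thesis by (auto simp: pointed_count_def ray_count_def weighted_sum_def)
    next
      case False
      then have "pointed_count Q Z u v W \<noteq> 0" "ray_count Q Z u (V - W) \<noteq> 0"
        by (auto simp: pointed_count_def ray_count_def weighted_sum_eq_0_iff)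
      then have "card (arrows_between Q W (V - W)) = card (arrows_between Q (V - W) W)"
        using pointed_count_nonzeroD[OF Q f(1,3)] W by (intro orth) auto
      from weighted_sum_union[OF Q f _ this, of ?p ?s] W show ?thesis
        by (simp add: pointed_count_def ray_count_def Un_absorb1)
    qed
  qed
  finally show ?thesis .
qed

lemma ray_count_empty: "ray_count Q Z u {} = 1"
proof -
  have E: "arrows_between Q {} {} = {}" by (simp add: thickened.arrows_from_def)
  then have "{S. S \<subseteq> arrows_between Q {} {} \<and> thickened.semistable_support Q (ray_weight Z u) {} S} = {{}}"
    by (auto simp: thickened.semistable_support_def)
  then show ?thesis using E by (simp add: ray_count_def weighted_sum_def thickened.semistable_sum_def)
qed

section \<open>The invariants as pointed counts\<close>

lemma of_rat_fun_card_mult: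
  "finite S \<Longrightarrow> of_rat_fun (of_nat (card S)) * x = (\<Sum>_\<in>S. x)"
  by (induction S rule: finite_induct) (simp_all add: of_rat_fun_add of_rat_fun_1 distrib_right)

lemma multi_fact_nonzero: "multi_fact \<beta> \<noteq> 0"
  by (simp add: multi_fact_def)

lemma layer_dim_eq_0_iff: "finite W \<Longrightarrow> layer_dim W = 0 \<longleftrightarrow> W = {}"
  using height_layer_dim[of W] by (auto simp: layer_dim_def)

lemma nat_laurent_nat_polys:
  assumes "x \<in> nat_polys (q_half\<^sup>2)"
  shows "of_rat_fun (q_half powi e * x) \<in> nat_laurent"
proof -
  have "\<exists>K c. finite K \<and> q_half powi e * x = (\<Sum>k\<in>K. of_nat (c k) * q_half powi k)"
    using assms
  proof (induction arbitrary: e)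
    case zero
    then show ?case by (intro exI[of _ "{}"]) simp
  next
    case one
    then show ?case by (intro exI[of _ "{e}"] exI[of _ "\<lambda>_. 1"]) simp
  next
    case (add x x')
    obtain K c where 1: "finite K" "q_half powi e * x = (\<Sum>k\<in>K. of_nat (c k) * q_half powi k)"
      using add.IH(1)[of e] by blast
    obtain K' c' where 2: "finite K'" "q_half powi e * x' = (\<Sum>k\<in>K'. of_nat (c' k) * q_half powi k)"
      using add.IH(2)[of e] by blast
    let ?c = "\<lambda>k. if k \<in> K then c k else 0" and ?c' = "\<lambda>k. if k \<in> K' then c' k else 0"
    have "(\<Sum>k\<in>K. of_nat (c k) * q_half powi k) = (\<Sum>k\<in>K \<union> K'. of_nat (?c k) * q_half powi k)"
      using 1(1) 2(1) by (intro sum.mono_neutral_cong_left) auto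
    moreover have "(\<Sum>k\<in>K'. of_nat (c' k) * q_half powi k) = (\<Sum>k\<in>K \<union> K'. of_nat (?c' k) * q_half powi k)"
      using 1(1) 2(1) by (intro sum.mono_neutral_cong_left) auto
    ultimately have "q_half powi e * (x + x') = (\<Sum>k\<in>K \<union> K'. of_nat (?c k + ?c' k) * q_half powi k)"
      unfolding distrib_left 1(2) 2(2) of_nat_add distrib_right sum.distrib by (simp only:)
    then show ?case using 1(1) 2(1)
      by (intro exI[of _ "K \<union> K'"] exI[of _ "\<lambda>k. ?c k + ?c' k"]) simp
  next
    case (times_q x)
    have "q_half powi e * (q_half\<^sup>2 * x) = q_half powi (e + 2) * x"
      using power_int_add[of q_half e 2] q_half_nonzero by (simp add: mult.assoc)
    then show ?case by (simp only: times_q.IH)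
  qed
  then obtain K c where "finite K" "q_half powi e * x = (\<Sum>k\<in>K. of_nat (c k) * q_half powi k)" by blast
  then show ?thesis unfolding nat_laurent_def by (intro CollectI exI[of _ K] exI[of _ c]) simp
qed

definition ray_coeff ::
    "('v, 'e) pre_digraph \<Rightarrow> (('v \<Rightarrow>\<^sub>0 int) \<Rightarrow> complex) \<Rightarrow> complex set \<Rightarrow> 'v mps" where
  "ray_coeff Q Z l \<alpha> = mps_one \<alpha> + ray_series Q Z l (f_inv Q Z) \<alpha>"

text \<open>
  The series in the exponent.
\<close>

definition log_coeff ::
    "('v, 'e) pre_digraph \<Rightarrow> (('v \<Rightarrow>\<^sub>0 int) \<Rightarrow> complex) \<Rightarrow> complex set \<Rightarrow> 'v mps \<Rightarrow> 'v mps" where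
  "log_coeff Q Z l g \<beta> = ray_series Q Z l g \<beta> * of_rat_fun (1 / (q_half - 1 / q_half))"

context
  fixes Q :: "('v, 'e) pre_digraph" and Z :: "('v \<Rightarrow>\<^sub>0 int) \<Rightarrow> complex" and u :: complex and l :: "complex set"
    and g :: "('v \<Rightarrow>\<^sub>0 int) \<Rightarrow> motivic"
  assumes Q: "quiver Q" and Z: "stability_function Q Z"
    and u: "u \<in> upper_half" and l: "l = {of_real r * u | r. r > 0}"
    and g: "is_abelian_invariant Q Z l g"
begin

lemma ray_coeff_eq_exp: "\<alpha> \<in> Gamma_plus Q \<Longrightarrow> ray_coeff Q Z l \<alpha> = mps_exp Q (log_coeff Q Z l g) \<alpha>"
  using g unfolding is_abelian_invariant_def
  by (simp add: ray_coeff_def log_coeff_def[abs_def])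

lemma log_coeff_0: "log_coeff Q Z l g 0 = 0"
  by (simp add: log_coeff_def ray_series_def ray_classes_def)

lemma ray_coeff_layer_dim:
  assumes W: "finite W" "fst ` W \<subseteq> verts Q"
  shows "ray_coeff Q Z l (layer_dim W) * of_rat_fun (of_nat (multi_fact (layer_dim W))) = of_rat_fun (ray_count Q Z u W)"
proof (cases "W = {}")
  case True
  then show ?thesis
    by (simp add: ray_coeff_def layer_dim_def mps_one_def ray_series_def ray_classes_def multi_fact_def ray_count_empty of_rat_fun_1)
next
  case False
  let ?\<beta> = "layer_dim W"
  have \<beta>: "?\<beta> \<in> Gamma_plus Q" "?\<beta> \<noteq> 0" using W False by (auto simp: layer_dim_Gamma_plus layer_dim_eq_0_iff)
  show ?thesis
  proof (cases "Z ?\<beta> \<in> l")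
    case True
    have "f_inv Q Z ?\<beta> = of_rat_fun (ray_count Q Z u (layers Q ?\<beta>))"
      by (rule f_inv_eq_ray_count[OF Q Z u l \<beta> True])
    also have "ray_count Q Z u (layers Q ?\<beta>) = ray_count Q Z u W"
      by (rule ray_count_cong[OF finite_layers W(1) layer_dim_layers[OF \<beta>(1)]])
    finally have "ray_coeff Q Z l ?\<beta> = of_rat_fun (ray_count Q Z u W) * of_rat_fun (1 / of_nat (multi_fact ?\<beta>))"
      using True \<beta> by (simp add: ray_coeff_def mps_one_def ray_series_def ray_classes_def)
    then show ?thesis by (simp add: mult.assoc of_rat_fun_mult multi_fact_nonzero)
  next
    case F: False
    then have "ray_count Q Z u W = 0"
      using ray_count_nonzeroD[of Q Z u W] on_ray_iff_weight[OF Q Z u l W False] by auto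
    then show ?thesis using F \<beta> by (simp add: ray_coeff_def mps_one_def ray_series_def ray_classes_def)
  qed
qed

text \<open>
  Comparison of the coefficients at \<open>\<alpha>\<close> after applying the Euler derivation, with \<open>\<alpha>\<^sub>i\<close> cancelled.
\<close>

lemma log_recursion:
  assumes V: "finite V" "fst ` V \<subseteq> verts Q" "v \<in> V"
  shows "of_rat_fun (ray_count Q Z u V) = (\<Sum>W | W \<subseteq> V \<and> v \<in> W.
      log_coeff Q Z l g (layer_dim W) * of_rat_fun (of_nat (multi_fact (layer_dim W))) * of_rat_fun (ray_count Q Z u (V - W)))"
proof -
  let ?\<alpha> = "layer_dim V" and ?i = "fst v" and ?l = "Poly_Mapping.lookup"
  let ?F = "ray_coeff Q Z l" and ?A = "log_coeff Q Z l g"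
  let ?G = "\<lambda>\<beta>. ?A \<beta> * of_rat_fun (of_nat (multi_fact \<beta>))"
  let ?S = "{W. W \<subseteq> V \<and> v \<in> W}" and ?D = "\<lambda>\<beta>. {W. W \<subseteq> V \<and> v \<in> W \<and> layer_dim W = \<beta>}"
  let ?h = "\<lambda>W. ?G (layer_dim W) * of_rat_fun (ray_count Q Z u (V - W))"
  have sub: "finite W" "fst ` W \<subseteq> verts Q" if "W \<subseteq> V" for W using that V finite_subset by auto
  have \<alpha>: "?\<alpha> \<in> Gamma_plus Q" by (rule layer_dim_Gamma_plus[OF V(1,2)])
  have \<alpha>i: "?l ?\<alpha> ?i > 0"
  proof -
    have "{w \<in> V. fst w = ?i} \<noteq> {}" using V(3) by blast
    then have "card {w \<in> V. fst w = ?i} > 0" unfolding card_gt_0_iff using V(1) by simp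
    then show ?thesis using V(1) by (simp only: lookup_layer_dim of_nat_0_less_iff)
  qed
  have dimD: "layer_dim W + layer_dim (V - W) = ?\<alpha>" if "W \<subseteq> V" for W
    using layer_dim_union[of W "V - W"] sub[OF that] V(1) that by (simp add: Un_absorb1)
  have "euler ?i ?F ?\<alpha> = euler ?i (mps_exp Q ?A) ?\<alpha>"
    by (simp add: euler_def ray_coeff_eq_exp[OF \<alpha>])
  also have "\<dots> = mps_mult Q (euler ?i ?A) (mps_exp Q ?A) ?\<alpha>" by (rule euler_mps_exp[of "log_coeff Q Z l g", OF log_coeff_0 \<alpha>])
  also have "\<dots> = mps_mult Q (euler ?i ?A) ?F ?\<alpha>"
    by (rule mps_mult_cong) (simp add: ray_coeff_eq_exp)
  finally have eq: "euler ?i ?F ?\<alpha> = (\<Sum>(\<beta>, \<gamma>)\<in>splits Q ?\<alpha>. euler ?i ?A \<beta> * ?F \<gamma>)"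
    unfolding mps_mult_splits .
  have "of_rat_fun (of_int (?l ?\<alpha> ?i)) * of_rat_fun (ray_count Q Z u V) =
      of_rat_fun (of_nat (multi_fact ?\<alpha>)) * euler ?i ?F ?\<alpha>"
    unfolding ray_coeff_layer_dim[OF V(1,2), symmetric] euler_def by (simp only: mult_ac)
  also have "\<dots> = (\<Sum>(\<beta>, \<gamma>)\<in>splits Q ?\<alpha>. of_rat_fun (of_nat (multi_fact ?\<alpha>)) * (euler ?i ?A \<beta> * ?F \<gamma>))"
    unfolding eq sum_distrib_left case_prod_unfold ..
  also have "\<dots> = (\<Sum>p\<in>splits Q ?\<alpha>. of_rat_fun (of_int (?l ?\<alpha> ?i)) *
      (\<Sum>W\<in>{W \<in> ?S. (layer_dim W, layer_dim (V - W)) = p}. ?h W))"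
  proof (rule sum.cong[OF refl])
    fix p assume p: "p \<in> splits Q ?\<alpha>"
    obtain \<beta> \<gamma> where [simp]: "p = (\<beta>, \<gamma>)" by (cases p)
    have s: "?\<alpha> = \<beta> + \<gamma>" and nn: "\<And>i. ?l \<beta> i \<ge> 0" "\<And>i. ?l \<gamma> i \<ge> 0"
      using p by (auto simp: splits_def Gamma_plus_def)
    have D: "{W \<in> ?S. (layer_dim W, layer_dim (V - W)) = p} = ?D \<beta>"
    proof -
      have "layer_dim (V - W) = \<gamma>" if "W \<subseteq> V" "layer_dim W = \<beta>" for W
        using dimD[OF that(1)] that(2) s by simp
      then show ?thesis by auto
    qed
    have finD: "finite (?D \<beta>)" using V(1) by simp
    let ?N = "card (?D \<beta>)"
    from count_pointed_subsets_of_dim[OF V(1,3) s nn]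
    have "of_nat (?N * nat (?l ?\<alpha> ?i) * multi_fact \<beta> * multi_fact \<gamma>) = (of_nat (nat (?l \<beta> ?i) * multi_fact ?\<alpha>) :: rat_fun)"
      by (rule arg_cong)
    then have cnt: "of_nat (multi_fact ?\<alpha>) * of_int (?l \<beta> ?i) =
        (of_int (?l ?\<alpha> ?i) * of_nat ?N * of_nat (multi_fact \<beta>) * of_nat (multi_fact \<gamma>) :: rat_fun)"
      using nn(1)[of ?i] \<alpha>i by (simp add: of_nat_nat mult_ac)
    have "of_rat_fun (of_nat (multi_fact ?\<alpha>)) * (euler ?i ?A \<beta> * ?F \<gamma>) =
        of_rat_fun (of_nat (multi_fact ?\<alpha>) * of_int (?l \<beta> ?i)) * (?A \<beta> * ?F \<gamma>)"
      unfolding euler_def of_rat_fun_mult[symmetric] by (simp only: mult_ac)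
    also have "\<dots> = of_rat_fun (of_int (?l ?\<alpha> ?i)) * (of_rat_fun (of_nat ?N) * (?G \<beta> * (?F \<gamma> * of_rat_fun (of_nat (multi_fact \<gamma>)))))"
      unfolding cnt of_rat_fun_mult[symmetric] by (simp only: mult_ac)
    also have "of_rat_fun (of_nat ?N) * (?G \<beta> * (?F \<gamma> * of_rat_fun (of_nat (multi_fact \<gamma>)))) =
        (\<Sum>W\<in>?D \<beta>. ?G \<beta> * (?F \<gamma> * of_rat_fun (of_nat (multi_fact \<gamma>))))"
      by (rule of_rat_fun_card_mult[OF finD])
    also have "\<dots> = (\<Sum>W\<in>?D \<beta>. ?h W)"
    proof (rule sum.cong[OF refl])
      fix W assume W: "W \<in> ?D \<beta>"
      then have "layer_dim (V - W) = \<gamma>" using dimD[of W] s by simp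
      moreover have "finite (V - W)" "fst ` (V - W) \<subseteq> verts Q" using sub[of "V - W"] by auto
      ultimately show "?G \<beta> * (?F \<gamma> * of_rat_fun (of_nat (multi_fact \<gamma>))) = ?h W"
        using ray_coeff_layer_dim[of "V - W"] W by simp
    qed
    finally show "(case p of (\<beta>, \<gamma>) \<Rightarrow> of_rat_fun (of_nat (multi_fact ?\<alpha>)) * (euler ?i ?A \<beta> * ?F \<gamma>)) =
        of_rat_fun (of_int (?l ?\<alpha> ?i)) * (\<Sum>W\<in>{W \<in> ?S. (layer_dim W, layer_dim (V - W)) = p}. ?h W)"
      unfolding D by simp
  qed
  also have "\<dots> = of_rat_fun (of_int (?l ?\<alpha> ?i)) *
      (\<Sum>p\<in>splits Q ?\<alpha>. \<Sum>W\<in>{W \<in> ?S. (layer_dim W, layer_dim (V - W)) = p}. ?h W)"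
    by (rule sum_distrib_left[symmetric])
  also have "(\<Sum>p\<in>splits Q ?\<alpha>. \<Sum>W\<in>{W \<in> ?S. (layer_dim W, layer_dim (V - W)) = p}. ?h W) = sum ?h ?S"
  proof (rule sum.group)
    show "finite ?S" using V(1) by simp
    show "finite (splits Q ?\<alpha>)" by (rule finite_splits_set)
    show "(\<lambda>W. (layer_dim W, layer_dim (V - W))) ` ?S \<subseteq> splits Q ?\<alpha>"
    proof (rule image_subsetI)
      fix W assume "W \<in> ?S"
      then have W: "W \<subseteq> V" by simp
      have "V - W \<subseteq> V" by auto
      then show "(layer_dim W, layer_dim (V - W)) \<in> splits Q ?\<alpha>"
        using layer_dim_Gamma_plus[OF sub[OF W]] layer_dim_Gamma_plus[OF sub[of "V - W"]] dimD[OF W]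
        by (simp add: splits_def)
    qed
  qed
  finally have fin: "of_rat_fun (of_int (?l ?\<alpha> ?i)) * of_rat_fun (ray_count Q Z u V) =
      of_rat_fun (of_int (?l ?\<alpha> ?i)) * sum ?h ?S" .
  let ?n = "of_int (?l ?\<alpha> ?i) :: rat_fun"
  have "?n = of_nat (nat (?l ?\<alpha> ?i))" using \<alpha>i by (simp add: of_nat_nat)
  then have nz: "?n \<noteq> 0" using \<alpha>i by simp
  have cancel: "of_rat_fun (1 / ?n) * (of_rat_fun ?n * x) = x" for x
    using nz by (simp add: mult.assoc[symmetric] of_rat_fun_mult of_rat_fun_1)
  show ?thesis using arg_cong[OF fin, of "\<lambda>x. of_rat_fun (1 / ?n) * x"] unfolding cancel .
qed

text \<open>
  Both families of coefficients satisfy the same recursion, in which the term \<open>W = V\<close> has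
  coefficient \<open>1\<close>.
\<close>

lemma log_coeff_eq_pointed_count:
  assumes orth: "\<And>W U. finite W \<Longrightarrow> finite U \<Longrightarrow> fst ` W \<subseteq> verts Q \<Longrightarrow> fst ` U \<subseteq> verts Q \<Longrightarrow>
      ray_count Q Z u W \<noteq> 0 \<Longrightarrow> ray_count Q Z u U \<noteq> 0 \<Longrightarrow>
      card (arrows_between Q W U) = card (arrows_between Q U W)"
    and V: "finite V" "fst ` V \<subseteq> verts Q" "v \<in> V"
  shows "log_coeff Q Z l g (layer_dim V) * of_rat_fun (of_nat (multi_fact (layer_dim V))) = of_rat_fun (pointed_count Q Z u v V)"
  using V
proof (induction "card V" arbitrary: V rule: less_induct)
  case less
  note V = less.prems
  let ?G = "\<lambda>W. log_coeff Q Z l g (layer_dim W) * of_rat_fun (of_nat (multi_fact (layer_dim W)))"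
  let ?R = "\<lambda>W. of_rat_fun (ray_count Q Z u W)"
  let ?S = "{W. W \<subseteq> V \<and> v \<in> W}"
  have S: "finite ?S" "V \<in> ?S" using V by auto
  have sub: "finite W" "fst ` W \<subseteq> verts Q" if "W \<subseteq> V" for W using that V finite_subset by auto
  have "ray_count Q Z u V = (\<Sum>W\<in>?S. pointed_count Q Z u v W * ray_count Q Z u (V - W))"
    by (rule ray_count_recursion[OF Q V]) (use orth sub in auto)
  then have 1: "?R V = (\<Sum>W\<in>?S. of_rat_fun (pointed_count Q Z u v W) * ?R (V - W))"
    by (simp only: of_rat_fun_sum of_rat_fun_mult)
  have 2: "?R V = (\<Sum>W\<in>?S. ?G W * ?R (V - W))" by (rule log_recursion[OF V])
  have "(\<Sum>W\<in>?S - {V}. ?G W * ?R (V - W)) = (\<Sum>W\<in>?S - {V}. of_rat_fun (pointed_count Q Z u v W) * ?R (V - W))"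
  proof (rule sum.cong[OF refl])
    fix W assume "W \<in> ?S - {V}"
    then have W: "W \<subset> V" "v \<in> W" by auto
    have "card W < card V" by (rule psubset_card_mono[OF V(1) W(1)])
    then have "?G W = of_rat_fun (pointed_count Q Z u v W)"
      by (rule less.hyps) (use W sub[of W] in auto)
    then show "?G W * ?R (V - W) = of_rat_fun (pointed_count Q Z u v W) * ?R (V - W)" by simp
  qed
  then show ?case
    using 1 2 unfolding sum.remove[OF S] by (simp add: ray_count_empty of_rat_fun_1)
qed

end

text \<open>
  The factor \<open>q\<^sup>1\<^sup>/\<^sup>2 - q\<^sup>-\<^sup>1\<^sup>/\<^sup>2 = (q - 1) / q\<^sup>1\<^sup>/\<^sup>2\<close> makes up for the one power of \<open>q - 1\<close> that the
  pointed sum lacks.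
\<close>

lemma pointed_count_nat_laurent:
  assumes Q: "quiver Q" and V: "finite V" "fst ` V \<subseteq> verts Q" "v \<in> V"
  shows "of_rat_fun (pointed_count Q Z u v V * (q_half - 1 / q_half)) \<in> nat_laurent"
proof -
  let ?y = "q_half\<^sup>2 - 1" and ?EV = "arrows_between Q V V"
  let ?e = "int (card V) - int (card ?EV)"
  have fin: "finite ?EV" using finite_arrows_between[OF Q V(1,1,2,2)] .
  obtain p where p: "p \<in> nat_polys (1 + ?y)"
    "thickened.pointed_sum Q ?y ?EV (ray_weight Z u) v V = ?y ^ (card V - 1) * p"
    using thickened.pointed_sum_positive[OF V(1,3) fin] by blast
  have eq: "thickened.pointed_sum Q ?y (thick_arrows Q) (ray_weight Z u) v V = ?y ^ (card V - 1) * p"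
    using p(2) by (simp add: thickened.pointed_sum_def thickened.arrows_from_arrows_on)
  have "card V \<noteq> 0" using V by auto
  then have n: "card V = Suc (card V - 1)" by simp
  have y: "q_half - 1 / q_half = ?y / q_half"
    using q_half_nonzero by (simp add: field_simps power2_eq_square)
  have "pointed_count Q Z u v V * (q_half - 1 / q_half) = q_half powi ?e / q_half * p"
  proof -
    have "pointed_count Q Z u v V * (q_half - 1 / q_half) =
        q_half powi ?e / (?y ^ (card V - 1) * ?y) * (?y ^ (card V - 1) * p) * (?y / q_half)"
      unfolding pointed_count_def weighted_sum_def eq y by (subst (2) n) (simp only: power_Suc2)
    also have "\<dots> = q_half powi ?e / q_half * p"
      using q_half_square by simp
    finally show ?thesis .
  qed
  also have "q_half powi ?e / q_half = q_half powi (?e - 1)"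
    using q_half_nonzero by (simp add: power_int_diff)
  finally show ?thesis using nat_laurent_nat_polys[of p "?e - 1"] p(1) by simp
qed

lemma nat_laurent_trivial:
  assumes "(1 :: motivic) = 0"
  shows "x \<in> nat_laurent"
proof -
  have "x = x * 1" by simp
  also have "\<dots> = of_rat_fun 0" by (simp only: assms mult_zero_right of_rat_fun_0)
  finally show ?thesis using nat_laurent_nat_polys[OF nat_polys.zero, of 0] by simp
qed

text \<open>
  Rational functions form a field, so a ring homomorphism from it to a nontrivial ring is injective.
\<close>

lemma of_rat_fun_eq_0:
  assumes "(1 :: motivic) \<noteq> 0" "of_rat_fun x = 0"
  shows "x = 0"
proof (rule ccontr)
  assume "x \<noteq> 0"
  then have "1 = of_rat_fun x * of_rat_fun (inverse x)" by (simp add: of_rat_fun_mult of_rat_fun_1)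
  then show False using assms by simp
qed

theorem theorem1p3:
  fixes Q :: "('v, 'e) pre_digraph"
    and Z :: "('v \<Rightarrow>\<^sub>0 int) \<Rightarrow> complex"
    and l :: "complex set"
    and \<alpha> :: "'v \<Rightarrow>\<^sub>0 int"
  assumes "quiver Q"
    and "stability_function Q Z"
    and "is_ray l"
    and "\<And>\<beta> \<gamma>. \<lbrakk>\<beta> \<in> Gamma_plus Q - {0}; \<gamma> \<in> Gamma_plus Q - {0}; Z \<beta> \<in> l; Z \<gamma> \<in> l;
           f_inv Q Z \<beta> \<noteq> 0; f_inv Q Z \<gamma> \<noteq> 0\<rbrakk> \<Longrightarrow> antisym_form Q \<beta> \<gamma> = 0"
    and "\<alpha> \<in> Gamma_plus Q - {0}"
    and "Z \<alpha> \<in> l"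
  shows "abelian_invariant Q Z l \<alpha> \<in> nat_laurent"
proof (cases "(1 :: motivic) = 0")
  case True
  then show ?thesis by (rule nat_laurent_trivial)
next
  \<comment> \<open>Rational functions now embed, so that \<open>f\<^sub>Z\<close> vanishes only if the corresponding count does.\<close>
  case nontrivial: False
  note Q = assms(1) and Z = assms(2)
  obtain u where u: "u \<in> upper_half" and l: "l = {of_real r * u | r. r > 0}"
    using assms(3) unfolding is_ray_def by blast
  let ?g = "abelian_invariant Q Z l"
  have g: "is_abelian_invariant Q Z l ?g"
    by (rule is_abelian_invariant_abelian_invariant[OF Z assms(3)])
  \<comment> \<open>Vertex sets with a nonzero count have dimension vectors to which the hypothesis applies.\<close>
  have cls: "layer_dim W \<in> Gamma_plus Q - {0} \<and> Z (layer_dim W) \<in> l \<and> f_inv Q Z (layer_dim W) \<noteq> 0"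
    if W: "finite W" "fst ` W \<subseteq> verts Q" "W \<noteq> {}" and nz: "ray_count Q Z u W \<noteq> 0" for W
  proof -
    have 1: "layer_dim W \<in> Gamma_plus Q" "layer_dim W \<noteq> 0"
      using W layer_dim_Gamma_plus layer_dim_eq_0_iff by auto
    have 2: "Z (layer_dim W) \<in> l"
      using on_ray_iff_weight[OF Q Z u l W] ray_count_nonzeroD[OF nz] by simp
    have "f_inv Q Z (layer_dim W) = of_rat_fun (ray_count Q Z u (layers Q (layer_dim W)))"
      by (rule f_inv_eq_ray_count[OF Q Z u l 1 2])
    also have "ray_count Q Z u (layers Q (layer_dim W)) = ray_count Q Z u W"
      by (rule ray_count_cong[OF finite_layers W(1) layer_dim_layers[OF 1(1)]])
    finally have "f_inv Q Z (layer_dim W) \<noteq> 0" using of_rat_fun_eq_0[OF nontrivial] nz by auto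
    with 1 2 show ?thesis by simp
  qed
  have orth: "card (arrows_between Q W U) = card (arrows_between Q U W)"
    if W: "finite W" "finite U" "fst ` W \<subseteq> verts Q" "fst ` U \<subseteq> verts Q"
      and nz: "ray_count Q Z u W \<noteq> 0" "ray_count Q Z u U \<noteq> 0" for W U
  proof (cases "W = {} \<or> U = {}")
    case True
    then show ?thesis by (auto simp: thickened.arrows_from_def)
  next
    case False
    have "antisym_form Q (layer_dim W) (layer_dim U) = 0"
      using cls[OF W(1,3) _ nz(1)] cls[OF W(2,4) _ nz(2)] False by (intro assms(4)) auto
    then show ?thesis
      using arrow_form_layer_dim[OF Q W(1,2,3,4)] arrow_form_layer_dim[OF Q W(2,1,4,3)]
      by (simp add: antisym_form_def)
  qed
  let ?V = "layers Q \<alpha>"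
  have V: "finite ?V" "fst ` ?V \<subseteq> verts Q" by (rule finite_layers, rule layers_verts)
  have dim: "layer_dim ?V = \<alpha>" using assms(5) by (intro layer_dim_layers) simp
  then have "?V \<noteq> {}" using assms(5) by (auto simp: layer_dim_def)
  then obtain v where v: "v \<in> ?V" by blast
  have k: "q_half - 1 / q_half \<noteq> 0"
    using q_half_nonzero q_half_square by (simp add: field_simps power2_eq_square)
  have "?g \<alpha> = log_coeff Q Z l ?g (layer_dim ?V) * of_rat_fun (of_nat (multi_fact (layer_dim ?V))) * of_rat_fun (q_half - 1 / q_half)"
  proof -
    have "log_coeff Q Z l ?g \<alpha> = ?g \<alpha> * of_rat_fun (1 / of_nat (multi_fact \<alpha>)) * of_rat_fun (1 / (q_half - 1 / q_half))"
      using assms(5,6) by (simp add: log_coeff_def ray_series_def ray_classes_def)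
    then show ?thesis unfolding dim
      using k by (simp add: mult.assoc of_rat_fun_mult multi_fact_nonzero of_rat_fun_1)
  qed
  also have "\<dots> = of_rat_fun (pointed_count Q Z u v ?V * (q_half - 1 / q_half))"
    using log_coeff_eq_pointed_count[OF Q Z u l g orth V v] by (simp add: of_rat_fun_mult)
  also have "\<dots> \<in> nat_laurent" by (rule pointed_count_nat_laurent[OF Q V v])
  finally show ?thesis .
qed

end
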